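(* Let $\mathcal{H}$ be a Hilbert space and let $\mathcal{A}$ be an abelian C*-subalgebra of $\mathcal{B}(\mathcal{H})$ for which there is a locally compact space $E$ and an injective $*$-homomorphism $F:\mathcal{A}\to\mathcal{C}_b(E)$. Let $T\in\mathcal{A}\otimes^{eh}\mathcal{A}$ and $u=(F\otimes F)T$, so that $u\in F(\mathcal{A})\otimes^{eh}F(\mathcal{A})\subset\mathrm{V}^b(E)$. The following are equivalent: (i) $T$ is positive (as a map on $\mathcal{B}(\mathcal{H})$). (ii) $T$ is completely positive (as a map on $\mathcal{B}(\mathcal{H})$). (iii) $u$ is positive definite on $E\times E$.
   Context: For closed subspaces $\mathcal{V},\mathcal{W}$ of $\mathcal{B}(\mathcal{H})$, the extended Haagerup tensor product $\mathcal{V}\otimes^{eh}\mathcal{W}$ is the space of formal series $T=\sum_{i\in I}v_i\otimes w_i$ with $v_i\in\mathcal{V}$, $w_i\in\mathcal{W}$, such that $\sum_i v_iv_i^*$ and $\sum_i w_i^*w_i$ converge weak* in $\mathcal{B}(\mathcal{H})$; two series are identified if they define the same map $x\mapsto\sum_i v_ixw_i$ on $\mathcal{B}(\mathcal{H})$. Elements are identified with these maps $Tx=\sum_i v_ixw_i$, which are normal completely bounded maps on $\mathcal{B}(\mathcal{H})$. $\mathcal{C}_b(E)$ is the C*-algebra of bounded continuous complex functions on $E$. $\mathrm{V}^b(E)=\mathcal{C}_b(E)\otimes^{eh}\mathcal{C}_b(E)$, regarded as an algebra of functions on $E\times E$: its elements are the functions $u(x,y)=\sum_{i\in I}\varphi_i(x)\psi_i(y)$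 with $\varphi_i,\psi_i\in\mathcal{C}_b(E)$ and $\sup_x\sum_i|\varphi_i(x)|^2<\infty$, $\sup_y\sum_i|\psi_i(y)|^2<\infty$; $F(\mathcal{A})\otimes^{eh}F(\mathcal{A})$ is the subset of those with a representation having all $\varphi_i,\psi_i\in F(\mathcal{A})$. The map $F\otimes F:\mathcal{A}\otimes^{eh}\mathcal{A}\to\mathrm{V}^b(E)$ is the (well-defined, isometric) algebra homomorphism sending $\sum_i a_i\otimes b_i$ to the function $(x,y)\mapsto\sum_i F(a_i)(x)F(b_i)(y)$. A function $u:E\times E\to\mathbb{C}$ is positive definite if for every finite collection $x_1,\dots,x_n\in E$ the matrix $[u(x_i,x_j)]$ is of positive type (positive semidefinite). *)

theory Defs
  imports "HOL-Analysis.Analysis"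
begin

subsection \<open>Complex Hilbert spaces and bounded operators\<close>

text \<open>
  A complex Hilbert space, presented over its underlying real Hilbert space: the real inner
  product is the real part of the complex one, so in particular the norm of \<open>x\<close> is
  \<open>sqrt (Re (cinner x x))\<close>.  The complex inner product is linear in its first argument.
\<close>

class complex_hilbert = real_inner + complete_space +
  fixes scaleC :: "complex \<Rightarrow> 'a \<Rightarrow> 'a"  (infixr \<open>*\<^sub>C\<close> 75)
    and cinner :: "'a \<Rightarrow> 'a \<Rightarrow> complex"
  assumes scaleC_add_right: "c *\<^sub>C (x + y) = c *\<^sub>C x + c *\<^sub>C y"
    and scaleC_add_left: "(c + d) *\<^sub>C x = c *\<^sub>C x + d *\<^sub>C x"
    and scaleC_scaleC: "c *\<^sub>C (d *\<^sub>C x) = (c * d) *\<^sub>C x"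
    and scaleC_of_real: "complex_of_real r *\<^sub>C x = r *\<^sub>R x"
    and cinner_commute: "cinner x y = cnj (cinner y x)"
    and cinner_add_left: "cinner (x + y) z = cinner x z + cinner y z"
    and cinner_scaleC_left: "cinner (c *\<^sub>C x) y = c * cinner x y"
    and Re_cinner: "Re (cinner x y) = inner x y"

text \<open>
  \<open>\<B>(\<H>)\<close> consists of the complex-linear elements of the space of bounded real-linear
  operators; the operator norm, hence the norm topology, is inherited from that space.
\<close>

definition bops :: "('h::complex_hilbert \<Rightarrow>\<^sub>L 'h) set" where
  "bops = {x :: 'h \<Rightarrow>\<^sub>L 'h. \<forall>c \<xi>. x (c *\<^sub>C \<xi>) = c *\<^sub>C x \<xi>}"

definition op_scaleC :: "complex \<Rightarrow> ('h::complex_hilbert \<Rightarrow>\<^sub>L 'h) \<Rightarrow> ('h \<Rightarrow>\<^sub>L 'h)" where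
  "op_scaleC c x = Blinfun (\<lambda>\<xi>. c *\<^sub>C x \<xi>)"

lemma norm_scaleC: "norm (c *\<^sub>C (x::'h::complex_hilbert)) = cmod c * norm x"
proof -
  have self: "cinner x x = complex_of_real ((norm x)\<^sup>2)"
  proof -
    have "Im (cinner x x) = 0"
      using arg_cong[OF cinner_commute[of x x], of Im] by simp
    then show ?thesis
      by (simp add: complex_eq_iff Re_cinner power2_norm_eq_inner)
  qed
  have "cinner (c *\<^sub>C x) (c *\<^sub>C x) = c * cnj (c * cinner x x)"
    by (metis cinner_commute cinner_scaleC_left)
  also have "\<dots> = complex_of_real ((cmod c * norm x)\<^sup>2)"
    unfolding self by (simp add: complex_norm_square[symmetric] power_mult_distrib mult.assoc[symmetric])
  finally have "(norm (c *\<^sub>C x))\<^sup>2 = (cmod c * norm x)\<^sup>2"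
    by (metis Re_cinner Re_complex_of_real power2_norm_eq_inner)
  then show ?thesis
    by (simp add: power2_eq_iff_nonneg)
qed

lemma op_scaleC_apply: "op_scaleC c x \<xi> = c *\<^sub>C x \<xi>"
proof -
  have "bounded_linear (\<lambda>\<xi>::'a. c *\<^sub>C \<xi>)"
  proof (rule bounded_linear_intro[where K = "cmod c"])
    fix r and \<xi> :: 'a
    show "c *\<^sub>C (r *\<^sub>R \<xi>) = r *\<^sub>R (c *\<^sub>C \<xi>)"
      by (simp add: scaleC_of_real[symmetric] scaleC_scaleC mult.commute)
  qed (simp_all add: scaleC_add_right norm_scaleC mult.commute)
  then have "bounded_linear (\<lambda>\<xi>. c *\<^sub>C x \<xi>)"
    by (rule bounded_linear_compose) (rule blinfun.bounded_linear_right)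
  then show ?thesis
    by (simp add: op_scaleC_def bounded_linear_Blinfun_apply)
qed

definition adj :: "('h::complex_hilbert \<Rightarrow>\<^sub>L 'h) \<Rightarrow> ('h \<Rightarrow>\<^sub>L 'h)" where
  "adj x = (THE y :: 'h \<Rightarrow>\<^sub>L 'h. \<forall>\<xi> \<eta>. cinner (x \<xi>) \<eta> = cinner \<xi> (y \<eta>))"

definition abelian_cstar_subalgebra :: "('h::complex_hilbert \<Rightarrow>\<^sub>L 'h) set \<Rightarrow> bool" where
  "abelian_cstar_subalgebra A \<longleftrightarrow>
     A \<subseteq> bops \<and> 0 \<in> A \<and>
     (\<forall>a\<in>A. \<forall>b\<in>A. a + b \<in> A) \<and>
     (\<forall>c. \<forall>a\<in>A. op_scaleC c a \<in> A) \<and>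
     (\<forall>a\<in>A. \<forall>b\<in>A. a o\<^sub>L b \<in> A) \<and>
     (\<forall>a\<in>A. adj a \<in> A) \<and>
     closed A \<and>
     (\<forall>a\<in>A. \<forall>b\<in>A. a o\<^sub>L b = b o\<^sub>L a)"

definition star_hom_on ::
  "('h::complex_hilbert \<Rightarrow>\<^sub>L 'h) set \<Rightarrow> (('h \<Rightarrow>\<^sub>L 'h) \<Rightarrow> ('e::topological_space \<Rightarrow>\<^sub>C complex)) \<Rightarrow> bool"
  where
  "star_hom_on A F \<longleftrightarrow>
     (\<forall>a\<in>A. \<forall>b\<in>A. \<forall>x. F (a + b) x = F a x + F b x) \<and>
     (\<forall>c. \<forall>a\<in>A. \<forall>x. F (op_scaleC c a) x = c * F a x) \<and>
     (\<forall>a\<in>A. \<forall>b\<in>A. \<forall>x. F (a o\<^sub>L b) x = F a x * F b x) \<and>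
     (\<forall>a\<in>A. \<forall>x. F (adj a) x = cnj (F a x))"


subsection \<open>The extended Haagerup tensor product\<close>

text \<open>
  The weak* topology of \<open>\<B>(\<H>)\<close> comes from its predual, the trace-class operators; it is
  generated by the functionals \<open>x \<mapsto> \<Sum>n. \<langle>x \<xi>\<^sub>n, \<eta>\<^sub>n\<rangle>\<close> with \<open>\<Sum>n. \<parallel>\<xi>\<^sub>n\<parallel>\<^sup>2 < \<infinity>\<close> and
  \<open>\<Sum>n. \<parallel>\<eta>\<^sub>n\<parallel>\<^sup>2 < \<infinity>\<close>.
\<close>

definition weakstar_tendsto ::
  "('j \<Rightarrow> ('h::complex_hilbert \<Rightarrow>\<^sub>L 'h)) \<Rightarrow> ('h \<Rightarrow>\<^sub>L 'h) \<Rightarrow> 'j filter \<Rightarrow> bool" where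
  "weakstar_tendsto f S \<FF> \<longleftrightarrow>
     S \<in> bops \<and>
     (\<forall>\<xi> \<eta>. summable (\<lambda>n::nat. (norm (\<xi> n))\<^sup>2) \<longrightarrow> summable (\<lambda>n. (norm (\<eta> n))\<^sup>2) \<longrightarrow>
        ((\<lambda>j. \<Sum>n. cinner (f j (\<xi> n)) (\<eta> n)) \<longlongrightarrow> (\<Sum>n. cinner (S (\<xi> n)) (\<eta> n))) \<FF>)"

definition weakstar_has_sum ::
  "('i \<Rightarrow> ('h::complex_hilbert \<Rightarrow>\<^sub>L 'h)) \<Rightarrow> 'i set \<Rightarrow> ('h \<Rightarrow>\<^sub>L 'h) \<Rightarrow> bool" where
  "weakstar_has_sum f I S \<longleftrightarrow> weakstar_tendsto (\<lambda>J. \<Sum>i\<in>J. f i) S (finite_subsets_at_top I)"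

definition eh_series ::
  "('h::complex_hilbert \<Rightarrow>\<^sub>L 'h) set \<Rightarrow> ('h \<Rightarrow>\<^sub>L 'h) set \<Rightarrow> 'i set \<Rightarrow>
   ('i \<Rightarrow> ('h \<Rightarrow>\<^sub>L 'h)) \<Rightarrow> ('i \<Rightarrow> ('h \<Rightarrow>\<^sub>L 'h)) \<Rightarrow> bool" where
  "eh_series V W I v w \<longleftrightarrow>
     (\<forall>i\<in>I. v i \<in> V \<and> w i \<in> W) \<and>
     (\<exists>S. weakstar_has_sum (\<lambda>i. v i o\<^sub>L adj (v i)) I S) \<and>
     (\<exists>S. weakstar_has_sum (\<lambda>i. adj (w i) o\<^sub>L w i) I S)"

text \<open>
  The map \<open>x \<mapsto> \<Sum>i\<in>I. v\<^sub>i x w\<^sub>i\<close> on \<open>\<B>(\<H>)\<close>.  It is made extensional, so that two series define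
  the same map on \<open>\<B>(\<H>)\<close> exactly if their \<open>eh_map\<close>s are equal.
\<close>

definition eh_map ::
  "'i set \<Rightarrow> ('i \<Rightarrow> ('h::complex_hilbert \<Rightarrow>\<^sub>L 'h)) \<Rightarrow> ('i \<Rightarrow> ('h \<Rightarrow>\<^sub>L 'h)) \<Rightarrow> ('h \<Rightarrow>\<^sub>L 'h) \<Rightarrow> ('h \<Rightarrow>\<^sub>L 'h)"
  where
  "eh_map I v w = (\<lambda>x\<in>bops. THE S. weakstar_has_sum (\<lambda>i. v i o\<^sub>L x o\<^sub>L w i) I S)"

text \<open>
  The type argument supplies the index sets of the series; a statement about an arbitrary
  extended Haagerup tensor has to be polymorphic in it.
\<close>

definition eh_tensor ::
  "'i itself \<Rightarrow> ('h::complex_hilbert \<Rightarrow>\<^sub>L 'h) set \<Rightarrow> ('h \<Rightarrow>\<^sub>L 'h) set \<Rightarrow> (('h \<Rightarrow>\<^sub>L 'h) \<Rightarrow> ('h \<Rightarrow>\<^sub>L 'h)) set"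
  where
  "eh_tensor t V W = {eh_map I v w | (I :: 'i set) v w. eh_series V W I v w}"

definition fun_tensor :: "'i set \<Rightarrow> ('i \<Rightarrow> 'e \<Rightarrow> complex) \<Rightarrow> ('i \<Rightarrow> 'e \<Rightarrow> complex) \<Rightarrow> 'e \<times> 'e \<Rightarrow> complex"
  where
  "fun_tensor I \<phi> \<psi> = (\<lambda>(x, y). \<Sum>\<^sub>\<infinity>i\<in>I. \<phi> i x * \<psi> i y)"

definition eh_fun_tensor ::
  "'i itself \<Rightarrow> ('e::topological_space \<Rightarrow>\<^sub>C complex) set \<Rightarrow> ('e \<times> 'e \<Rightarrow> complex) set" where
  "eh_fun_tensor t B =
     {fun_tensor I (\<lambda>i. apply_bcontfun (\<phi> i)) (\<lambda>i. apply_bcontfun (\<psi> i)) | (I :: 'i set) \<phi> \<psi>.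
        (\<forall>i\<in>I. \<phi> i \<in> B \<and> \<psi> i \<in> B) \<and>
        (\<exists>C. \<forall>x. (\<lambda>i. (cmod (\<phi> i x))\<^sup>2) summable_on I \<and> (\<Sum>\<^sub>\<infinity>i\<in>I. (cmod (\<phi> i x))\<^sup>2) \<le> C) \<and>
        (\<exists>C. \<forall>y. (\<lambda>i. (cmod (\<psi> i y))\<^sup>2) summable_on I \<and> (\<Sum>\<^sub>\<infinity>i\<in>I. (cmod (\<psi> i y))\<^sup>2) \<le> C)}"

abbreviation Vb :: "'i itself \<Rightarrow> ('e::topological_space \<times> 'e \<Rightarrow> complex) set" where
  "Vb t \<equiv> eh_fun_tensor t (UNIV :: ('e \<Rightarrow>\<^sub>C complex) set)"

text \<open>
  The map \<open>F \<otimes> F\<close> on \<open>\<A> \<otimes>\<^sup>e\<^sup>h \<A>\<close>; the description is unique because the function does not depend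
  on the series chosen to represent \<open>T\<close>.
\<close>

definition hom_tensor ::
  "'i itself \<Rightarrow> ('h::complex_hilbert \<Rightarrow>\<^sub>L 'h) set \<Rightarrow> (('h \<Rightarrow>\<^sub>L 'h) \<Rightarrow> ('e::topological_space \<Rightarrow>\<^sub>C complex)) \<Rightarrow>
   (('h \<Rightarrow>\<^sub>L 'h) \<Rightarrow> ('h \<Rightarrow>\<^sub>L 'h)) \<Rightarrow> 'e \<times> 'e \<Rightarrow> complex" where
  "hom_tensor t A F T =
     (THE u. \<exists>(I :: 'i set) a b. eh_series A A I a b \<and> T = eh_map I a b \<and>
        u = fun_tensor I (\<lambda>i. apply_bcontfun (F (a i))) (\<lambda>i. apply_bcontfun (F (b i))))"


subsection \<open>Positivity\<close>

definition positive_op :: "('h::complex_hilbert \<Rightarrow>\<^sub>L 'h) \<Rightarrow> bool" where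
  "positive_op x \<longleftrightarrow> x \<in> bops \<and> (\<forall>\<xi>. cinner (x \<xi>) \<xi> \<in> \<real>\<^sub>\<ge>\<^sub>0)"

definition positive_map :: "(('h::complex_hilbert \<Rightarrow>\<^sub>L 'h) \<Rightarrow> ('h \<Rightarrow>\<^sub>L 'h)) \<Rightarrow> bool" where
  "positive_map T \<longleftrightarrow> (\<forall>x. positive_op x \<longrightarrow> positive_op (T x))"

text \<open>
  An \<open>n \<times> n\<close> matrix over \<open>\<B>(\<H>)\<close> acts on the \<open>n\<close>-fold direct sum of \<open>\<H>\<close>, by
  \<open>(X \<xi>)\<^sub>i = \<Sum>j<n. X\<^sub>i\<^sub>j \<xi>\<^sub>j\<close>; it is positive if it is a positive operator there.
\<close>

definition positive_op_matrix :: "nat \<Rightarrow> (nat \<Rightarrow> nat \<Rightarrow> ('h::complex_hilbert \<Rightarrow>\<^sub>L 'h)) \<Rightarrow> bool" where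
  "positive_op_matrix n X \<longleftrightarrow>
     (\<forall>i<n. \<forall>j<n. X i j \<in> bops) \<and>
     (\<forall>\<xi>. (\<Sum>i<n. cinner (\<Sum>j<n. X i j (\<xi> j)) (\<xi> i)) \<in> \<real>\<^sub>\<ge>\<^sub>0)"

definition completely_positive_map :: "(('h::complex_hilbert \<Rightarrow>\<^sub>L 'h) \<Rightarrow> ('h \<Rightarrow>\<^sub>L 'h)) \<Rightarrow> bool" where
  "completely_positive_map T \<longleftrightarrow>
     (\<forall>n X. positive_op_matrix n X \<longrightarrow> positive_op_matrix n (\<lambda>i j. T (X i j)))"

definition psd_matrix :: "nat \<Rightarrow> (nat \<Rightarrow> nat \<Rightarrow> complex) \<Rightarrow> bool" where
  "psd_matrix n M \<longleftrightarrow> (\<forall>c. (\<Sum>i<n. \<Sum>j<n. cnj (c i) * M i j * c j) \<in> \<real>\<^sub>\<ge>\<^sub>0)"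

definition positive_definite_fun :: "('e \<times> 'e \<Rightarrow> complex) \<Rightarrow> bool" where
  "positive_definite_fun u \<longleftrightarrow> (\<forall>n (x :: nat \<Rightarrow> 'e). psd_matrix n (\<lambda>i j. u (x i, x j)))"

end

theory Submission
  imports Defs
begin

text \<open>
  All three conditions are compared with the following one: \<open>\<Sum>i. cnj (h(a\<^sub>i\<^sup>*)) h(b\<^sub>i) \<ge> 0\<close> for every
  bounded functional \<open>h\<close> on \<open>\<A>\<close>, where \<open>T = \<Sum>i. a\<^sub>i \<otimes> b\<^sub>i\<close>. For linear combinations \<open>h\<close> of the
  characters \<open>a \<mapsto> F a x\<close> it says that \<open>u\<close> is positive definite, and for \<open>h a = \<langle>a \<zeta>, \<theta>\<rangle>\<close> it says that
  \<open>\<langle>T(\<theta> \<otimes> \<theta>\<^sup>*) \<zeta>, \<zeta>\<rangle> \<ge> 0\<close>. Both families of functionals are norming (the first because \<open>F\<close> is isometric),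
  and a norming convex set of functionals approximates every bounded functional in the \<open>l\<^sup>2\<close> norm along
  \<open>(a\<^sub>i\<^sup>*, b\<^sub>i)\<close>. In the second case a sum \<open>\<Sum>k. \<langle>a \<xi>\<^sub>k, \<eta>\<^sub>k\<rangle>\<close> reduces to a single term because finitely many
  vectors \<open>\<xi>\<^sub>k\<close> lie in the closure of \<open>\<A>' \<zeta>\<close> for one \<open>\<zeta>\<close>. Conversely the condition implies complete
  positivity: a positive matrix \<open>X\<close> and vectors \<open>\<xi>\<^sub>k\<close> define a positive form \<open>s\<close> on \<open>\<A>\<close> with
  \<open>\<Sum>i. s(b\<^sub>i, a\<^sub>i\<^sup>*)\<close> the number to be shown nonnegative, and Schur complements decompose \<open>s\<close> into
  forms \<open>h \<otimes> cnj h\<close> up to a small tail.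
\<close>

section \<open>Complex Hilbert spaces\<close>

text \<open>Point evaluations through \<open>F\<close> and vector functionals of the Hilbert space
  are unrelated families on \<open>A\<close>, so neither positivity test can be rewritten into the
  other; arbitrary bounded functionals are the common ground. The adjoint sits on \<open>a i\<close>
  because \<open>\<lambda>a. cnj (h (adj a))\<close> is again linear, and a character equals its own
  conjugate.

  The form in question is an infinite series quadratic in h. Weak* convergence of functionals does
  not pass through it; l2 convergence along the two families does. The bipolar theorem would make a
  convex norming subset of a ball of functionals weak* dense, and convexity would turn weak into
  norm approximation in l2; a descent argument gives both at once, without separating hyperplanes.

  A positive form on \<open>A\<close> need not be a finite sum of rank-one forms, but only finitely
  many \<open>b i\<close> matter up to a small tail, so it suffices to remove their directions.
  \<open>A\<close> may lack a unit, which is why quasi-inverses and multipliers replace inverses and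
  functional calculus in the study of \<open>F\<close>.\<close>

instance complex_hilbert \<subseteq> banach ..

lemma scaleR_eq_scaleC: "r *\<^sub>R x = complex_of_real r *\<^sub>C (x::'h::complex_hilbert)"
  by (simp add: scaleC_of_real)

lemma cinner_scaleC_right: "cinner (x::'h::complex_hilbert) (c *\<^sub>C y) = cnj c * cinner x y"
  by (metis cinner_commute cinner_scaleC_left complex_cnj_mult)

lemma cinner_add_right: "cinner (x::'h::complex_hilbert) (y + z) = cinner x y + cinner x z"
  by (metis cinner_add_left cinner_commute complex_cnj_add)

lemma cinner_self: "cinner (x::'h::complex_hilbert) x = complex_of_real ((norm x)\<^sup>2)"
proof -
  have "Im (cinner x x) = 0"
    using arg_cong[OF cinner_commute[of x x], of Im] by simp
  then show ?thesis
    by (simp add: complex_eq_iff Re_cinner power2_norm_eq_inner)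
qed

text \<open>Rotating \<open>x\<close> by the phase \<open>c\<close> makes \<open>cinner x y\<close>
  real and nonnegative, where the real Cauchy-Schwarz inequality applies.\<close>

lemma norm_cinner_le: "cmod (cinner (x::'h::complex_hilbert) y) \<le> norm x * norm y"
proof (cases "cinner x y = 0")
  case False
  define c where "c = cnj (cinner x y) / cmod (cinner x y)"
  have c: "cmod c = 1"
    using False by (simp add: c_def norm_divide)
  have "c * cinner x y = complex_of_real (cmod (cinner x y))"
    using False by (simp add: c_def complex_norm_square[symmetric] power2_eq_square mult.commute)
  then have "cmod (cinner x y) = Re (cinner (c *\<^sub>C x) y)"
    by (simp add: cinner_scaleC_left)
  also have "\<dots> \<le> norm (c *\<^sub>C x) * norm y"
    by (simp add: Re_cinner norm_cauchy_schwarz)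
  finally show ?thesis
    by (simp add: norm_scaleC c)
qed simp

interpretation cinner: bounded_bilinear "cinner :: 'h::complex_hilbert \<Rightarrow> 'h \<Rightarrow> complex"
proof
  fix a b :: 'h and r :: real
  show "cinner (r *\<^sub>R a) b = r *\<^sub>R cinner a b"
    by (simp add: scaleR_eq_scaleC cinner_scaleC_left scaleR_conv_of_real)
  show "cinner a (r *\<^sub>R b) = r *\<^sub>R cinner a b"
    by (simp add: scaleR_eq_scaleC cinner_scaleC_right scaleR_conv_of_real)
  show "\<exists>K. \<forall>a b. norm (cinner (a::'h) b) \<le> norm a * norm b * K"
    by (intro exI[of _ 1]) (simp add: norm_cinner_le)
qed (simp_all add: cinner_add_left cinner_add_right)

interpretation scaleC: bounded_bilinear "scaleC :: complex \<Rightarrow> 'h::complex_hilbert \<Rightarrow> 'h"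
proof
  fix c :: complex and b :: 'h and r :: real
  show "(r *\<^sub>R c) *\<^sub>C b = r *\<^sub>R (c *\<^sub>C b)"
    by (simp add: scaleR_eq_scaleC scaleC_scaleC scaleR_conv_of_real)
  show "c *\<^sub>C (r *\<^sub>R b) = r *\<^sub>R (c *\<^sub>C b)"
    by (simp add: scaleR_eq_scaleC scaleC_scaleC mult.commute)
  show "\<exists>K. \<forall>a b. norm (a *\<^sub>C (b::'h)) \<le> norm a * norm b * K"
    by (intro exI[of _ 1]) (simp add: norm_scaleC)
qed (simp_all add: scaleC_add_left scaleC_add_right)

lemma scaleC_minus_one [simp]: "(- 1) *\<^sub>C (x::'h::complex_hilbert) = - x"
  using scaleC_of_real[of "-1" x] by simp

lemma Im_cinner: "Im (cinner x y) = inner x (\<i> *\<^sub>C (y::'h::complex_hilbert))"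
  by (simp add: Re_cinner[symmetric] cinner_scaleC_right)

lemma cinner_eqI:
  fixes x y :: "'h::complex_hilbert"
  assumes "\<And>z. cinner x z = cinner y z"
  shows "x = y"
proof -
  have "cinner (x - y) (x - y) = 0"
    by (simp add: assms cinner.diff_left)
  then show ?thesis
    by (simp add: cinner_self)
qed

section \<open>Closure properties of the bounded operators\<close>

lemma bops_scaleC: "x \<in> bops \<Longrightarrow> blinfun_apply x (c *\<^sub>C \<xi>) = c *\<^sub>C x \<xi>"
  by (simp add: bops_def)

lemma bops_eqI:
  fixes x y :: "'h::complex_hilbert \<Rightarrow>\<^sub>L 'h"
  assumes "\<And>\<xi> \<eta>. cinner (x \<xi>) \<eta> = cinner (y \<xi>) \<eta>"
  shows "x = y"
  by (rule blinfun_eqI, rule cinner_eqI) (rule assms)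

lemma bops_id: "id_blinfun \<in> bops"
  by (simp add: bops_def)

lemma bops_add: "x \<in> bops \<Longrightarrow> y \<in> bops \<Longrightarrow> x + y \<in> bops"
  by (simp add: bops_def blinfun.add_left scaleC_add_right)

lemma bops_scale: "x \<in> bops \<Longrightarrow> op_scaleC c x \<in> bops"
  by (simp add: bops_def op_scaleC_apply scaleC_scaleC mult.commute)

lemma bops_scaleR: "x \<in> bops \<Longrightarrow> r *\<^sub>R x \<in> bops"
  by (simp add: bops_def blinfun.scaleR_left scaleC.scaleR_right)

lemma bops_compose: "x \<in> bops \<Longrightarrow> y \<in> bops \<Longrightarrow> x o\<^sub>L y \<in> bops"
  by (simp add: bops_def)

lemma norm_op_scaleC: "norm (op_scaleC c x) \<le> cmod c * norm (x :: 'h::complex_hilbert \<Rightarrow>\<^sub>L 'h)"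
proof (rule norm_blinfun_bound)
  fix \<xi>
  have "norm (op_scaleC c x \<xi>) = cmod c * norm (x \<xi>)"
    by (simp add: op_scaleC_apply norm_scaleC)
  also have "\<dots> \<le> cmod c * (norm x * norm \<xi>)"
    by (intro mult_left_mono norm_blinfun) auto
  finally show "norm (op_scaleC c x \<xi>) \<le> cmod c * norm x * norm \<xi>"
    by (simp add: mult.assoc)
qed auto

section \<open>Orthogonal projections, the Riesz representation and adjoints\<close>

text \<open>A minimizing sequence is Cauchy by the parallelogram law, and its limit is the foot of
  the perpendicular. Only the real inner product occurs, so kernels of real functionals are covered
  as well as complex subspaces.\<close>

lemma orthogonal_decomposition_exists:
  fixes V :: "'h::{real_inner, complete_space} set"
  assumes sub: "subspace V" and cl: "closed V"
  shows "\<exists>p\<in>V. \<forall>v\<in>V. inner (x - p) v = 0"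
proof -
  define m where "m = (INF v\<in>V. norm (x - v))"
  have V0: "0 \<in> V"
    using sub by (rule subspace_0)
  have bdd: "bdd_below ((\<lambda>v. norm (x - v)) ` V)"
    by (intro bdd_belowI2[where m = 0]) simp
  have m_le: "m \<le> norm (x - v)" if "v \<in> V" for v
    unfolding m_def using bdd that by (rule cINF_lower)
  have m0: "0 \<le> m"
    unfolding m_def using V0 by (intro cINF_greatest) auto
  have "\<exists>v\<in>V. norm (x - v) < m + 1 / Suc n" for n
  proof -
    have "m < m + 1 / Suc n" by simp
    then show ?thesis
      unfolding m_def using V0 bdd by (subst (asm) cINF_less_iff) auto
  qed
  then obtain v where vV: "\<And>n. v n \<in> V" and v_less: "\<And>n. norm (x - v n) < m + 1 / Suc n"
    by metis
  \<comment> \<open>Midpoints stay in \<open>V\<close>, so their distance from \<open>x\<close> is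
    at least \<open>m\<close>.\<close>
  have para: "(norm (v k - v n))\<^sup>2 \<le> 2 * (m + 1 / Suc k)\<^sup>2 + 2 * (m + 1 / Suc n)\<^sup>2 - 4 * m\<^sup>2" for k n
  proof -
    have "(1/2) *\<^sub>R (v k + v n) \<in> V"
      using vV sub by (intro subspace_scale subspace_add) auto
    then have "m\<^sup>2 \<le> (norm (x - (1/2) *\<^sub>R (v k + v n)))\<^sup>2"
      using m_le m0 by (intro power_mono) auto
    moreover have "(norm (v k - v n))\<^sup>2 = 2 * (norm (x - v k))\<^sup>2 + 2 * (norm (x - v n))\<^sup>2
        - 4 * (norm (x - (1/2) *\<^sub>R (v k + v n)))\<^sup>2"
      unfolding power2_norm_eq_inner
      by (simp add: inner_diff inner_add inner_commute algebra_simps)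
    moreover have "(norm (x - v k))\<^sup>2 \<le> (m + 1 / Suc k)\<^sup>2" "(norm (x - v n))\<^sup>2 \<le> (m + 1 / Suc n)\<^sup>2"
      using v_less[of k] v_less[of n] by (auto intro!: power_mono simp del: of_nat_Suc)
    ultimately show ?thesis by linarith
  qed
  have "Cauchy v"
  proof (rule CauchyI')
    fix e :: real assume e: "0 < e"
    have "(\<lambda>n. 4 * (m + 1 / Suc n)\<^sup>2) \<longlonglongrightarrow> 4 * (m + 0)\<^sup>2"
      by (intro tendsto_intros LIMSEQ_Suc[OF lim_1_over_n])
    moreover have "4 * (m + 0)\<^sup>2 < 4 * m\<^sup>2 + e\<^sup>2"
      using e by simp
    ultimately have "\<forall>\<^sub>F n in sequentially. 4 * (m + 1 / Suc n)\<^sup>2 < 4 * m\<^sup>2 + e\<^sup>2"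
      by (rule order_tendstoD)
    then obtain N where N: "4 * (m + 1 / Suc N)\<^sup>2 < 4 * m\<^sup>2 + e\<^sup>2"
      by (auto simp: eventually_sequentially)
    have mono: "(m + 1 / Suc n)\<^sup>2 \<le> (m + 1 / Suc N)\<^sup>2" if "n \<ge> N" for n
      using that m0 by (intro power_mono add_left_mono divide_left_mono) auto
    show "\<exists>M. \<forall>k\<ge>M. \<forall>n>k. dist (v k) (v n) < e"
    proof (intro exI[of _ N] allI impI)
      fix k n assume "N \<le> k" "k < n"
      then have "(norm (v k - v n))\<^sup>2 < e\<^sup>2"
        using para[of k n] mono[of k] mono[of n] N by linarith
      then show "dist (v k) (v n) < e"
        using e by (simp add: dist_norm power2_less_imp_less)
    qed
  qed
  then obtain p where p: "v \<longlonglongrightarrow> p"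
    by (auto simp: Cauchy_convergent_iff convergent_def)
  have pV: "p \<in> V"
    using cl vV p by (rule closed_sequentially)
  have "norm (x - p) \<le> m"
  proof (rule LIMSEQ_le)
    show "(\<lambda>n. norm (x - v n)) \<longlonglongrightarrow> norm (x - p)"
      by (intro tendsto_intros p)
    have "(\<lambda>n. m + 1 / Suc n) \<longlonglongrightarrow> m + 0"
      by (intro tendsto_intros LIMSEQ_Suc[OF lim_1_over_n])
    then show "(\<lambda>n. m + 1 / Suc n) \<longlonglongrightarrow> m" by simp
  qed (use v_less less_imp_le in blast)
  then have min: "norm (x - p) \<le> norm (x - v)" if "v \<in> V" for v
    using m_le[OF that] by linarith
  have "inner (x - p) v = 0" if v: "v \<in> V" for v
  proof (cases "v = 0")
    case False
    \<comment> \<open>The minimizer of the quadratic function t \<mapsto> norm (x - p - t v)^2; a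
      nonzero inner product would make it beat \<open>p\<close>.\<close>
    define t where "t = inner (x - p) v / (norm v)\<^sup>2"
    have "(norm (x - p))\<^sup>2 \<le> (norm (x - (p + t *\<^sub>R v)))\<^sup>2"
      using v pV sub by (intro power_mono min subspace_add subspace_scale) auto
    also have "\<dots> = (norm (x - p))\<^sup>2 - 2 * t * inner (x - p) v + t\<^sup>2 * (norm v)\<^sup>2"
      unfolding power2_norm_eq_inner
      by (simp add: inner_diff inner_add inner_commute algebra_simps power2_eq_square)
    also have "\<dots> = (norm (x - p))\<^sup>2 - (inner (x - p) v)\<^sup>2 / (norm v)\<^sup>2"
      using False by (simp add: t_def power2_eq_square)
    finally have "(inner (x - p) v)\<^sup>2 \<le> 0"
      using False by (simp add: divide_le_0_iff)
    then show ?thesis by simp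
  qed simp
  with pV show ?thesis by blast
qed

text \<open>The last clause, uniqueness of the foot point, yields linearity of \<open>Q\<close> here
  and later shows that \<open>Q\<close> commutes with operators.\<close>

lemma projection_exists:
  fixes V :: "'h::{real_inner, complete_space} set"
  assumes sub: "subspace V" and cl: "closed V"
  obtains Q :: "'h \<Rightarrow>\<^sub>L 'h" where "\<And>x. Q x \<in> V" "\<And>x v. v \<in> V \<Longrightarrow> inner (x - Q x) v = 0"
    "\<And>x p. p \<in> V \<Longrightarrow> (\<And>v. v \<in> V \<Longrightarrow> inner (x - p) v = 0) \<Longrightarrow> Q x = p"
proof -
  obtain q where qV: "\<And>x. q x \<in> V" and q: "\<And>x v. v \<in> V \<Longrightarrow> inner (x - q x) v = 0"
    using orthogonal_decomposition_exists[OF assms] by metis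
  have uniq: "q x = p" if "p \<in> V" "\<And>v. v \<in> V \<Longrightarrow> inner (x - p) v = 0" for x p
  proof -
    have "q x - p \<in> V"
      using qV that sub by (simp add: subspace_diff)
    then have "inner (q x - p) (q x - p) = 0"
      using that(2)[of "q x - p"] q[of "q x - p" x] by (simp add: inner_diff)
    then show ?thesis by simp
  qed
  have "bounded_linear q"
  proof (rule bounded_linear_intro[where K = 1])
    show "q (x + y) = q x + q y" for x y
    proof (rule uniq)
      show "inner (x + y - (q x + q y)) v = 0" if "v \<in> V" for v
        using q[OF that, of x] q[OF that, of y] by (simp add: inner_diff_left inner_add_left)
    qed (use qV sub in \<open>simp add: subspace_add\<close>)
    show "q (r *\<^sub>R x) = r *\<^sub>R q x" for r x
    proof (rule uniq)
      show "inner (r *\<^sub>R x - r *\<^sub>R q x) v = 0" if "v \<in> V" for v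
        using q[OF that, of x] by (simp add: scaleR_right_diff_distrib[symmetric])
    qed (use qV sub in \<open>simp add: subspace_scale\<close>)
    fix x
    have "inner (x - q x) (q x) = 0"
      using q qV by blast
    then have "(norm (q x))\<^sup>2 = inner x (q x)"
      by (simp add: inner_diff power2_norm_eq_inner)
    also have "\<dots> \<le> norm x * norm (q x)"
      by (rule norm_cauchy_schwarz)
    finally have "norm (q x) * norm (q x) \<le> norm x * norm (q x)"
      by (simp add: power2_eq_square)
    then show "norm (q x) \<le> norm x * 1"
      by (cases "norm (q x) = 0") auto
  qed
  then show ?thesis
    using that[of "Blinfun q"] qV q uniq by (simp add: bounded_linear_Blinfun_apply)
qed

lemma Riesz_representation:
  fixes f :: "'h::{real_inner, complete_space} \<Rightarrow> real"
  assumes f: "bounded_linear f"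
  shows "\<exists>z. \<forall>x. f x = inner z x"
proof (cases "\<forall>x. f x = 0")
  case False
  interpret bounded_linear f by (rule f)
  obtain x0 where x0: "f x0 \<noteq> 0" using False by blast
  define V where "V = {x. f x = 0}"
  have "subspace V"
    by (auto simp: V_def subspace_def add scaleR zero)
  moreover have "closed V"
    unfolding V_def by (intro closed_Collect_eq continuous_intros linear_continuous_on f)
  ultimately obtain p where p: "f p = 0" and orth: "\<And>v. f v = 0 \<Longrightarrow> inner (x0 - p) v = 0"
    using orthogonal_decomposition_exists[of V x0] by (auto simp: V_def)
  define e where "e = x0 - p"
  have fe: "f e = f x0" by (simp add: e_def diff p)
  then have e0: "e \<noteq> 0" using x0 zero by metis
  have "f x = inner ((f e / (norm e)\<^sup>2) *\<^sub>R e) x" for x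
  proof -
    have "inner e (f e *\<^sub>R x - f x *\<^sub>R e) = 0"
      unfolding e_def by (rule orth) (simp add: diff scaleR p)
    then have "f e * inner e x = f x * (norm e)\<^sup>2"
      by (simp add: inner_diff power2_norm_eq_inner)
    then show ?thesis
      using e0 by (simp add: field_simps)
  qed
  then show ?thesis by blast
qed (auto intro: exI[of _ 0])

text \<open>The real Riesz theorem for each functional \<open>\<beta> \<xi>\<close> suffices: the
  hypothesis on scalars is what makes the representing operator complex-linear. Both adjoints and
  the values of the elementary maps are obtained this way.\<close>

lemma bounded_form_represented:
  fixes \<beta> :: "'h::complex_hilbert \<Rightarrow> 'h \<Rightarrow> real"
  assumes "bounded_bilinear \<beta>" and cnj: "\<And>c \<xi> \<eta>. \<beta> (c *\<^sub>C \<xi>) \<eta> = \<beta> \<xi> (cnj c *\<^sub>C \<eta>)"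
  shows "\<exists>S\<in>bops. \<forall>\<xi> \<eta>. inner (blinfun_apply S \<xi>) \<eta> = \<beta> \<xi> \<eta>"
proof -
  interpret bounded_bilinear \<beta> by (rule assms)
  have "\<exists>z. \<forall>\<eta>. \<beta> \<xi> \<eta> = inner z \<eta>" for \<xi>
    by (rule Riesz_representation) (rule bounded_linear_right)
  then obtain s where s: "\<And>\<xi> \<eta>. \<beta> \<xi> \<eta> = inner (s \<xi>) \<eta>" by metis
  have eqI: "x = y" if "\<And>\<eta>. inner x \<eta> = inner y \<eta>" for x y :: 'h
    using that[of "x - y"] by (metis inner_diff_left inner_eq_zero_iff right_minus_eq)
  obtain K where K: "K \<ge> 0" "\<And>\<xi> \<eta>. norm (\<beta> \<xi> \<eta>) \<le> norm \<xi> * norm \<eta> * K"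
    using nonneg_bounded by blast
  have "bounded_linear s"
  proof (rule bounded_linear_intro[where K = K])
    show "s (x + y) = s x + s y" for x y
      by (rule eqI) (simp add: inner_add s[symmetric] add_left)
    show "s (r *\<^sub>R x) = r *\<^sub>R s x" for r x
      by (rule eqI) (simp add: s[symmetric] scaleR_left)
    fix x
    have "norm (s x) * norm (s x) \<le> norm x * norm (s x) * K"
      using K(2)[of x "s x"] by (simp add: s power2_norm_eq_inner[symmetric] power2_eq_square)
    then have "norm (s x) * norm (s x) \<le> (norm x * K) * norm (s x)"
      by (simp add: mult_ac)
    then show "norm (s x) \<le> norm x * K"
      using K(1) by (cases "norm (s x) = 0") (auto simp: mult_le_cancel_right)
  qed
  moreover have "s (c *\<^sub>C x) = c *\<^sub>C s x" for c x
    by (rule eqI) (simp add: s[symmetric] cnj, simp add: s Re_cinner[symmetric] cinner_scaleC_left cinner_scaleC_right)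
  ultimately have "Blinfun s \<in> bops" "\<forall>\<xi> \<eta>. inner (Blinfun s \<xi>) \<eta> = \<beta> \<xi> \<eta>"
    by (auto simp: bops_def bounded_linear_Blinfun_apply s)
  then show ?thesis by blast
qed

section \<open>Adjoints and the C*-identity\<close>

lemma inner_scaleC_left: "inner (c *\<^sub>C x) y = inner x (cnj c *\<^sub>C (y::'h::complex_hilbert))"
  by (simp add: Re_cinner[symmetric] cinner_scaleC_left cinner_scaleC_right)

text \<open>Both sides are conjugate-linear in \<open>\<eta>\<close>, so replacing
  \<open>\<eta>\<close> by \<open>\<i> *\<^sub>C \<eta>\<close> recovers the imaginary part from the
  real one.\<close>

lemma cinner_eq_from_inner:
  assumes "\<And>\<eta>. inner (x::'h::complex_hilbert) \<eta> = Re (f \<eta>)" and "\<And>c \<eta>. f (c *\<^sub>C \<eta>) = cnj c * f \<eta>"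
  shows "cinner x \<eta> = f \<eta>"
  by (rule complex_eqI) (simp_all add: Re_cinner Im_cinner assms)

lemma adj_unique:
  fixes x y :: "'h::complex_hilbert \<Rightarrow>\<^sub>L 'h"
  assumes "\<And>\<xi> \<eta>. cinner (x \<xi>) \<eta> = cinner \<xi> (y \<eta>)"
  shows "adj x = y"
  unfolding adj_def
proof (rule the_equality)
  fix z :: "'h \<Rightarrow>\<^sub>L 'h" assume z: "\<forall>\<xi> \<eta>. cinner (x \<xi>) \<eta> = cinner \<xi> (z \<eta>)"
  show "z = y"
    by (rule bops_eqI) (metis assms cinner_commute z)
qed (use assms in auto)

lemma adj_exists:
  assumes x: "x \<in> bops"
  shows "\<exists>y\<in>bops. \<forall>\<xi> \<eta>. cinner (blinfun_apply x \<xi>) \<eta> = cinner \<xi> (y \<eta>)"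
proof -
  have "bounded_bilinear (\<lambda>\<xi> \<eta>. inner \<xi> (x \<eta>))"
    by (rule bounded_bilinear.comp[OF bounded_bilinear_inner bounded_linear_ident blinfun.bounded_linear_right])
  then obtain y where y: "y \<in> bops" "\<And>\<xi> \<eta>. inner (y \<xi>) \<eta> = inner \<xi> (x \<eta>)"
    using bounded_form_represented[of "\<lambda>\<xi> \<eta>. inner \<xi> (x \<eta>)"] x
    by (auto simp: inner_scaleC_left bops_scaleC)
  have "cinner (y \<xi>) \<eta> = cinner \<xi> (x \<eta>)" for \<xi> \<eta>
    by (rule cinner_eq_from_inner) (use x in \<open>simp_all add: y Re_cinner bops_scaleC cinner_scaleC_right\<close>)
  then have "cinner (x \<xi>) \<eta> = cinner \<xi> (y \<eta>)" for \<xi> \<eta>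
    by (metis cinner_commute)
  with y show ?thesis by blast
qed

lemma cinner_adj_right: "x \<in> bops \<Longrightarrow> cinner \<xi> (adj x \<eta>) = cinner (x \<xi>) \<eta>"
  using adj_exists[of x] adj_unique[of x] by metis

lemma cinner_adj_left: "x \<in> bops \<Longrightarrow> cinner (adj x \<xi>) \<eta> = cinner \<xi> (x \<eta>)"
  by (metis cinner_adj_right cinner_commute)

lemma bops_adj: "x \<in> bops \<Longrightarrow> adj x \<in> bops"
  using adj_exists[of x] adj_unique[of x] by metis

lemma adj_adj: "x \<in> bops \<Longrightarrow> adj (adj x) = x"
  by (rule adj_unique) (rule cinner_adj_left)

lemma adj_compose: "x \<in> bops \<Longrightarrow> y \<in> bops \<Longrightarrow> adj (x o\<^sub>L y) = adj y o\<^sub>L adj x"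
  by (rule adj_unique) (simp add: cinner_adj_right)

lemma norm_apply_sq_adj:
  "x \<in> bops \<Longrightarrow> complex_of_real ((norm (blinfun_apply x \<xi>))\<^sup>2) = cinner (adj x (x \<xi>)) \<xi>"
  by (simp add: cinner_adj_left cinner_self)

lemma norm_adj_le: "x \<in> bops \<Longrightarrow> norm (adj x) \<le> norm x"
proof (rule norm_blinfun_bound)
  fix \<xi> assume x: "x \<in> bops"
  have "complex_of_real ((norm (adj x \<xi>))\<^sup>2) = cinner (x (adj x \<xi>)) \<xi>"
    using x by (metis adj_adj bops_adj norm_apply_sq_adj)
  also have "cmod \<dots> \<le> norm (x (adj x \<xi>)) * norm \<xi>"
    by (rule norm_cinner_le)
  also have "\<dots> \<le> norm x * norm (adj x \<xi>) * norm \<xi>"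
    by (intro mult_right_mono norm_blinfun) auto
  finally have "norm (adj x \<xi>) * norm (adj x \<xi>) \<le> (norm x * norm \<xi>) * norm (adj x \<xi>)"
    by (simp add: norm_of_real power2_eq_square norm_mult mult_ac)
  then show "norm (adj x \<xi>) \<le> norm x * norm \<xi>"
    by (cases "norm (adj x \<xi>) = 0") auto
qed auto

lemma norm_adj: "x \<in> bops \<Longrightarrow> norm (adj x) = norm x"
  by (metis adj_adj antisym bops_adj norm_adj_le)

lemma norm_adj_compose: "x \<in> bops \<Longrightarrow> norm (adj x o\<^sub>L x) = (norm x)\<^sup>2"
proof (rule antisym)
  assume x: "x \<in> bops"
  show "norm (adj x o\<^sub>L x) \<le> (norm x)\<^sup>2"
    using norm_blinfun_compose[of "adj x" x] x by (simp add: norm_adj power2_eq_square)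
  have "norm x \<le> sqrt (norm (adj x o\<^sub>L x))"
  proof (rule norm_blinfun_bound)
    fix \<xi>
    have "(norm (x \<xi>))\<^sup>2 = cmod (cinner ((adj x o\<^sub>L x) \<xi>) \<xi>)"
      using x by (simp add: cinner_adj_left cinner_self norm_power)
    also have "\<dots> \<le> norm ((adj x o\<^sub>L x) \<xi>) * norm \<xi>"
      by (rule norm_cinner_le)
    also have "\<dots> \<le> norm (adj x o\<^sub>L x) * norm \<xi> * norm \<xi>"
      by (intro mult_right_mono norm_blinfun) auto
    also have "\<dots> = (sqrt (norm (adj x o\<^sub>L x)) * norm \<xi>)\<^sup>2"
      by (simp add: power_mult_distrib power2_eq_square)
    finally show "norm (x \<xi>) \<le> sqrt (norm (adj x o\<^sub>L x)) * norm \<xi>"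
      by (rule power2_le_imp_le) auto
  qed auto
  then have "(norm x)\<^sup>2 \<le> (sqrt (norm (adj x o\<^sub>L x)))\<^sup>2"
    by (rule power_mono) auto
  then show "(norm x)\<^sup>2 \<le> norm (adj x o\<^sub>L x)" by simp
qed

section \<open>Square-summable families\<close>

text \<open>A bound on finite partial sums carries summability and the size of the sum together, and
  applies to finite subsets without any convergence argument.\<close>

definition sq_bounded :: "'i set \<Rightarrow> ('i \<Rightarrow> 'b::real_normed_vector) \<Rightarrow> real \<Rightarrow> bool" where
  "sq_bounded I x B \<longleftrightarrow> (\<forall>J. finite J \<longrightarrow> J \<subseteq> I \<longrightarrow> (\<Sum>i\<in>J. (norm (x i))\<^sup>2) \<le> B)"

lemma sq_boundedD: "sq_bounded I x B \<Longrightarrow> finite J \<Longrightarrow> J \<subseteq> I \<Longrightarrow> (\<Sum>i\<in>J. (norm (x i))\<^sup>2) \<le> B"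
  by (simp add: sq_bounded_def)

lemma sq_bounded_nonneg: "sq_bounded I x B \<Longrightarrow> 0 \<le> B"
  using sq_boundedD[of I x B "{}"] by simp

lemma sq_bounded_mono: "sq_bounded I x B \<Longrightarrow> B \<le> B' \<Longrightarrow> sq_bounded I x B'"
  unfolding sq_bounded_def by force

lemma sq_bounded_summable: "sq_bounded I x B \<Longrightarrow> (\<lambda>i. (norm (x i))\<^sup>2) summable_on I"
  by (rule nonneg_bdd_above_summable_on) (auto intro!: bdd_aboveI2[where M = B] sq_boundedD)

lemma sq_bounded_infsum_le: "sq_bounded I x B \<Longrightarrow> (\<Sum>\<^sub>\<infinity>i\<in>I. (norm (x i))\<^sup>2) \<le> B"
  by (rule infsum_le_finite_sums) (auto intro: sq_bounded_summable sq_boundedD)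

lemma summable_sq_bounded:
  "(\<lambda>i. (norm (x i))\<^sup>2) summable_on I \<Longrightarrow> sq_bounded I x (\<Sum>\<^sub>\<infinity>i\<in>I. (norm (x i))\<^sup>2)"
  unfolding sq_bounded_def by (auto intro: finite_sum_le_infsum)

lemma sum_norm_mult_le:
  "(\<Sum>i\<in>J. norm (x i) * norm (y i)) \<le> sqrt (\<Sum>i\<in>J. (norm (x i))\<^sup>2) * sqrt (\<Sum>i\<in>J. (norm (y i))\<^sup>2)"
  using L2_set_mult_ineq[of "\<lambda>i. norm (x i)" "\<lambda>i. norm (y i)" J] by (simp add: L2_set_def)

lemma sq_bounded_sum_mult_le:
  assumes "sq_bounded I x B" "sq_bounded I y D" "finite J" "J \<subseteq> I"
  shows "(\<Sum>i\<in>J. norm (x i) * norm (y i)) \<le> sqrt B * sqrt D"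
proof -
  have "sqrt (\<Sum>i\<in>J. (norm (x i))\<^sup>2) * sqrt (\<Sum>i\<in>J. (norm (y i))\<^sup>2) \<le> sqrt B * sqrt D"
    using assms by (intro mult_mono real_sqrt_le_mono sq_boundedD)
      (auto intro: sum_nonneg sq_bounded_nonneg)
  with sum_norm_mult_le[of x y J] show ?thesis by linarith
qed

lemma sq_bounded_mult_summable:
  assumes "sq_bounded I x B" "sq_bounded I y D"
  shows "(\<lambda>i. norm (x i) * norm (y i)) summable_on I"
    and "(\<Sum>\<^sub>\<infinity>i\<in>I. norm (x i) * norm (y i)) \<le> sqrt B * sqrt D"
proof -
  show "(\<lambda>i. norm (x i) * norm (y i)) summable_on I"
    using sq_bounded_sum_mult_le[OF assms]
    by (intro nonneg_bdd_above_summable_on) (auto intro!: bdd_aboveI2)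
  then show "(\<Sum>\<^sub>\<infinity>i\<in>I. norm (x i) * norm (y i)) \<le> sqrt B * sqrt D"
    using sq_bounded_sum_mult_le[OF assms] by (intro infsum_le_finite_sums) auto
qed

lemma abs_summable_on_dominated:
  fixes f :: "'i \<Rightarrow> 'b::banach"
  assumes "g summable_on I" "\<And>i. i \<in> I \<Longrightarrow> norm (f i) \<le> g i"
  shows "f summable_on I" "(\<lambda>i. norm (f i)) summable_on I" "norm (infsum f I) \<le> infsum g I"
proof -
  show abs: "(\<lambda>i. norm (f i)) summable_on I"
    by (rule Infinite_Sum.abs_summable_on_comparison_test'[OF assms])
  then show "f summable_on I"
    by (rule abs_summable_summable)
  have "norm (infsum f I) \<le> (\<Sum>\<^sub>\<infinity>i\<in>I. norm (f i))"
    by (rule norm_infsum_bound[OF abs])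
  also have "\<dots> \<le> infsum g I"
    by (rule infsum_mono[OF abs assms])
  finally show "norm (infsum f I) \<le> infsum g I" .
qed

lemma sq_bounded_product:
  fixes x y :: "'i \<Rightarrow> complex"
  assumes "sq_bounded I x B" "sq_bounded I y D"
  shows "(\<lambda>i. x i * y i) summable_on I" "cmod (\<Sum>\<^sub>\<infinity>i\<in>I. x i * y i) \<le> sqrt B * sqrt D"
proof -
  note dom = abs_summable_on_dominated[OF sq_bounded_mult_summable(1)[OF assms], of "\<lambda>i. x i * y i"]
  show "(\<lambda>i. x i * y i) summable_on I"
    by (rule dom) (simp add: norm_mult)
  have "cmod (\<Sum>\<^sub>\<infinity>i\<in>I. x i * y i) \<le> (\<Sum>\<^sub>\<infinity>i\<in>I. norm (x i) * norm (y i))"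
    by (rule dom) (simp add: norm_mult)
  with sq_bounded_mult_summable(2)[OF assms] show "cmod (\<Sum>\<^sub>\<infinity>i\<in>I. x i * y i) \<le> sqrt B * sqrt D"
    by linarith
qed

text \<open>Two partial sums over supersets of \<open>J0\<close> differ only by sums over sets
  disjoint from \<open>J0\<close>. The criterion serves operator series that need not converge
  absolutely.\<close>

lemma summable_on_Cauchy_criterion:
  fixes f :: "'i \<Rightarrow> 'b::banach"
  assumes "\<And>e. e > 0 \<Longrightarrow> \<exists>J0. finite J0 \<and> J0 \<subseteq> I \<and>
      (\<forall>J. finite J \<longrightarrow> J \<subseteq> I - J0 \<longrightarrow> norm (sum f J) < e)"
  shows "f summable_on I"
proof -
  have "cauchy_filter (filtermap (sum f) (finite_subsets_at_top I))"
    unfolding cauchy_filter_metric_filtermap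
  proof (intro allI impI)
    fix e :: real assume "e > 0"
    then obtain J0 where J0: "finite J0" "J0 \<subseteq> I"
      and small: "\<And>J. finite J \<Longrightarrow> J \<subseteq> I - J0 \<Longrightarrow> norm (sum f J) < e / 2"
      using assms[of "e / 2"] by (metis half_gt_zero)
    define P where "P J \<longleftrightarrow> finite J \<and> J0 \<subseteq> J \<and> J \<subseteq> I" for J
    have "eventually P (finite_subsets_at_top I)"
      unfolding eventually_finite_subsets_at_top using J0 by (auto simp: P_def)
    moreover have "dist (sum f J) (sum f K) < e" if "P J" "P K" for J K
    proof -
      have "sum f J = sum f J0 + sum f (J - J0)" "sum f K = sum f J0 + sum f (K - J0)"
        using that by (auto simp: P_def sum.subset_diff add.commute)
      then have "dist (sum f J) (sum f K) = norm (sum f (J - J0) - sum f (K - J0))"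
        by (simp add: dist_norm)
      also have "\<dots> \<le> norm (sum f (J - J0)) + norm (sum f (K - J0))"
        by (rule norm_triangle_ineq4)
      also have "\<dots> < e / 2 + e / 2"
        using that by (intro add_strict_mono small) (auto simp: P_def)
      finally show ?thesis by simp
    qed
    ultimately show "\<exists>P. eventually P (finite_subsets_at_top I) \<and>
        (\<forall>J K. P J \<and> P K \<longrightarrow> dist (sum f J) (sum f K) < e)"
      by blast
  qed
  then have "\<exists>L. filtermap (sum f) (finite_subsets_at_top I) \<le> nhds L"
    by (rule cauchy_filter_complete_converges[of _ UNIV]) (auto simp: filtermap_bot_iff complete_UNIV)
  then obtain L where "filtermap (sum f) (finite_subsets_at_top I) \<le> nhds L" ..
  then show ?thesis
    by (auto simp: summable_on_def has_sum_def filterlim_def)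
qed

lemma summable_on_small_tail:
  fixes g :: "'i \<Rightarrow> real"
  assumes "g summable_on I" and nonneg: "\<And>i. i \<in> I \<Longrightarrow> 0 \<le> g i" and "e > 0"
  shows "\<exists>J0. finite J0 \<and> J0 \<subseteq> I \<and> infsum g (I - J0) < e"
proof -
  obtain J0 where J0: "finite J0" "J0 \<subseteq> I" "dist (sum g J0) (infsum g I) \<le> e / 2"
    using infsum_finite_approximation[of g I "e / 2"] assms by auto
  then have "infsum g I - sum g J0 \<le> e / 2"
    unfolding dist_real_def by linarith
  have "infsum g (I - J0) = infsum g I - infsum g J0"
    using J0 assms by (intro infsum_Diff) auto
  also have "\<dots> < e"
    using J0 \<open>e > 0\<close> \<open>infsum g I - sum g J0 \<le> e / 2\<close> by simp
  finally show ?thesis using J0 by blast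
qed

section \<open>Square-summable families of operators\<close>

definition op_subspace :: "('h::complex_hilbert \<Rightarrow>\<^sub>L 'h) set \<Rightarrow> bool" where
  "op_subspace A \<longleftrightarrow> A \<subseteq> bops \<and> 0 \<in> A \<and> (\<forall>a\<in>A. \<forall>b\<in>A. a + b \<in> A) \<and> (\<forall>c. \<forall>a\<in>A. op_scaleC c a \<in> A)"

text \<open>A total function of which only the values on \<open>A\<close> matter; \<open>M\<close>
  is some bound rather than the norm, so that bounds simply add up in sums of functionals.\<close>

definition bounded_functional_on ::
  "('h::complex_hilbert \<Rightarrow>\<^sub>L 'h) set \<Rightarrow> (('h \<Rightarrow>\<^sub>L 'h) \<Rightarrow> complex) \<Rightarrow> real \<Rightarrow> bool" where
  "bounded_functional_on A f M \<longleftrightarrow> 0 \<le> M \<and> (\<forall>a\<in>A. \<forall>b\<in>A. f (a + b) = f a + f b) \<and>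
     (\<forall>c. \<forall>a\<in>A. f (op_scaleC c a) = c * f a) \<and> (\<forall>a\<in>A. cmod (f a) \<le> M * norm a)"

text \<open>The column with entries \<open>e i\<close> is a bounded operator into the l2 sum of
  copies of the space, with squared norm at most \<open>C\<close>.\<close>

definition sq_bounded_family ::
  "'i set \<Rightarrow> ('i \<Rightarrow> ('h::complex_hilbert \<Rightarrow>\<^sub>L 'h)) \<Rightarrow> real \<Rightarrow> bool" where
  "sq_bounded_family I e C \<longleftrightarrow> 0 \<le> C \<and> (\<forall>\<xi>. sq_bounded I (\<lambda>i. e i \<xi>) (C * (norm \<xi>)\<^sup>2))"

lemma sq_bounded_familyD:
  "sq_bounded_family I e C \<Longrightarrow> sq_bounded I (\<lambda>i. blinfun_apply (e i) \<xi>) (C * (norm \<xi>)\<^sup>2)"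
  by (simp add: sq_bounded_family_def)

lemma op_scaleC_minus_1: "op_scaleC (-1) (a :: 'h::complex_hilbert \<Rightarrow>\<^sub>L 'h) = - a"
  by (rule blinfun_eqI) (simp add: op_scaleC_apply blinfun.minus_left)

lemma op_subspace_diff:
  assumes "op_subspace A" "a \<in> A" "b \<in> A" shows "a - b \<in> A"
proof -
  have "a + op_scaleC (-1) b \<in> A"
    using assms by (simp add: op_subspace_def)
  then show ?thesis by (simp add: op_scaleC_minus_1)
qed

lemma op_subspace_sum:
  assumes "op_subspace A" "\<And>i. i \<in> J \<Longrightarrow> e i \<in> A"
  shows "(\<Sum>i\<in>J. op_scaleC (c i) (e i)) \<in> A"
  using assms(2)
  by (induction J rule: infinite_finite_induct) (use assms(1) in \<open>auto simp: op_subspace_def\<close>)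

lemma bounded_functional_on_0:
  assumes "bounded_functional_on A f M" "0 \<in> A" shows "f 0 = 0"
proof -
  have "cmod (f 0) \<le> M * norm (0 :: 'a \<Rightarrow>\<^sub>L 'a)"
    using assms unfolding bounded_functional_on_def by blast
  then show ?thesis by simp
qed

lemma bounded_functional_on_diff:
  assumes "bounded_functional_on A f M" "op_subspace A" "a \<in> A" "b \<in> A"
  shows "f (a - b) = f a - f b"
proof -
  have "f (a + op_scaleC (-1) b) = f a + (-1) * f b"
    using assms unfolding bounded_functional_on_def op_subspace_def by metis
  then show ?thesis by (simp add: op_scaleC_minus_1)
qed

lemma bounded_functional_on_sum:
  assumes f: "bounded_functional_on A f M" and A: "op_subspace A" and e: "\<And>i. i \<in> J \<Longrightarrow> e i \<in> A"
  shows "f (\<Sum>i\<in>J. op_scaleC (c i) (e i)) = (\<Sum>i\<in>J. c i * f (e i))"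
  using e
proof (induction J rule: infinite_finite_induct)
  case (insert i J)
  have "op_scaleC (c i) (e i) \<in> A" "(\<Sum>i\<in>J. op_scaleC (c i) (e i)) \<in> A"
    using insert A by (auto intro: op_subspace_sum simp: op_subspace_def)
  then show ?case
    using insert f by (simp add: bounded_functional_on_def)
qed (use bounded_functional_on_0[OF f] A in \<open>auto simp: op_subspace_def\<close>)

text \<open>Cauchy-Schwarz for a row of scalars times the column \<open>e\<close>. The right side
  depends on \<open>J\<close> only through the coefficients, so l2 coefficients produce
  norm-convergent series.\<close>

lemma norm_sum_scaled_family_le:
  assumes e: "sq_bounded_family I e C" and J: "finite J" "J \<subseteq> I"
  shows "norm (\<Sum>i\<in>J. op_scaleC (c i) (e i)) \<le> sqrt C * sqrt (\<Sum>i\<in>J. (cmod (c i))\<^sup>2)"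
proof (rule norm_blinfun_bound)
  have C: "0 \<le> C" using e by (simp add: sq_bounded_family_def)
  then show "0 \<le> sqrt C * sqrt (\<Sum>i\<in>J. (cmod (c i))\<^sup>2)"
    by (simp add: sum_nonneg)
  fix \<xi>
  have "norm ((\<Sum>i\<in>J. op_scaleC (c i) (e i)) \<xi>) \<le> (\<Sum>i\<in>J. norm (c i) * norm (e i \<xi>))"
    by (simp add: blinfun.sum_left op_scaleC_apply) (rule sum_norm_le, simp add: norm_scaleC)
  also have "\<dots> \<le> sqrt (\<Sum>i\<in>J. (norm (c i))\<^sup>2) * sqrt (\<Sum>i\<in>J. (norm (e i \<xi>))\<^sup>2)"
    by (rule sum_norm_mult_le)
  also have "\<dots> \<le> sqrt (\<Sum>i\<in>J. (norm (c i))\<^sup>2) * sqrt (C * (norm \<xi>)\<^sup>2)"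
    using sq_boundedD[OF sq_bounded_familyD[OF e, of \<xi>] J]
    by (intro mult_left_mono real_sqrt_le_mono) (auto simp: sum_nonneg)
  finally show "norm ((\<Sum>i\<in>J. op_scaleC (c i) (e i)) \<xi>) \<le> sqrt C * sqrt (\<Sum>i\<in>J. (cmod (c i))\<^sup>2) * norm \<xi>"
    by (simp add: real_sqrt_mult mult_ac)
qed

text \<open>Duality: \<open>f\<close> is tested on the combination of the \<open>e i\<close> with
  coefficients \<open>cnj (f (e i))\<close>. Its value there is the sum of squares \<open>S\<close>,
  the norm of the combination is at most \<open>sqrt C * sqrt S\<close>, and cancelling
  \<open>sqrt S\<close> leaves the bound.\<close>

lemma functional_family_sq_bounded:
  assumes f: "bounded_functional_on A f M" and A: "op_subspace A"
    and e: "sq_bounded_family I e C" "\<And>i. i \<in> I \<Longrightarrow> e i \<in> A"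
  shows "sq_bounded I (\<lambda>i. f (e i)) (M\<^sup>2 * C)"
  unfolding sq_bounded_def
proof (intro allI impI)
  fix J assume J: "finite J" "J \<subseteq> I"
  define S where "S = (\<Sum>i\<in>J. (norm (f (e i)))\<^sup>2)"
  define z where "z = (\<Sum>i\<in>J. op_scaleC (cnj (f (e i))) (e i))"
  have S0: "0 \<le> S" by (simp add: S_def sum_nonneg)
  have zA: "z \<in> A"
    unfolding z_def using A e(2) J by (intro op_subspace_sum) auto
  have "f z = (\<Sum>i\<in>J. cnj (f (e i)) * f (e i))"
    unfolding z_def using J by (intro bounded_functional_on_sum[OF f A] e(2)) auto
  also have "\<dots> = complex_of_real S"
    unfolding S_def of_real_sum
    by (rule sum.cong) (auto simp: mult.commute simp flip: complex_norm_square)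
  finally have "S = cmod (f z)"
    using S0 by simp
  also have "\<dots> \<le> M * norm z"
    using f zA by (simp add: bounded_functional_on_def)
  also have "\<dots> \<le> M * (sqrt C * sqrt S)"
    using norm_sum_scaled_family_le[OF e(1) J, of "\<lambda>i. cnj (f (e i))"] f
    by (intro mult_left_mono) (auto simp: z_def S_def bounded_functional_on_def)
  finally have "sqrt S * sqrt S \<le> (M * sqrt C) * sqrt S"
    using S0 by (simp add: mult_ac)
  moreover have "0 \<le> M * sqrt C"
    using f e(1) by (simp add: bounded_functional_on_def sq_bounded_family_def)
  ultimately have "sqrt S \<le> M * sqrt C"
    using S0 by (cases "S = 0") (auto simp del: real_sqrt_mult_self simp: mult_le_cancel_right)
  then have "(sqrt S)\<^sup>2 \<le> (M * sqrt C)\<^sup>2"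
    using S0 by (intro power_mono) auto
  then show "(\<Sum>i\<in>J. (norm (f (e i)))\<^sup>2) \<le> M\<^sup>2 * C"
    using S0 e(1) by (simp add: S_def power_mult_distrib sq_bounded_family_def)
qed

text \<open>The element \<open>z\<close> is chosen before \<open>f\<close>, so a whole series
  becomes one evaluation at a point of \<open>A\<close>, where separation by functionals or norming
  families can be used.\<close>

lemma scaled_family_converges:
  assumes A: "op_subspace A" "closed A"
    and e: "sq_bounded_family I e C" "\<And>i. i \<in> I \<Longrightarrow> e i \<in> A"
    and c: "sq_bounded I c B"
  shows "\<exists>z\<in>A. \<forall>f M. bounded_functional_on A f M \<longrightarrow> ((\<lambda>i. c i * f (e i)) has_sum f z) I"
proof -
  define g where "g i = op_scaleC (c i) (e i)" for i
  have C: "0 \<le> C" using e by (simp add: sq_bounded_family_def)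
  have "g summable_on I"
  proof (rule summable_on_Cauchy_criterion)
    fix \<epsilon> :: real assume \<epsilon>: "\<epsilon> > 0"
    define d where "d = (\<epsilon> / (sqrt C + 1))\<^sup>2"
    have C1: "sqrt C + 1 > 0" using C by (simp add: add_nonneg_pos)
    then have d: "d > 0" using \<epsilon> by (simp add: d_def)
    obtain J0 where J0: "finite J0" "J0 \<subseteq> I" and tail: "(\<Sum>\<^sub>\<infinity>i\<in>I - J0. (norm (c i))\<^sup>2) < d"
      using summable_on_small_tail[OF sq_bounded_summable[OF c] _ d] by auto
    have "norm (sum g J) < \<epsilon>" if J: "finite J" "J \<subseteq> I - J0" for J
    proof -
      have "(\<lambda>i. (norm (c i))\<^sup>2) summable_on (I - J0)"
        by (rule summable_on_subset_banach[OF sq_bounded_summable[OF c]]) auto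
      then have "(\<Sum>i\<in>J. (norm (c i))\<^sup>2) \<le> (\<Sum>\<^sub>\<infinity>i\<in>I - J0. (norm (c i))\<^sup>2)"
        using J by (intro finite_sum_le_infsum) auto
      then have "sqrt (\<Sum>i\<in>J. (norm (c i))\<^sup>2) \<le> sqrt d"
        using tail by simp
      then have "sqrt C * sqrt (\<Sum>i\<in>J. (norm (c i))\<^sup>2) \<le> sqrt C * (\<epsilon> / (sqrt C + 1))"
        using \<epsilon> C by (intro mult_left_mono) (auto simp: d_def)
      also have "\<dots> < \<epsilon>"
        using \<epsilon> C1 by (simp add: field_simps)
      finally show ?thesis
        using norm_sum_scaled_family_le[OF e(1) J(1), of c] J(2) by (force simp: g_def)
    qed
    with J0 show "\<exists>J0. finite J0 \<and> J0 \<subseteq> I \<and> (\<forall>J. finite J \<longrightarrow> J \<subseteq> I - J0 \<longrightarrow> norm (sum g J) < \<epsilon>)"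
      by blast
  qed
  then obtain z where z: "(g has_sum z) I" by (auto simp: summable_on_def)
  have gA: "sum g J \<in> A" if "finite J" "J \<subseteq> I" for J
    unfolding g_def using that e(2) by (intro op_subspace_sum[OF A(1)]) auto
  have lim: "(sum g \<longlongrightarrow> z) (finite_subsets_at_top I)"
    using z by (simp add: has_sum_def)
  have zA: "z \<in> A"
    by (rule Lim_in_closed_set[OF A(2) _ _ lim]) (auto intro: eventually_finite_subsets_at_top_weakI gA)
  have "((\<lambda>i. c i * f (e i)) has_sum f z) I" if f: "bounded_functional_on A f M" for f M
    unfolding has_sum_def
  proof (rule tendstoI)
    fix \<epsilon> :: real assume \<epsilon>: "\<epsilon> > 0"
    have M: "0 \<le> M" using f by (simp add: bounded_functional_on_def)
    then have "\<epsilon> / (M + 1) > 0" using \<epsilon> by simp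
    then have "\<forall>\<^sub>F J in finite_subsets_at_top I. dist (sum g J) z < \<epsilon> / (M + 1)"
      using lim by (rule tendstoD[rotated])
    moreover have "\<forall>\<^sub>F J in finite_subsets_at_top I. finite J \<and> J \<subseteq> I"
      by (auto intro: eventually_finite_subsets_at_top_weakI)
    ultimately show "\<forall>\<^sub>F J in finite_subsets_at_top I. dist (\<Sum>i\<in>J. c i * f (e i)) (f z) < \<epsilon>"
    proof eventually_elim
      case (elim J)
      have "(\<Sum>i\<in>J. c i * f (e i)) = f (sum g J)"
        unfolding g_def using elim e(2) by (intro bounded_functional_on_sum[OF f A(1), symmetric]) auto
      then have "dist (\<Sum>i\<in>J. c i * f (e i)) (f z) = cmod (f (sum g J - z))"
        using bounded_functional_on_diff[OF f A(1) gA zA] elim by (simp add: dist_norm)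
      also have "\<dots> \<le> M * norm (sum g J - z)"
        using f op_subspace_diff[OF A(1) gA zA] elim by (simp add: bounded_functional_on_def)
      also have "\<dots> \<le> M * (\<epsilon> / (M + 1))"
        using elim M by (intro mult_left_mono) (auto simp: dist_norm)
      also have "\<dots> < \<epsilon>" using M \<epsilon> by (simp add: field_simps)
      finally show ?case .
    qed
  qed
  with zA show ?thesis by blast
qed

section \<open>Elementary maps on the bounded operators\<close>

lemma weakstar_has_sum_cinner:
  assumes "weakstar_has_sum f I S"
  shows "((\<lambda>i. cinner (f i \<xi>) \<eta>) has_sum cinner (S \<xi>) \<eta>) I"
proof -
  \<comment> \<open>Sequences supported at index 0 reduce the functionals in the definition to a
    single matrix coefficient.\<close>
  define x where "x n = (if n = (0::nat) then \<xi> else 0)" for n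
  define y where "y n = (if n = (0::nat) then \<eta> else 0)" for n
  have x: "summable (\<lambda>n. (norm (x n))\<^sup>2)" and y: "summable (\<lambda>n. (norm (y n))\<^sup>2)"
    by (auto intro!: summable_finite[of "{0}"] simp: x_def y_def split: if_splits)
  have single: "(\<Sum>n. cinner (blinfun_apply R (x n)) (y n)) = cinner (R \<xi>) \<eta>" for R
    by (subst suminf_finite[of "{0}"]) (auto simp: x_def y_def cinner.zero_right)
  have "((\<lambda>J. \<Sum>n. cinner ((\<Sum>i\<in>J. f i) (x n)) (y n)) \<longlongrightarrow> (\<Sum>n. cinner (S (x n)) (y n)))
      (finite_subsets_at_top I)"
    using assms x y unfolding weakstar_has_sum_def weakstar_tendsto_def by blast
  then show ?thesis
    unfolding single has_sum_def by (simp add: blinfun.sum_left cinner.sum_left)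
qed

lemma weakstar_has_sum_unique:
  assumes "weakstar_has_sum f I S" "weakstar_has_sum f I S'"
  shows "S = S'"
  by (rule bops_eqI)
    (rule has_sum_unique[OF weakstar_has_sum_cinner[OF assms(1)] weakstar_has_sum_cinner[OF assms(2)]])

lemma weakstar_has_sum_bops: "weakstar_has_sum f I S \<Longrightarrow> S \<in> bops"
  by (simp add: weakstar_has_sum_def weakstar_tendsto_def)

text \<open>On the diagonal the terms are \<open>(norm (e i \<xi>))\<^sup>2\<close>, and partial
  sums of nonnegative terms stay below the limit.\<close>

lemma weakstar_sum_positive_family:
  assumes e: "\<And>i. i \<in> I \<Longrightarrow> e i \<in> bops"
    and S: "weakstar_has_sum (\<lambda>i. adj (e i) o\<^sub>L e i) I S"
  shows "sq_bounded_family I e (norm S)"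
  unfolding sq_bounded_family_def sq_bounded_def
proof (intro conjI allI impI)
  fix \<xi> J assume J: "finite J" "J \<subseteq> I"
  have "((\<lambda>i. cinner ((adj (e i) o\<^sub>L e i) \<xi>) \<xi>) has_sum cinner (S \<xi>) \<xi>) I"
    using S by (rule weakstar_has_sum_cinner)
  then have "((\<lambda>i. Re (cinner ((adj (e i) o\<^sub>L e i) \<xi>) \<xi>)) has_sum Re (cinner (S \<xi>) \<xi>)) I"
    by (rule has_sum_Re)
  also have "?this \<longleftrightarrow> ((\<lambda>i. (norm (e i \<xi>))\<^sup>2) has_sum Re (cinner (S \<xi>) \<xi>)) I"
    by (rule has_sum_cong) (simp add: e cinner_adj_left cinner_self)
  finally have "(\<Sum>i\<in>J. (norm (e i \<xi>))\<^sup>2) \<le> Re (cinner (S \<xi>) \<xi>)"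
    using J by (intro finite_sum_le_has_sum) auto
  also have "\<dots> \<le> norm (S \<xi>) * norm \<xi>"
    using complex_Re_le_cmod norm_cinner_le order_trans by blast
  also have "\<dots> \<le> (norm S * norm \<xi>) * norm \<xi>"
    by (intro mult_right_mono norm_blinfun) auto
  finally show "(\<Sum>i\<in>J. (norm (e i \<xi>))\<^sup>2) \<le> norm S * (norm \<xi>)\<^sup>2"
    by (simp add: power2_eq_square mult.assoc)
qed auto

lemma sq_bounded_family_mono:
  "sq_bounded_family I e C \<Longrightarrow> C \<le> C' \<Longrightarrow> sq_bounded_family I e C'"
  unfolding sq_bounded_family_def by (auto intro: sq_bounded_mono[OF _ mult_right_mono])

lemma eh_series_bounded:
  assumes "eh_series V W I v w" and VW: "V \<subseteq> bops" "W \<subseteq> bops"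
  obtains C where "sq_bounded_family I w C" "sq_bounded_family I (\<lambda>i. adj (v i)) C"
proof -
  have v: "v i \<in> bops" and w: "w i \<in> bops" if "i \<in> I" for i
    using assms that unfolding eh_series_def by blast+
  obtain S S' where S: "weakstar_has_sum (\<lambda>i. v i o\<^sub>L adj (v i)) I S"
    and S': "weakstar_has_sum (\<lambda>i. adj (w i) o\<^sub>L w i) I S'"
    using assms unfolding eh_series_def by blast
  \<comment> \<open>Turns the row condition on \<open>v\<close> into a column condition on its
    adjoints. Double adjoints cancel only for indices in \<open>I\<close>, hence the comparison
    along finite subsets of \<open>I\<close>.\<close>
  have "weakstar_has_sum (\<lambda>i. adj (adj (v i)) o\<^sub>L adj (v i)) I S"
    using S unfolding weakstar_has_sum_def weakstar_tendsto_def
  proof (elim conjE, intro conjI allI impI)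
    fix \<xi> \<eta> :: "nat \<Rightarrow> 'a"
    assume *: "\<forall>\<xi> \<eta>. summable (\<lambda>n. (norm (\<xi> n))\<^sup>2) \<longrightarrow> summable (\<lambda>n. (norm (\<eta> n))\<^sup>2) \<longrightarrow>
        ((\<lambda>J. \<Sum>n. cinner ((\<Sum>i\<in>J. v i o\<^sub>L adj (v i)) (\<xi> n)) (\<eta> n)) \<longlongrightarrow>
          (\<Sum>n. cinner (S (\<xi> n)) (\<eta> n))) (finite_subsets_at_top I)"
      and sm: "summable (\<lambda>n. (norm (\<xi> n))\<^sup>2)" "summable (\<lambda>n. (norm (\<eta> n))\<^sup>2)"
    have "\<forall>\<^sub>F J in finite_subsets_at_top I.
        (\<Sum>n. cinner ((\<Sum>i\<in>J. v i o\<^sub>L adj (v i)) (\<xi> n)) (\<eta> n)) =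
        (\<Sum>n. cinner ((\<Sum>i\<in>J. adj (adj (v i)) o\<^sub>L adj (v i)) (\<xi> n)) (\<eta> n))"
    proof (rule eventually_finite_subsets_at_top_weakI)
      fix J assume J: "finite J" "J \<subseteq> I"
      have "(\<Sum>i\<in>J. v i o\<^sub>L adj (v i)) = (\<Sum>i\<in>J. adj (adj (v i)) o\<^sub>L adj (v i))"
        using J v by (intro sum.cong) (auto simp: adj_adj)
      then show "(\<Sum>n. cinner ((\<Sum>i\<in>J. v i o\<^sub>L adj (v i)) (\<xi> n)) (\<eta> n)) =
        (\<Sum>n. cinner ((\<Sum>i\<in>J. adj (adj (v i)) o\<^sub>L adj (v i)) (\<xi> n)) (\<eta> n))"
        by simp
    qed
    then show "((\<lambda>J. \<Sum>n. cinner ((\<Sum>i\<in>J. adj (adj (v i)) o\<^sub>L adj (v i)) (\<xi> n)) (\<eta> n)) \<longlongrightarrow>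
          (\<Sum>n. cinner (S (\<xi> n)) (\<eta> n))) (finite_subsets_at_top I)"
      using * sm by (auto intro: Lim_transform_eventually)
  qed
  then have "sq_bounded_family I (\<lambda>i. adj (v i)) (norm S)"
    by (rule weakstar_sum_positive_family[rotated]) (rule bops_adj[OF v])
  moreover have "sq_bounded_family I w (norm S')"
    by (rule weakstar_sum_positive_family[OF w S'])
  ultimately show ?thesis
    by (intro that[of "max (norm S) (norm S')"]) (auto elim: sq_bounded_family_mono)
qed

text \<open>The bound is a constant times the product of the two norms: this makes the sum a bounded
  form, and permits a further summation over square-summable sequences of vectors.\<close>

lemma op_form_bound:
  assumes w: "sq_bounded_family I w C" and v: "sq_bounded_family I v D"
  shows "(\<lambda>i. norm (cinner (blinfun_apply x (w i \<xi>)) (v i \<eta>))) summable_on I"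
    and "(\<Sum>\<^sub>\<infinity>i\<in>I. norm (cinner (blinfun_apply x (w i \<xi>)) (v i \<eta>))) \<le>
      norm x * sqrt C * sqrt D * (norm \<xi> * norm \<eta>)"
proof -
  note sq = sq_bounded_familyD[OF w, of \<xi>] sq_bounded_familyD[OF v, of \<eta>]
  have le: "norm (cinner (blinfun_apply x (w i \<xi>)) (v i \<eta>)) \<le> norm x * (norm (w i \<xi>) * norm (v i \<eta>))" for i
  proof -
    have "norm (cinner (blinfun_apply x (w i \<xi>)) (v i \<eta>)) \<le> norm (x (w i \<xi>)) * norm (v i \<eta>)"
      by (rule norm_cinner_le)
    also have "\<dots> \<le> (norm x * norm (w i \<xi>)) * norm (v i \<eta>)"
      by (intro mult_right_mono norm_blinfun) auto
    finally show ?thesis by (simp add: mult.assoc)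
  qed
  have sm: "(\<lambda>i. norm x * (norm (w i \<xi>) * norm (v i \<eta>))) summable_on I"
    by (rule summable_on_cmult_right) (rule sq_bounded_mult_summable[OF sq])
  then show *: "(\<lambda>i. norm (cinner (blinfun_apply x (w i \<xi>)) (v i \<eta>))) summable_on I"
    using le by (rule abs_summable_on_dominated)
  have "(\<Sum>\<^sub>\<infinity>i\<in>I. norm (cinner (blinfun_apply x (w i \<xi>)) (v i \<eta>)))
      \<le> (\<Sum>\<^sub>\<infinity>i\<in>I. norm x * (norm (w i \<xi>) * norm (v i \<eta>)))"
    using * sm le by (rule infsum_mono)
  also have "\<dots> = norm x * (\<Sum>\<^sub>\<infinity>i\<in>I. norm (w i \<xi>) * norm (v i \<eta>))"
    by (rule infsum_cmult_right) (auto intro: sq_bounded_mult_summable[OF sq])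
  also have "\<dots> \<le> norm x * (sqrt (C * (norm \<xi>)\<^sup>2) * sqrt (D * (norm \<eta>)\<^sup>2))"
    by (intro mult_left_mono sq_bounded_mult_summable[OF sq]) auto
  finally show "(\<Sum>\<^sub>\<infinity>i\<in>I. norm (cinner (blinfun_apply x (w i \<xi>)) (v i \<eta>))) \<le>
      norm x * sqrt C * sqrt D * (norm \<xi> * norm \<eta>)"
    by (simp add: real_sqrt_mult mult_ac)
qed

text \<open>\<open>S\<close> is the sum of \<open>adj (v i) o\<^sub>L x o\<^sub>L w i\<close> in the
  weak operator sense. Keeping the adjoints on the second vector leaves two column families, to
  which Cauchy-Schwarz applies.\<close>

lemma op_form_represented:
  assumes w: "sq_bounded_family I w C" and v: "sq_bounded_family I v D"
    and bops: "\<And>i. i \<in> I \<Longrightarrow> w i \<in> bops" "\<And>i. i \<in> I \<Longrightarrow> v i \<in> bops" and x: "x \<in> bops"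
  obtains S where "S \<in> bops"
    "\<And>\<xi> \<eta>. ((\<lambda>i. cinner (blinfun_apply x (w i \<xi>)) (v i \<eta>)) has_sum cinner (S \<xi>) \<eta>) I"
proof -
  define t where "t \<xi> \<eta> i = cinner (x (w i \<xi>)) (v i \<eta>)" for \<xi> \<eta> i
  have sm: "t \<xi> \<eta> summable_on I" for \<xi> \<eta>
    unfolding t_def by (rule abs_summable_summable) (rule op_form_bound[OF w v])
  define \<tau> where "\<tau> \<xi> \<eta> = infsum (t \<xi> \<eta>) I" for \<xi> \<eta>
  have \<tau>: "(t \<xi> \<eta> has_sum \<tau> \<xi> \<eta>) I" for \<xi> \<eta>
    unfolding \<tau>_def by (rule has_sum_infsum[OF sm])
  have \<tau>_eqI: "\<tau> \<xi> \<eta> = s" if "(t \<xi> \<eta> has_sum s) I" for \<xi> \<eta> s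
    unfolding \<tau>_def using that by (rule infsumI)
  have add1: "\<tau> (\<xi> + \<xi>') \<eta> = \<tau> \<xi> \<eta> + \<tau> \<xi>' \<eta>" for \<xi> \<xi>' \<eta>
  proof (rule \<tau>_eqI)
    have "t (\<xi> + \<xi>') \<eta> = (\<lambda>i. t \<xi> \<eta> i + t \<xi>' \<eta> i)"
      by (simp add: t_def fun_eq_iff blinfun.add_right cinner_add_left)
    then show "(t (\<xi> + \<xi>') \<eta> has_sum (\<tau> \<xi> \<eta> + \<tau> \<xi>' \<eta>)) I"
      using has_sum_add[OF \<tau> \<tau>] by simp
  qed
  have add2: "\<tau> \<xi> (\<eta> + \<eta>') = \<tau> \<xi> \<eta> + \<tau> \<xi> \<eta>'" for \<xi> \<eta>' \<eta>
  proof (rule \<tau>_eqI)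
    have "t \<xi> (\<eta> + \<eta>') = (\<lambda>i. t \<xi> \<eta> i + t \<xi> \<eta>' i)"
      by (simp add: t_def fun_eq_iff blinfun.add_right cinner_add_right)
    then show "(t \<xi> (\<eta> + \<eta>') has_sum (\<tau> \<xi> \<eta> + \<tau> \<xi> \<eta>')) I"
      using has_sum_add[OF \<tau> \<tau>] by simp
  qed
  have scale1: "\<tau> (c *\<^sub>C \<xi>) \<eta> = c * \<tau> \<xi> \<eta>" for c \<xi> \<eta>
  proof (rule \<tau>_eqI)
    have "(t (c *\<^sub>C \<xi>) \<eta> has_sum s) I \<longleftrightarrow> ((\<lambda>i. c * t \<xi> \<eta> i) has_sum s) I" for s
      by (rule has_sum_cong) (simp add: t_def bops_scaleC bops x cinner_scaleC_left)
    then show "(t (c *\<^sub>C \<xi>) \<eta> has_sum c * \<tau> \<xi> \<eta>) I"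
      using has_sum_cmult_right[OF \<tau>] by simp
  qed
  have scale2: "\<tau> \<xi> (c *\<^sub>C \<eta>) = cnj c * \<tau> \<xi> \<eta>" for c \<xi> \<eta>
  proof (rule \<tau>_eqI)
    have "(t \<xi> (c *\<^sub>C \<eta>) has_sum s) I \<longleftrightarrow> ((\<lambda>i. cnj c * t \<xi> \<eta> i) has_sum s) I" for s
      by (rule has_sum_cong) (simp add: t_def bops_scaleC bops x cinner_scaleC_right)
    then show "(t \<xi> (c *\<^sub>C \<eta>) has_sum cnj c * \<tau> \<xi> \<eta>) I"
      using has_sum_cmult_right[OF \<tau>] by simp
  qed
  have "bounded_bilinear (\<lambda>\<xi> \<eta>. Re (\<tau> \<xi> \<eta>))"
  proof
    show "Re (\<tau> (r *\<^sub>R \<xi>) \<eta>) = r *\<^sub>R Re (\<tau> \<xi> \<eta>)" for r \<xi> \<eta>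
      by (simp add: scaleR_eq_scaleC scale1)
    show "Re (\<tau> \<xi> (r *\<^sub>R \<eta>)) = r *\<^sub>R Re (\<tau> \<xi> \<eta>)" for r \<xi> \<eta>
      by (simp add: scaleR_eq_scaleC scale2)
    have "norm (Re (\<tau> \<xi> \<eta>)) \<le> norm \<xi> * norm \<eta> * (norm x * sqrt C * sqrt D)" for \<xi> \<eta>
    proof -
      have "cmod (\<tau> \<xi> \<eta>) \<le> (\<Sum>\<^sub>\<infinity>i\<in>I. norm (t \<xi> \<eta> i))"
        unfolding \<tau>_def t_def by (rule norm_infsum_bound) (rule op_form_bound[OF w v])
      also have "\<dots> \<le> norm x * sqrt C * sqrt D * (norm \<xi> * norm \<eta>)"
        unfolding t_def by (rule op_form_bound[OF w v])
      finally show ?thesis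
        using abs_Re_le_cmod[of "\<tau> \<xi> \<eta>"] by (simp add: mult_ac)
    qed
    then show "\<exists>K. \<forall>\<xi> \<eta>. norm (Re (\<tau> \<xi> \<eta>)) \<le> norm \<xi> * norm \<eta> * K"
      by blast
  qed (simp_all add: add1 add2)
  then obtain S where S: "S \<in> bops" "\<And>\<xi> \<eta>. inner (S \<xi>) \<eta> = Re (\<tau> \<xi> \<eta>)"
    using bounded_form_represented[of "\<lambda>\<xi> \<eta>. Re (\<tau> \<xi> \<eta>)"] by (auto simp: scale1 scale2)
  have S_\<tau>: "cinner (S \<xi>) \<eta> = \<tau> \<xi> \<eta>" for \<xi> \<eta>
    by (rule cinner_eq_from_inner) (simp_all add: S scale2)
  show ?thesis
  proof (rule that[OF S(1)])
    fix \<xi> \<eta>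
    have "(\<lambda>i. cinner (x (w i \<xi>)) (v i \<eta>)) = t \<xi> \<eta>"
      by (simp add: t_def fun_eq_iff)
    then show "((\<lambda>i. cinner (x (w i \<xi>)) (v i \<eta>)) has_sum cinner (S \<xi>) \<eta>) I"
      using \<tau>[of \<xi> \<eta>] by (simp only: S_\<tau>)
  qed
qed

text \<open>Upgrades weak operator to weak* convergence by exchanging sums: the matrix coefficients
  over pairs (n, i) are absolutely summable, since row n is dominated by a constant times
  \<open>norm (\<xi> n) * norm (\<eta> n)\<close>.\<close>

lemma weakstar_series_has_sum:
  fixes v w :: "'i \<Rightarrow> ('h::complex_hilbert \<Rightarrow>\<^sub>L 'h)"
  assumes w: "sq_bounded_family I w C" and v: "sq_bounded_family I (\<lambda>i. adj (v i)) D"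
    and bops: "\<And>i. i \<in> I \<Longrightarrow> w i \<in> bops" "\<And>i. i \<in> I \<Longrightarrow> v i \<in> bops" and x: "x \<in> bops"
  shows "\<exists>S. weakstar_has_sum (\<lambda>i. v i o\<^sub>L x o\<^sub>L w i) I S"
proof -
  obtain S where S: "S \<in> bops"
    "\<And>\<xi> \<eta>. ((\<lambda>i. cinner (x (w i \<xi>)) (adj (v i) \<eta>)) has_sum cinner (S \<xi>) \<eta>) I"
    using op_form_represented[OF w v bops(1) bops_adj[OF bops(2)] x] by blast
  have "((\<lambda>J. \<Sum>n. cinner ((\<Sum>i\<in>J. v i o\<^sub>L x o\<^sub>L w i) (\<xi> n)) (\<eta> n)) \<longlongrightarrow>
      (\<Sum>n. cinner (S (\<xi> n)) (\<eta> n))) (finite_subsets_at_top I)"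
    if \<xi>: "summable (\<lambda>n. (norm (\<xi> n))\<^sup>2)" and \<eta>: "summable (\<lambda>n. (norm (\<eta> n))\<^sup>2)" for \<xi> \<eta> :: "nat \<Rightarrow> 'h"
  proof -
    define f where "f n i = cinner (x (w i (\<xi> n))) (adj (v i) (\<eta> n))" for n i
    define K where "K = norm x * sqrt C * sqrt D"
    have K: "K \<ge> 0" using w v by (simp add: K_def sq_bounded_family_def)
    have "(\<lambda>n. norm (\<xi> n) * norm (\<eta> n)) summable_on UNIV"
      using \<xi> \<eta> by (intro sq_bounded_mult_summable(1)[OF summable_sq_bounded summable_sq_bounded])
        (auto intro!: norm_summable_imp_summable_on)
    then have "(\<lambda>n. K * (norm (\<xi> n) * norm (\<eta> n))) summable_on UNIV"
      by (rule summable_on_cmult_right)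
    then have "(\<lambda>n. norm (\<Sum>\<^sub>\<infinity>i\<in>I. norm (f n i))) summable_on UNIV"
    proof (rule abs_summable_on_dominated(2))
      fix n
      show "norm (\<Sum>\<^sub>\<infinity>i\<in>I. norm (f n i)) \<le> K * (norm (\<xi> n) * norm (\<eta> n))"
        unfolding f_def K_def using op_form_bound(2)[OF w v] by (simp add: infsum_nonneg)
    qed
    then have "(\<lambda>(n, i). norm (f n i)) summable_on (UNIV \<times> I)"
      using op_form_bound(1)[OF w v] Infinite_Sum.abs_summable_on_Sigma_iff[of "\<lambda>(n, i). f n i" UNIV "\<lambda>_. I"]
      by (simp add: f_def case_prod_unfold)
    then have abs: "(\<lambda>p. norm (case p of (n, i) \<Rightarrow> f n i)) summable_on (UNIV \<times> I)"
      by (simp add: case_prod_unfold)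
    have sm: "(\<lambda>(n, i). f n i) summable_on (UNIV \<times> I)"
      by (rule abs_summable_summable[OF abs])
    have rows: "(f n has_sum cinner (S (\<xi> n)) (\<eta> n)) I" for n
      unfolding f_def by (rule S(2))
    obtain s where s: "((\<lambda>(n, i). f n i) has_sum s) (UNIV \<times> I)"
      using sm by (auto simp: summable_on_def)
    then have "((\<lambda>n. cinner (S (\<xi> n)) (\<eta> n)) has_sum s) UNIV"
      by (rule has_sum_SigmaD) (use rows in simp)
    then have suminf_S: "(\<Sum>n. cinner (S (\<xi> n)) (\<eta> n)) = s"
      by (intro sums_unique[symmetric] has_sum_imp_sums)
    have swapped: "((\<lambda>(i, n). f n i) has_sum s) (I \<times> UNIV)"
      using s by (subst has_sum_swap) (simp add: case_prod_unfold)
    have cols: "((\<lambda>n. f n i) has_sum (\<Sum>n. f n i)) UNIV" if "i \<in> I" for i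
    proof -
      have "(\<lambda>(i, n). f n i) summable_on (I \<times> UNIV)"
        using swapped by (auto simp: summable_on_def)
      then have "(\<lambda>n. f n i) summable_on UNIV"
        using that by (rule summable_on_SigmaD1)
      then show ?thesis
        by (metis has_sum_imp_sums has_sum_infsum sums_unique)
    qed
    have "((\<lambda>i. \<Sum>n. f n i) has_sum s) I"
      using swapped by (rule has_sum_SigmaD) (use cols in simp)
    moreover have "(\<Sum>n. cinner ((\<Sum>i\<in>J. v i o\<^sub>L x o\<^sub>L w i) (\<xi> n)) (\<eta> n)) = (\<Sum>i\<in>J. \<Sum>n. f n i)"
      if J: "finite J" "J \<subseteq> I" for J
    proof -
      have "(\<Sum>n. cinner ((\<Sum>i\<in>J. v i o\<^sub>L x o\<^sub>L w i) (\<xi> n)) (\<eta> n)) = (\<Sum>n. \<Sum>i\<in>J. f n i)"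
        using J bops by (auto simp: f_def blinfun.sum_left cinner.sum_left cinner_adj_right subset_iff
            intro!: suminf_cong sum.cong)
      also have "\<dots> = (\<Sum>i\<in>J. \<Sum>n. f n i)"
        using J cols by (intro suminf_sum) (meson has_sum_imp_sums subsetD sums_summable)
      finally show ?thesis .
    qed
    ultimately show ?thesis
      unfolding suminf_S has_sum_def
      by (elim Lim_transform_eventually) (rule eventually_finite_subsets_at_top_weakI, simp)
  qed
  then show ?thesis
    using S(1) unfolding weakstar_has_sum_def weakstar_tendsto_def by blast
qed

lemma eh_map_has_sum:
  assumes eh: "eh_series V W I v w" and VW: "V \<subseteq> bops" "W \<subseteq> bops" and x: "x \<in> bops"
  shows "weakstar_has_sum (\<lambda>i. v i o\<^sub>L x o\<^sub>L w i) I (eh_map I v w x)"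
proof -
  have bops: "v i \<in> bops" "w i \<in> bops" if "i \<in> I" for i
    using assms that unfolding eh_series_def by blast+
  obtain C where C: "sq_bounded_family I w C" "sq_bounded_family I (\<lambda>i. adj (v i)) C"
    using eh_series_bounded[OF eh VW] .
  obtain S where S: "weakstar_has_sum (\<lambda>i. v i o\<^sub>L x o\<^sub>L w i) I S"
    using weakstar_series_has_sum[OF C bops(2) bops(1) x] by blast
  have "(THE S. weakstar_has_sum (\<lambda>i. v i o\<^sub>L x o\<^sub>L w i) I S) = S"
    using S by (rule the_equality) (rule weakstar_has_sum_unique[OF _ S])
  then show ?thesis
    unfolding eh_map_def using x S by simp
qed

lemma eh_map_bops:
  "eh_series V W I v w \<Longrightarrow> V \<subseteq> bops \<Longrightarrow> W \<subseteq> bops \<Longrightarrow> x \<in> bops \<Longrightarrow> eh_map I v w x \<in> bops"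
  using eh_map_has_sum weakstar_has_sum_bops by blast

lemma eh_map_cinner:
  assumes eh: "eh_series V W I v w" and VW: "V \<subseteq> bops" "W \<subseteq> bops" and x: "x \<in> bops"
  shows "((\<lambda>i. cinner (x (w i \<xi>)) (adj (v i) \<eta>)) has_sum cinner (eh_map I v w x \<xi>) \<eta>) I"
proof -
  have "((\<lambda>i. cinner ((v i o\<^sub>L x o\<^sub>L w i) \<xi>) \<eta>) has_sum cinner (eh_map I v w x \<xi>) \<eta>) I"
    by (rule weakstar_has_sum_cinner[OF eh_map_has_sum[OF assms]])
  also have "?this \<longleftrightarrow> ?thesis"
    using eh VW by (intro has_sum_cong) (auto simp: cinner_adj_right eh_series_def subset_iff)
  finally show ?thesis .
qed

section \<open>Abelian C*-algebras and characters\<close>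

lemma abelian_cstarD:
  assumes "abelian_cstar_subalgebra A"
  shows "A \<subseteq> bops" "op_subspace A" "closed A"
    "\<And>a b. a \<in> A \<Longrightarrow> b \<in> A \<Longrightarrow> a o\<^sub>L b \<in> A" "\<And>a. a \<in> A \<Longrightarrow> adj a \<in> A"
    "\<And>a b. a \<in> A \<Longrightarrow> b \<in> A \<Longrightarrow> a o\<^sub>L b = b o\<^sub>L a" "\<And>a. a \<in> A \<Longrightarrow> a \<in> bops"
  using assms by (auto simp: abelian_cstar_subalgebra_def op_subspace_def)

text \<open>Elements of an abelian self-adjoint algebra are normal, so both norms square to the same
  matrix coefficient.\<close>

lemma norm_adj_apply:
  assumes A: "abelian_cstar_subalgebra A" and a: "a \<in> A"
  shows "norm (adj a \<xi>) = norm (blinfun_apply a \<xi>)"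
proof -
  have ab: "a \<in> bops" "adj a \<in> bops"
    using abelian_cstarD[OF A] a by auto
  have "complex_of_real ((norm (adj a \<xi>))\<^sup>2) = cinner (a (adj a \<xi>)) \<xi>"
    using norm_apply_sq_adj[OF ab(2), of \<xi>] by (simp only: adj_adj[OF ab(1)])
  also have "a (adj a \<xi>) = adj a (a \<xi>)"
    using abelian_cstarD(6)[OF A a abelian_cstarD(5)[OF A a]]
    by (metis blinfun_apply_blinfun_compose)
  also have "cinner \<dots> \<xi> = complex_of_real ((norm (a \<xi>))\<^sup>2)"
    using norm_apply_sq_adj[OF ab(1), of \<xi>] by simp
  finally have "(norm (adj a \<xi>))\<^sup>2 = (norm (a \<xi>))\<^sup>2"
    by (simp only: of_real_eq_iff)
  then show ?thesis
    by (simp add: power2_eq_iff_nonneg)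
qed

lemma vector_functional_bounded:
  assumes "A \<subseteq> bops"
  shows "bounded_functional_on A (\<lambda>a. cinner (blinfun_apply a \<xi>) \<eta>) (norm \<xi> * norm \<eta>)"
  unfolding bounded_functional_on_def
proof (intro conjI ballI allI)
  fix a
  have "cmod (cinner (blinfun_apply a \<xi>) \<eta>) \<le> norm (a \<xi>) * norm \<eta>"
    by (rule norm_cinner_le)
  also have "\<dots> \<le> (norm a * norm \<xi>) * norm \<eta>"
    by (intro mult_right_mono norm_blinfun) auto
  finally show "cmod (cinner (a \<xi>) \<eta>) \<le> norm \<xi> * norm \<eta> * norm a"
    by (simp add: mult_ac)
qed (auto simp: blinfun.add_left cinner_add_left op_scaleC_apply cinner_scaleC_left)

definition rank_one :: "'h::complex_hilbert \<Rightarrow> 'h \<Rightarrow> ('h \<Rightarrow>\<^sub>L 'h)" where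
  "rank_one \<eta> \<zeta> = Blinfun (\<lambda>v. cinner v \<zeta> *\<^sub>C \<eta>)"

lemma rank_one_apply [simp]: "rank_one \<eta> \<zeta> v = cinner v \<zeta> *\<^sub>C \<eta>"
proof -
  have "bounded_linear (\<lambda>v. cinner v \<zeta> *\<^sub>C \<eta>)"
    by (rule bounded_linear_compose[OF scaleC.bounded_linear_left cinner.bounded_linear_left])
  then show ?thesis
    by (simp add: rank_one_def bounded_linear_Blinfun_apply)
qed

lemma rank_one_bops: "rank_one \<eta> \<zeta> \<in> bops"
  by (simp add: bops_def cinner_scaleC_left scaleC_scaleC)

text \<open>The series hypothesis bounds the row of the \<open>a i\<close>, that is, the column of
  their adjoints. Normality turns this into a bound on the column of the \<open>a i\<close>
  themselves.\<close>

lemma abelian_eh_series: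
  assumes A: "abelian_cstar_subalgebra A" and eh: "eh_series A A I a b"
  obtains C where "sq_bounded_family I b C" "sq_bounded_family I a C" "sq_bounded_family I (\<lambda>i. adj (a i)) C"
proof -
  obtain C where C: "sq_bounded_family I b C" "sq_bounded_family I (\<lambda>i. adj (a i)) C"
    using eh_series_bounded[OF eh] abelian_cstarD(1)[OF A] by metis
  have "(\<Sum>i\<in>J. (norm (adj (a i) \<xi>))\<^sup>2) = (\<Sum>i\<in>J. (norm (a i \<xi>))\<^sup>2)" if "J \<subseteq> I" for J \<xi>
    using that eh norm_adj_apply[OF A] by (intro sum.cong) (auto simp: eh_series_def)
  with C(2) have "sq_bounded_family I a C"
    unfolding sq_bounded_family_def sq_bounded_def by simp
  with C that show ?thesis by blast
qed

text \<open>Placed between \<open>a i\<close> and \<open>b i\<close>, a rank-one operator splits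
  each term into a product of two vector functionals.\<close>

lemma vector_series_has_sum:
  assumes A: "abelian_cstar_subalgebra A" and eh: "eh_series A A I a b"
  shows "((\<lambda>i. cinner (a i \<xi>') \<eta>' * cinner (b i \<xi>) \<eta>) has_sum
    cinner (eh_map I a b (rank_one \<xi>' \<eta>) \<xi>) \<eta>') I"
proof -
  note AD = abelian_cstarD[OF A]
  have "((\<lambda>i. cinner (rank_one \<xi>' \<eta> (b i \<xi>)) (adj (a i) \<eta>')) has_sum
      cinner (eh_map I a b (rank_one \<xi>' \<eta>) \<xi>) \<eta>') I"
    by (rule eh_map_cinner[OF eh AD(1) AD(1) rank_one_bops])
  also have "?this \<longleftrightarrow> ?thesis"
    using eh AD by (intro has_sum_cong)
      (auto simp: eh_series_def cinner_scaleC_left cinner_adj_right mult.commute)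
  finally show ?thesis .
qed

text \<open>
  Equality of the maps is tested on rank-one operators, which only yields the claim for vector
  functionals; it extends to arbitrary functionals one factor at a time, because
  \<open>\<Sum>i. f(a\<^sub>i) b\<^sub>i\<close> and \<open>\<Sum>i. g(b\<^sub>i) a\<^sub>i\<close> converge in norm.
\<close>

lemma eh_series_functionals_eq:
  assumes A: "abelian_cstar_subalgebra A"
    and eh: "eh_series A A I a b" "eh_series A A I' a' b'" and eq: "eh_map I a b = eh_map I' a' b'"
    and f: "bounded_functional_on A f M" and g: "bounded_functional_on A g N"
  shows "(\<Sum>\<^sub>\<infinity>i\<in>I. f (a i) * g (b i)) = (\<Sum>\<^sub>\<infinity>i\<in>I'. f (a' i) * g (b' i))"
proof -
  note AD = abelian_cstarD[OF A]
  have mem: "a i \<in> A" "b i \<in> A" if "i \<in> I" for i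
    using that eh by (auto simp: eh_series_def)
  have mem': "a' i \<in> A" "b' i \<in> A" if "i \<in> I'" for i
    using that eh by (auto simp: eh_series_def)
  obtain C where C: "sq_bounded_family I b C" "sq_bounded_family I a C"
    using abelian_eh_series[OF A eh(1)] by metis
  obtain C' where C': "sq_bounded_family I' b' C'" "sq_bounded_family I' a' C'"
    using abelian_eh_series[OF A eh(2)] by metis
  define v where "v \<xi> \<eta> = (\<lambda>x. cinner (blinfun_apply x \<xi>) \<eta>)" for \<xi> \<eta> :: 'a
  have v: "bounded_functional_on A (v \<xi> \<eta>) (norm \<xi> * norm \<eta>)" for \<xi> \<eta>
    unfolding v_def by (rule vector_functional_bounded[OF AD(1)])
  have step1: "\<exists>s. ((\<lambda>i. v \<xi>' \<eta>' (a i) * g (b i)) has_sum s) I \<and> ((\<lambda>i. v \<xi>' \<eta>' (a' i) * g (b' i)) has_sum s) I'"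
    for \<xi>' \<eta>'
  proof -
    note c = functional_family_sq_bounded[OF v AD(2) C(2) mem(1), of \<xi>' \<eta>']
    note c' = functional_family_sq_bounded[OF v AD(2) C'(2) mem'(1), of \<xi>' \<eta>']
    obtain z where z: "z \<in> A" "\<forall>h K. bounded_functional_on A h K \<longrightarrow>
        ((\<lambda>i. v \<xi>' \<eta>' (a i) * h (b i)) has_sum h z) I"
      using scaled_family_converges[OF AD(2,3) C(1) mem(2) c] by blast
    obtain z' where z': "z' \<in> A" "\<forall>h K. bounded_functional_on A h K \<longrightarrow>
        ((\<lambda>i. v \<xi>' \<eta>' (a' i) * h (b' i)) has_sum h z') I'"
      using scaled_family_converges[OF AD(2,3) C'(1) mem'(2) c'] by blast
    have "v \<xi> \<eta> z = v \<xi> \<eta> z'" for \<xi> \<eta>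
    proof -
      have "v \<xi> \<eta> z = cinner (eh_map I a b (rank_one \<xi>' \<eta>) \<xi>) \<eta>'"
        using z(2)[rule_format, OF v[of \<xi> \<eta>]] vector_series_has_sum[OF A eh(1), of \<xi>' \<eta>' \<xi> \<eta>]
        unfolding v_def by (rule has_sum_unique)
      moreover have "v \<xi> \<eta> z' = cinner (eh_map I' a' b' (rank_one \<xi>' \<eta>) \<xi>) \<eta>'"
        using z'(2)[rule_format, OF v[of \<xi> \<eta>]] vector_series_has_sum[OF A eh(2), of \<xi>' \<eta>' \<xi> \<eta>]
        unfolding v_def by (rule has_sum_unique)
      ultimately show ?thesis by (simp add: eq)
    qed
    then have "z = z'"
      by (intro bops_eqI) (simp add: v_def)
    then show ?thesis
      using z(2)[rule_format, OF g] z'(2)[rule_format, OF g] by blast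
  qed
  note d = functional_family_sq_bounded[OF g AD(2) C(1) mem(2)]
  note d' = functional_family_sq_bounded[OF g AD(2) C'(1) mem'(2)]
  obtain y where y: "y \<in> A" "\<forall>h K. bounded_functional_on A h K \<longrightarrow>
      ((\<lambda>i. g (b i) * h (a i)) has_sum h y) I"
    using scaled_family_converges[OF AD(2,3) C(2) mem(1) d] by blast
  obtain y' where y': "y' \<in> A" "\<forall>h K. bounded_functional_on A h K \<longrightarrow>
      ((\<lambda>i. g (b' i) * h (a' i)) has_sum h y') I'"
    using scaled_family_converges[OF AD(2,3) C'(2) mem'(1) d'] by blast
  have "v \<xi> \<eta> y = v \<xi> \<eta> y'" for \<xi> \<eta>
  proof -
    obtain s where s: "((\<lambda>i. v \<xi> \<eta> (a i) * g (b i)) has_sum s) I"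
      "((\<lambda>i. v \<xi> \<eta> (a' i) * g (b' i)) has_sum s) I'"
      using step1 by blast
    have "((\<lambda>i. v \<xi> \<eta> (a i) * g (b i)) has_sum v \<xi> \<eta> y) I"
      using y(2)[rule_format, OF v[of \<xi> \<eta>]] by (simp add: mult.commute)
    then have "v \<xi> \<eta> y = s" using s(1) by (rule has_sum_unique)
    moreover have "((\<lambda>i. v \<xi> \<eta> (a' i) * g (b' i)) has_sum v \<xi> \<eta> y') I'"
      using y'(2)[rule_format, OF v[of \<xi> \<eta>]] by (simp add: mult.commute)
    then have "v \<xi> \<eta> y' = s" using s(2) by (rule has_sum_unique)
    ultimately show ?thesis by simp
  qed
  then have "y = y'"
    by (intro bops_eqI) (simp add: v_def)
  then show ?thesis
    using infsumI[OF y(2)[rule_format, OF f]] infsumI[OF y'(2)[rule_format, OF f]] by (simp add: mult.commute)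
qed

text \<open>Characters of a Banach algebra are automatically contractive. Otherwise some
  \<open>p\<close> has norm below 1 and character value 1, and a solution \<open>b\<close> of
  \<open>b = p + (p o\<^sub>L b)\<close> forces \<open>F b x = 1 + F b x\<close>.\<close>

lemma character_bounded_functional:
  assumes A: "abelian_cstar_subalgebra A" and F: "star_hom_on A F"
  shows "bounded_functional_on A (\<lambda>a. F a x) 1"
proof -
  note AD = abelian_cstarD[OF A]
  have add: "\<And>a b. a \<in> A \<Longrightarrow> b \<in> A \<Longrightarrow> F (a + b) x = F a x + F b x"
    and scale: "\<And>c a. a \<in> A \<Longrightarrow> F (op_scaleC c a) x = c * F a x"
    and mult: "\<And>a b. a \<in> A \<Longrightarrow> b \<in> A \<Longrightarrow> F (a o\<^sub>L b) x = F a x * F b x"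
    using F by (auto simp: star_hom_on_def)
  have "cmod (F a x) \<le> norm a" if a: "a \<in> A" for a
  proof (rule ccontr)
    assume "\<not> cmod (F a x) \<le> norm a"
    then have less: "norm a < cmod (F a x)" by simp
    then have nz: "F a x \<noteq> 0" using norm_ge_zero[of a] by auto
    define p where "p = op_scaleC (1 / F a x) a"
    have pA: "p \<in> A" using AD(2) a by (simp add: p_def op_subspace_def)
    have Fp: "F p x = 1" using nz a by (simp add: p_def scale)
    have "norm p \<le> cmod (1 / F a x) * norm a"
      unfolding p_def by (rule norm_op_scaleC)
    also have "\<dots> < 1"
      using less nz by (simp add: norm_divide divide_less_eq)
    finally have p1: "norm p < 1" .
    \<comment> \<open>The contraction principle sums the geometric series p + p^2 + ... inside
      \<open>A\<close>, without reference to a unit.\<close>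
    have "\<exists>!b\<in>A. p + (p o\<^sub>L b) = b"
    proof (rule Banach_fix[where c = "norm p"])
      show "complete A" using AD(3) by (simp add: complete_eq_closed)
      show "A \<noteq> {}" using a by blast
      show "(\<lambda>b. p + (p o\<^sub>L b)) ` A \<subseteq> A" using pA AD(2,4) by (auto simp: op_subspace_def)
      fix b c
      have "(p + (p o\<^sub>L b)) - (p + (p o\<^sub>L c)) = p o\<^sub>L (b - c)"
        by (simp add: bounded_bilinear.diff_right[OF bounded_bilinear_blinfun_compose])
      then show "dist (p + (p o\<^sub>L b)) (p + (p o\<^sub>L c)) \<le> norm p * dist b c"
        using norm_blinfun_compose[of p "b - c"] by (simp add: dist_norm)
    qed (use p1 in auto)
    then obtain b where b: "b \<in> A" "p + (p o\<^sub>L b) = b" by blast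
    have "F b x = F (p + (p o\<^sub>L b)) x" by (simp add: b)
    also have "\<dots> = 1 + F b x"
      using add[OF pA AD(4)[OF pA b(1)]] mult[OF pA b(1)] Fp by simp
    finally show False by simp
  qed
  then show ?thesis
    by (simp add: bounded_functional_on_def add scale)
qed

text \<open>Point evaluations are bounded functionals, so the function attached to a series depends
  only on the map it defines; this justifies the definite description.\<close>

lemma hom_tensor_eq:
  fixes I :: "'i set"
  assumes A: "abelian_cstar_subalgebra A" and F: "star_hom_on A F" and eh: "eh_series A A I a b"
  shows "hom_tensor TYPE('i) A F (eh_map I a b) =
    fun_tensor I (\<lambda>i. apply_bcontfun (F (a i))) (\<lambda>i. apply_bcontfun (F (b i)))"
  unfolding hom_tensor_def
proof (rule the_equality)
  fix u
  assume "\<exists>(J :: 'i set) a' b'. eh_series A A J a' b' \<and> eh_map I a b = eh_map J a' b' \<and>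
      u = fun_tensor J (\<lambda>i. apply_bcontfun (F (a' i))) (\<lambda>i. apply_bcontfun (F (b' i)))"
  then obtain J :: "'i set" and a' b' where J: "eh_series A A J a' b'" "eh_map I a b = eh_map J a' b'"
    and u: "u = fun_tensor J (\<lambda>i. apply_bcontfun (F (a' i))) (\<lambda>i. apply_bcontfun (F (b' i)))"
    by blast
  show "u = fun_tensor I (\<lambda>i. apply_bcontfun (F (a i))) (\<lambda>i. apply_bcontfun (F (b i)))"
    unfolding u fun_tensor_def
    using eh_series_functionals_eq[OF A eh J character_bounded_functional[OF A F] character_bounded_functional[OF A F]]
    by (simp add: fun_eq_iff)
qed (use eh in blast)

lemma character_family_summable:
  assumes A: "abelian_cstar_subalgebra A" and F: "star_hom_on A F"
    and e: "sq_bounded_family I e C" "\<And>i. i \<in> I \<Longrightarrow> e i \<in> A"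
  shows "(\<lambda>i. (cmod (F (e i) x))\<^sup>2) summable_on I" "(\<Sum>\<^sub>\<infinity>i\<in>I. (cmod (F (e i) x))\<^sup>2) \<le> C"
  using functional_family_sq_bounded[OF character_bounded_functional[OF A F] abelian_cstarD(2)[OF A] e]
  by (auto dest: sq_bounded_summable sq_bounded_infsum_le)

lemma fun_tensor_mem:
  fixes I :: "'i set"
  assumes A: "abelian_cstar_subalgebra A" and F: "star_hom_on A F" and eh: "eh_series A A I a b"
  shows "fun_tensor I (\<lambda>i. apply_bcontfun (F (a i))) (\<lambda>i. apply_bcontfun (F (b i)))
    \<in> eh_fun_tensor TYPE('i) (F ` A)"
proof -
  obtain C where C: "sq_bounded_family I b C" "sq_bounded_family I a C"
    using abelian_eh_series[OF A eh] by metis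
  have mem: "a i \<in> A" "b i \<in> A" if "i \<in> I" for i
    using that eh by (auto simp: eh_series_def)
  show ?thesis
    unfolding eh_fun_tensor_def mem_Collect_eq
    using mem character_family_summable[OF A F C(1)] character_family_summable[OF A F C(2)]
    by (intro exI[of _ I] exI[of _ "\<lambda>i. F (a i)"] exI[of _ "\<lambda>i. F (b i)"] conjI refl ballI exI[of _ C] allI) auto
qed

section \<open>Injective *-homomorphisms are isometric\<close>

text \<open>Iterates of s \<mapsto> (w + s^2) / 2, whose smaller fixed point for 0 \<le> w \<le> 1
  is 1 - sqrt (1 - w). For w = 1 - g^2 this is 1 - |g|, so absolute values are reached through
  polynomials.\<close>

primrec sqrt_iter :: "real \<Rightarrow> nat \<Rightarrow> real" where
  "sqrt_iter w 0 = 0"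
| "sqrt_iter w (Suc n) = (w + (sqrt_iter w n)\<^sup>2) / 2"

primrec op_sqrt_iter :: "('h::complex_hilbert \<Rightarrow>\<^sub>L 'h) \<Rightarrow> nat \<Rightarrow> ('h \<Rightarrow>\<^sub>L 'h)" where
  "op_sqrt_iter w 0 = 0"
| "op_sqrt_iter w (Suc n) = (1/2) *\<^sub>R (w + (op_sqrt_iter w n o\<^sub>L op_sqrt_iter w n))"

lemma sqrt_iter_bounds:
  assumes "\<bar>g\<bar> \<le> 1"
  shows "0 \<le> sqrt_iter (1 - g\<^sup>2) n \<and> sqrt_iter (1 - g\<^sup>2) n \<le> 1 - \<bar>g\<bar>"
proof (induction n)
  case (Suc n)
  have w: "0 \<le> 1 - g\<^sup>2" "1 - g\<^sup>2 = 2 * (1 - \<bar>g\<bar>) - (1 - \<bar>g\<bar>)\<^sup>2"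
    using assms by (simp add: abs_square_le_1, simp add: power2_eq_square algebra_simps)
  have "(sqrt_iter (1 - g\<^sup>2) n)\<^sup>2 \<le> (1 - \<bar>g\<bar>)\<^sup>2"
    using Suc by (intro power_mono) auto
  then have "(1 - g\<^sup>2 + (sqrt_iter (1 - g\<^sup>2) n)\<^sup>2) / 2 \<le> (1 - g\<^sup>2 + (1 - \<bar>g\<bar>)\<^sup>2) / 2"
    by simp
  also have "\<dots> = 1 - \<bar>g\<bar>"
    by (subst w(2)) simp
  finally show ?case
    using w(1) by simp
qed (use assms in simp)

lemma sqrt_iter_mono:
  assumes "\<bar>g\<bar> \<le> 1"
  shows "sqrt_iter (1 - g\<^sup>2) n \<le> sqrt_iter (1 - g\<^sup>2) (Suc n)"
proof (induction n)
  case (Suc n)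
  then have "(sqrt_iter (1 - g\<^sup>2) n)\<^sup>2 \<le> (sqrt_iter (1 - g\<^sup>2) (Suc n))\<^sup>2"
    using sqrt_iter_bounds[OF assms] by (intro power_mono) auto
  then show ?case by simp
qed (use assms in \<open>simp add: abs_square_le_1\<close>)

lemma sqrt_iter_tendsto:
  assumes "\<bar>g\<bar> \<le> 1"
  shows "sqrt_iter (1 - g\<^sup>2) \<longlonglongrightarrow> 1 - \<bar>g\<bar>"
proof -
  let ?h = "sqrt_iter (1 - g\<^sup>2)"
  have "incseq ?h"
    by (rule incseq_SucI) (rule sqrt_iter_mono[OF assms])
  moreover have "\<And>n. ?h n \<le> 1 - \<bar>g\<bar>"
    using sqrt_iter_bounds[OF assms] by blast
  ultimately obtain L where L: "?h \<longlonglongrightarrow> L" "\<forall>n. ?h n \<le> L"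
    using incseq_convergent[of ?h "1 - \<bar>g\<bar>"] by blast
  have "(\<lambda>n. ?h (Suc n)) \<longlonglongrightarrow> L"
    using L(1) by (rule LIMSEQ_Suc)
  moreover have "(\<lambda>n. ?h (Suc n)) \<longlonglongrightarrow> (1 - g\<^sup>2 + L\<^sup>2) / 2"
    by (simp del: of_nat_Suc) (intro tendsto_intros L(1), simp)
  ultimately have "L = (1 - g\<^sup>2 + L\<^sup>2) / 2"
    by (rule LIMSEQ_unique)
  \<comment> \<open>The fixed-point equation leaves 1 - |g| and 1 + |g|; the upper bound on the
    iterates selects the former.\<close>
  then have "(1 - L)\<^sup>2 = g\<^sup>2"
    by (simp add: power2_eq_square algebra_simps)
  then have "\<bar>1 - L\<bar> = \<bar>g\<bar>"
    by (simp add: power2_eq_iff abs_eq_iff)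
  moreover have "L \<le> 1 - \<bar>g\<bar>"
    using L(1) sqrt_iter_bounds[OF assms] by (intro LIMSEQ_le_const2) auto
  ultimately have "L = 1 - \<bar>g\<bar>" by linarith
  with L(1) show ?thesis by simp
qed

text \<open>The scalar iteration at 1 majorizes the operator iteration, by submultiplicativity and
  the triangle inequality. The increments are majorized as well because the Cauchy estimate
  telescopes them.\<close>

lemma op_sqrt_iter_bounds:
  assumes w: "norm w \<le> 1"
  shows "norm (op_sqrt_iter w n) \<le> sqrt_iter 1 n \<and>
    norm (op_sqrt_iter w (Suc n) - op_sqrt_iter w n) \<le> sqrt_iter 1 (Suc n) - sqrt_iter 1 n"
proof (induction n)
  case (Suc n)
  define s s' r r' where "s = op_sqrt_iter w n" and "s' = op_sqrt_iter w (Suc n)"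
    and "r = sqrt_iter 1 n" and "r' = sqrt_iter 1 (Suc n)"
  have IH: "norm s \<le> r" "norm (s' - s) \<le> r' - r"
    using Suc by (simp_all only: s_def s'_def r_def r'_def)
  have "norm s' \<le> norm (s' - s) + norm s"
    by (metis diff_add_cancel norm_triangle_ineq)
  with IH have s': "norm s' \<le> r'" by linarith
  have "op_sqrt_iter w (Suc (Suc n)) - s' = (1/2) *\<^sub>R ((s' o\<^sub>L s') - (s o\<^sub>L s))"
    unfolding op_sqrt_iter.simps(2)[of w "Suc n"]
    by (simp add: s'_def s_def scaleR_diff_right[symmetric])
  also have "(s' o\<^sub>L s') - (s o\<^sub>L s) = (s' o\<^sub>L (s' - s)) + ((s' - s) o\<^sub>L s)"
    by (rule blinfun_eqI) (simp add: blinfun.diff_left blinfun.diff_right blinfun.add_left)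
  finally have "norm (op_sqrt_iter w (Suc (Suc n)) - s') =
      (1/2) * norm ((s' o\<^sub>L (s' - s)) + ((s' - s) o\<^sub>L s))"
    by simp
  also have "\<dots> \<le> (1/2) * (norm s' * norm (s' - s) + norm (s' - s) * norm s)"
    by (intro mult_left_mono order_trans[OF norm_triangle_ineq] add_mono norm_blinfun_compose) auto
  also have "\<dots> \<le> (1/2) * (r' * (r' - r) + (r' - r) * r)"
    using IH s' norm_ge_zero[of s] norm_ge_zero[of s'] norm_ge_zero[of "s' - s"]
    by (intro mult_left_mono add_mono mult_mono) (linarith | simp)+
  also have "\<dots> = sqrt_iter 1 (Suc (Suc n)) - r'"
    by (simp add: r_def r'_def power2_eq_square algebra_simps)
  finally show ?case
    using s' unfolding s'_def r'_def by blast
qed (use w in simp)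

text \<open>When \<open>norm w = 1\<close> the iteration need not be a strict contraction, so
  convergence comes from the increasing scalar majorant, which tends to 1.\<close>

lemma op_sqrt_iter_convergent:
  fixes w :: "'h::complex_hilbert \<Rightarrow>\<^sub>L 'h"
  assumes w: "norm w \<le> 1"
  obtains S where "op_sqrt_iter w \<longlonglongrightarrow> S" "norm S \<le> 1"
proof -
  let ?s = "op_sqrt_iter w" and ?r = "sqrt_iter 1"
  have r: "?r \<longlonglongrightarrow> 1" and r1: "?r n \<le> 1" for n
    using sqrt_iter_tendsto[of 0] sqrt_iter_bounds[of 0 n] by simp_all
  have diff: "norm (?s (n + k) - ?s n) \<le> ?r (n + k) - ?r n" for n k
  proof (induction k)
    case (Suc k)
    have "norm (?s (Suc (n + k)) - ?s n) \<le> norm (?s (Suc (n + k)) - ?s (n + k)) + norm (?s (n + k) - ?s n)"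
      using norm_triangle_ineq[of "?s (Suc (n + k)) - ?s (n + k)" "?s (n + k) - ?s n"] by simp
    with Suc op_sqrt_iter_bounds[OF w, of "n + k"]
    have "norm (?s (Suc (n + k)) - ?s n) \<le> ?r (Suc (n + k)) - ?r n"
      by linarith
    then show ?case by (simp only: add_Suc_right)
  qed simp
  have "Cauchy ?s"
  proof (rule CauchyI')
    fix e :: real assume "0 < e"
    with r have "\<forall>\<^sub>F n in sequentially. ?r n > 1 - e"
      by (intro order_tendstoD) auto
    then obtain N where N: "\<And>n. n \<ge> N \<Longrightarrow> ?r n > 1 - e"
      by (auto simp: eventually_sequentially)
    show "\<exists>M. \<forall>m\<ge>M. \<forall>n>m. dist (?s m) (?s n) < e"
    proof (intro exI[of _ N] allI impI)
      fix m n assume "N \<le> m" "m < n"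
      then obtain k where "n = m + k" using less_imp_add_positive by blast
      then show "dist (?s m) (?s n) < e"
        using diff[of m k] N[OF \<open>N \<le> m\<close>] r1[of n] by (simp add: dist_norm norm_minus_commute)
    qed
  qed
  then obtain S where S: "?s \<longlonglongrightarrow> S"
    by (auto simp: Cauchy_convergent_iff convergent_def)
  have "norm (?s n) \<le> 1" for n
    using op_sqrt_iter_bounds[OF w, of n] r1[of n] by linarith
  then have "norm S \<le> 1"
    using S by (intro LIMSEQ_le_const2[OF tendsto_norm]) auto
  with S that show ?thesis by blast
qed

text \<open>
  Since \<open>\<A>\<close> need not contain the identity, functional calculus is carried out in its multiplier
  algebra: the operator \<open>z\<close> multiplies \<open>\<A>\<close> into itself, and \<open>F\<close> turns this into multiplication by \<open>h\<close>.
\<close>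

definition multiplier ::
  "('h::complex_hilbert \<Rightarrow>\<^sub>L 'h) set \<Rightarrow> (('h \<Rightarrow>\<^sub>L 'h) \<Rightarrow> ('e::topological_space \<Rightarrow>\<^sub>C complex)) \<Rightarrow>
   ('h \<Rightarrow>\<^sub>L 'h) \<Rightarrow> ('e \<Rightarrow> real) \<Rightarrow> bool" where
  "multiplier A F z h \<longleftrightarrow> (\<forall>b\<in>A. z o\<^sub>L b \<in> A \<and> (\<forall>x. F (z o\<^sub>L b) x = complex_of_real (h x) * F b x))"

context
  fixes A :: "('h::complex_hilbert \<Rightarrow>\<^sub>L 'h) set"
    and F :: "('h \<Rightarrow>\<^sub>L 'h) \<Rightarrow> ('e::topological_space \<Rightarrow>\<^sub>C complex)"
  assumes A: "abelian_cstar_subalgebra A" and F: "star_hom_on A F"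
begin

lemma multiplier_id: "multiplier A F id_blinfun (\<lambda>_. 1)"
proof -
  have "id_blinfun o\<^sub>L b = b" for b :: "'h \<Rightarrow>\<^sub>L 'h"
    by (rule blinfun_eqI) simp
  then show ?thesis by (simp add: multiplier_def)
qed

lemma multiplier_zero: "multiplier A F 0 (\<lambda>_. 0)"
  using abelian_cstarD(2)[OF A] bounded_functional_on_0[OF character_bounded_functional[OF A F]]
  by (simp add: multiplier_def op_subspace_def)

lemma multiplier_mem:
  assumes "p \<in> A" "\<And>x. F p x = complex_of_real (h x)"
  shows "multiplier A F p h"
  using F abelian_cstarD(4)[OF A] assms by (simp add: multiplier_def star_hom_on_def)

lemma multiplier_add:
  assumes "multiplier A F z h" "multiplier A F z' h'"
  shows "multiplier A F (z + z') (\<lambda>x. h x + h' x)"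
proof -
  have "(z + z') o\<^sub>L b = (z o\<^sub>L b) + (z' o\<^sub>L b)" for b :: "'h \<Rightarrow>\<^sub>L 'h"
    by (rule blinfun_eqI) (simp add: blinfun.add_left)
  note distrib = this
  show ?thesis
    unfolding multiplier_def
  proof (intro ballI conjI allI)
    fix b x assume "b \<in> A"
    then have b: "z o\<^sub>L b \<in> A" "F (z o\<^sub>L b) x = complex_of_real (h x) * F b x"
      "z' o\<^sub>L b \<in> A" "F (z' o\<^sub>L b) x = complex_of_real (h' x) * F b x"
      using assms by (simp_all add: multiplier_def)
    show "(z + z') o\<^sub>L b \<in> A"
      unfolding distrib using b abelian_cstarD(2)[OF A] by (simp add: op_subspace_def)
    show "F ((z + z') o\<^sub>L b) x = complex_of_real (h x + h' x) * F b x"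
      unfolding distrib using b F by (simp add: star_hom_on_def distrib_right)
  qed
qed

lemma multiplier_scaleR:
  assumes "multiplier A F z h"
  shows "multiplier A F (r *\<^sub>R z) (\<lambda>x. r * h x)"
proof -
  have "(r *\<^sub>R z) o\<^sub>L b = op_scaleC (complex_of_real r) (z o\<^sub>L b)" for b :: "'h \<Rightarrow>\<^sub>L 'h"
    by (rule blinfun_eqI) (simp add: blinfun.scaleR_left op_scaleC_apply scaleC_of_real)
  then show ?thesis
    using assms F abelian_cstarD(2)[OF A]
    by (simp add: multiplier_def op_subspace_def star_hom_on_def)
qed

lemma multiplier_diff:
  assumes "multiplier A F z h" "multiplier A F z' h'"
  shows "multiplier A F (z - z') (\<lambda>x. h x - h' x)"
  using multiplier_add[OF assms(1) multiplier_scaleR[OF assms(2), of "-1"]] by simp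

lemma multiplier_compose:
  assumes "multiplier A F z h" "multiplier A F z' h'"
  shows "multiplier A F (z o\<^sub>L z') (\<lambda>x. h x * h' x)"
proof -
  have "(z o\<^sub>L z') o\<^sub>L b = z o\<^sub>L (z' o\<^sub>L b)" for b :: "'h \<Rightarrow>\<^sub>L 'h"
    by (rule blinfun_eqI) simp
  then show ?thesis
    using assms by (simp add: multiplier_def mult.assoc)
qed

text \<open>\<open>A\<close> is closed and characters are contractive, so norm convergence of the
  operators passes to the function values at each point; pointwise convergence of \<open>h\<close>
  then identifies the limit.\<close>

lemma multiplier_limit:
  assumes zh: "\<And>n. multiplier A F (z n) (h n)" and z: "z \<longlonglongrightarrow> Z" and h: "\<And>x. (\<lambda>n. h n x) \<longlonglongrightarrow> H x"
  shows "multiplier A F Z H"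
  unfolding multiplier_def
proof (intro ballI conjI allI)
  note AD = abelian_cstarD[OF A]
  fix b assume b: "b \<in> A"
  have lim: "(\<lambda>n. z n o\<^sub>L b) \<longlonglongrightarrow> (Z o\<^sub>L b)"
    by (rule bounded_bilinear.tendsto[OF bounded_bilinear_blinfun_compose z tendsto_const])
  have mem: "z n o\<^sub>L b \<in> A" for n
    using zh b by (simp add: multiplier_def)
  show Zb: "Z o\<^sub>L b \<in> A"
    using AD(3) mem lim by (rule closed_sequentially)
  fix x
  note Fx = character_bounded_functional[OF A F, of x]
  have "(\<lambda>n. F (z n o\<^sub>L b) x) \<longlonglongrightarrow> F (Z o\<^sub>L b) x"
  proof (rule tendsto_dist_iff[THEN iffD2], rule tendsto_sandwich[OF _ _ tendsto_const])
    have "dist (F (z n o\<^sub>L b) x) (F (Z o\<^sub>L b) x) \<le> dist (z n o\<^sub>L b) (Z o\<^sub>L b)" for n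
      using Fx op_subspace_diff[OF AD(2) mem Zb] bounded_functional_on_diff[OF Fx AD(2) mem Zb]
      by (metis (no_types, lifting) bounded_functional_on_def dist_norm mult_1)
    then show "\<forall>\<^sub>F n in sequentially. dist (F (z n o\<^sub>L b) x) (F (Z o\<^sub>L b) x) \<le> dist (z n o\<^sub>L b) (Z o\<^sub>L b)"
      by simp
    show "(\<lambda>n. dist (z n o\<^sub>L b) (Z o\<^sub>L b)) \<longlonglongrightarrow> 0"
      using lim by (simp add: tendsto_dist_iff[symmetric])
  qed simp
  moreover have "(\<lambda>n. F (z n o\<^sub>L b) x) \<longlonglongrightarrow> complex_of_real (H x) * F b x"
  proof -
    have "F (z n o\<^sub>L b) x = complex_of_real (h n x) * F b x" for n
      using zh b by (simp add: multiplier_def)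
    then show ?thesis
      using h[of x] by (auto intro!: tendsto_intros)
  qed
  ultimately show "F (Z o\<^sub>L b) x = complex_of_real (H x) * F b x"
    by (rule LIMSEQ_unique)
qed

lemma multiplier_sqrt_iter:
  assumes "multiplier A F w h"
  shows "multiplier A F (op_sqrt_iter w n) (\<lambda>x. sqrt_iter (h x) n)"
proof (induction n)
  case 0
  show ?case using multiplier_zero by simp
next
  case (Suc n)
  show ?case
    using multiplier_scaleR[OF multiplier_add[OF assms multiplier_compose[OF Suc Suc]], of "1/2"]
    by (simp add: power2_eq_square)
qed

text \<open>
  With \<open>p = adj y o y\<close>, the operator \<open>t = (p - s\<^sup>2) / 2R\<close> acts on the function side as some \<open>g \<le> 0\<close>, so
  \<open>t + \<bar>t\<bar>\<close> multiplies every \<open>F b\<close> by \<open>0\<close>; injectivity gives \<open>(t + \<bar>t\<bar>) p = 0\<close>, which says that \<open>p \<le> s\<^sup>2\<close>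
  on the range of \<open>p\<close>. Here \<open>\<bar>t\<bar> = 1 - S\<close>, where \<open>S\<close> is the limit of the iteration
  \<open>S \<leftarrow> (1 - t\<^sup>2 + S\<^sup>2) / 2\<close>.
\<close>

lemma injective_star_hom_norm_le:
  assumes inj: "inj_on F A" and y: "y \<in> A" and Fy: "\<And>x. cmod (F y x) \<le> s"
  shows "norm y \<le> s"
proof (rule ccontr)
  assume "\<not> norm y \<le> s"
  note AD = abelian_cstarD[OF A]
  \<comment> \<open>Types are nonempty, so some point of the space witnesses the sign of
    \<open>s\<close>.\<close>
  have s: "0 \<le> s" using Fy[of undefined] norm_ge_zero order_trans by blast
  with \<open>\<not> norm y \<le> s\<close> have ys: "s < norm y" "0 < norm y" by auto
  have yb: "y \<in> bops" using AD y by blast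
  define p where "p = adj y o\<^sub>L y"
  have pA: "p \<in> A" using AD y by (simp add: p_def)
  have pb: "p \<in> bops" using AD pA by blast
  have adj_p: "adj p = p"
    using yb by (simp add: p_def adj_compose adj_adj bops_adj)
  define R where "R = (norm y)\<^sup>2"
  have R: "0 < R" using ys by (simp add: R_def)
  have norm_p: "norm p = R" using yb by (simp add: p_def R_def norm_adj_compose)
  have \<sigma>R: "s\<^sup>2 \<le> R" unfolding R_def using s ys by (intro power_mono) auto
  \<comment> \<open>Both \<open>norm p\<close> and \<open>s\<^sup>2\<close> are at most
    \<open>R\<close>, so the divisor \<open>2 * R\<close> yields \<open>norm t \<le> 1\<close> and
    |g| \<le> 1, the range in which the iteration converges.\<close>
  define t where "t = (1 / (2 * R)) *\<^sub>R (p - s\<^sup>2 *\<^sub>R id_blinfun)"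
  define g where "g x = (1 / (2 * R)) * ((cmod (F y x))\<^sup>2 - s\<^sup>2)" for x
  have tg: "multiplier A F t g"
  proof -
    have "F p x = complex_of_real ((cmod (F y x))\<^sup>2)" for x
      using F y AD(5)[OF y] by (simp add: p_def star_hom_on_def mult.commute flip: complex_norm_square)
    then have "multiplier A F p (\<lambda>x. (cmod (F y x))\<^sup>2)"
      by (intro multiplier_mem pA)
    from multiplier_scaleR[OF multiplier_diff[OF this multiplier_scaleR[OF multiplier_id, of "s\<^sup>2"]], of "1 / (2 * R)"]
    show ?thesis by (simp add: t_def g_def[abs_def])
  qed
  have g: "g x \<le> 0" "\<bar>g x\<bar> \<le> 1" for x
  proof -
    have "(cmod (F y x))\<^sup>2 \<le> s\<^sup>2" using Fy by (intro power_mono) auto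
    then show g0: "g x \<le> 0"
      using R by (simp add: g_def divide_le_0_iff)
    have "s\<^sup>2 - (cmod (F y x))\<^sup>2 \<le> 2 * R"
      using \<sigma>R R zero_le_power2[of "cmod (F y x)"] by linarith
    then have "- 1 \<le> g x"
      using R by (simp add: g_def pos_le_divide_eq)
    with g0 show "\<bar>g x\<bar> \<le> 1" by linarith
  qed
  have t_inner: "inner (t \<xi>) \<eta> = inner \<xi> (t \<eta>)" for \<xi> \<eta>
  proof -
    have "inner (p \<xi>) \<eta> = inner \<xi> (p \<eta>)"
      using cinner_adj_right[OF pb, of \<xi> \<eta>] by (simp add: adj_p Re_cinner[symmetric])
    then show ?thesis
      by (simp add: t_def blinfun.scaleR_left blinfun.diff_left inner_diff)
  qed
  have "norm t \<le> 1"
  proof -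
    have "norm (p - s\<^sup>2 *\<^sub>R id_blinfun) \<le> norm p + norm (s\<^sup>2 *\<^sub>R (id_blinfun :: 'h \<Rightarrow>\<^sub>L 'h))"
      by (rule norm_triangle_ineq4)
    also have "\<dots> \<le> R + s\<^sup>2 * 1"
      unfolding norm_scaleR by (intro add_mono mult_mono norm_blinfun_id_le) (auto simp: norm_p)
    also have "\<dots> \<le> 2 * R" using \<sigma>R by simp
    finally show ?thesis using R by (simp add: t_def divide_le_eq)
  qed
  then have t_le: "norm (t \<xi>) \<le> norm \<xi>" for \<xi>
    using norm_blinfun[of t \<xi>] mult_right_mono[of "norm t" 1 "norm \<xi>"] by simp
  define w where "w = id_blinfun - (t o\<^sub>L t)"
  \<comment> \<open>\<open>t\<close> is a self-adjoint contraction, so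
    \<open>(norm (w \<xi>))\<^sup>2\<close> expands to \<open>(norm \<xi>)\<^sup>2\<close> minus
    twice \<open>(norm (t \<xi>))\<^sup>2\<close> plus a term no larger than the latter.\<close>
  have "norm w \<le> 1"
  proof (rule norm_blinfun_bound)
    fix \<xi>
    have "(norm (w \<xi>))\<^sup>2 = (norm \<xi>)\<^sup>2 - 2 * inner \<xi> (t (t \<xi>)) + (norm (t (t \<xi>)))\<^sup>2"
      unfolding power2_norm_eq_inner
      by (simp add: w_def blinfun.diff_left inner_diff inner_commute)
    also have "inner \<xi> (t (t \<xi>)) = (norm (t \<xi>))\<^sup>2"
      by (simp add: power2_norm_eq_inner t_inner)
    also have "(norm \<xi>)\<^sup>2 - 2 * (norm (t \<xi>))\<^sup>2 + (norm (t (t \<xi>)))\<^sup>2 \<le> (norm \<xi>)\<^sup>2"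
      using power_mono[OF t_le[of "t \<xi>"] norm_ge_zero, of 2] zero_le_power2[of "norm (t \<xi>)"] by linarith
    finally have "norm (w \<xi>) \<le> norm \<xi>"
      by (rule power2_le_imp_le) simp
    then show "norm (w \<xi>) \<le> 1 * norm \<xi>"
      by simp
  qed simp
  then obtain S where S: "op_sqrt_iter w \<longlonglongrightarrow> S" "norm S \<le> 1"
    by (rule op_sqrt_iter_convergent)
  have "multiplier A F w (\<lambda>x. 1 - (g x)\<^sup>2)"
    using multiplier_diff[OF multiplier_id multiplier_compose[OF tg tg]]
    by (simp add: w_def power2_eq_square)
  then have "multiplier A F S (\<lambda>x. 1 - \<bar>g x\<bar>)"
    using S(1) by (rule multiplier_limit[OF multiplier_sqrt_iter]) (rule sqrt_iter_tendsto[OF g(2)])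
  note multiplier_add[OF tg multiplier_diff[OF multiplier_id this]]
  then have "multiplier A F (t + (id_blinfun - S)) (\<lambda>x. 0)"
    using g(1) by (simp add: abs_of_nonpos)
  then have zp: "(t + (id_blinfun - S)) o\<^sub>L p \<in> A" "\<And>x. F ((t + (id_blinfun - S)) o\<^sub>L p) x = 0"
    using pA by (auto simp: multiplier_def)
  have zero: "0 \<in> A" "\<And>x. F 0 x = 0"
    using bounded_functional_on_0[OF character_bounded_functional[OF A F]] AD(2)
    by (auto simp: op_subspace_def)
  have "F ((t + (id_blinfun - S)) o\<^sub>L p) = F 0"
    by (rule bcontfun_eqI) (simp add: zp zero)
  then have ann: "(t + (id_blinfun - S)) o\<^sub>L p = 0"
    using inj zp(1) zero(1) by (auto dest: inj_onD)
  \<comment> \<open>On a vector \<open>\<zeta>\<close> in the range of \<open>p\<close>,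
    annihilation gives \<open>t \<zeta> = S \<zeta> - \<zeta>\<close>; since
    \<open>norm S \<le> 1\<close>, the number \<open>inner (t \<zeta>) \<zeta>\<close> is
    nonpositive, which unfolds to the bound on \<open>y \<zeta>\<close>.\<close>
  have yp: "norm (y o\<^sub>L p) \<le> s * norm p"
  proof (rule norm_blinfun_bound)
    fix \<xi>
    define \<zeta> where "\<zeta> = p \<xi>"
    have "((t + (id_blinfun - S)) o\<^sub>L p) \<xi> = 0" by (simp add: ann)
    then have "t \<zeta> = S \<zeta> - \<zeta>"
      by (simp add: \<zeta>_def blinfun.add_left blinfun.diff_left algebra_simps)
    then have "inner (t \<zeta>) \<zeta> = inner (S \<zeta>) \<zeta> - (norm \<zeta>)\<^sup>2"
      by (simp add: inner_diff power2_norm_eq_inner)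
    also have "inner (S \<zeta>) \<zeta> \<le> norm (S \<zeta>) * norm \<zeta>"
      by (rule norm_cauchy_schwarz)
    also have "\<dots> \<le> (1 * norm \<zeta>) * norm \<zeta>"
      using S(2) by (intro mult_right_mono order_trans[OF norm_blinfun] mult_mono) auto
    finally have "inner (t \<zeta>) \<zeta> \<le> 0" by (simp add: power2_eq_square)
    then have "inner (p \<zeta>) \<zeta> - s\<^sup>2 * (norm \<zeta>)\<^sup>2 \<le> 0"
      using R by (simp add: t_def blinfun.scaleR_left blinfun.diff_left inner_diff
          power2_norm_eq_inner divide_le_0_iff)
    moreover have "inner (p \<zeta>) \<zeta> = (norm (y \<zeta>))\<^sup>2"
      using norm_apply_sq_adj[OF yb, of \<zeta>] by (simp add: p_def Re_cinner[symmetric] complex_eq_iff)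
    ultimately have "(norm (y \<zeta>))\<^sup>2 \<le> (s * norm \<zeta>)\<^sup>2"
      by (simp add: power_mult_distrib)
    then have "norm (y \<zeta>) \<le> s * norm \<zeta>"
      by (rule power2_le_imp_le) (use s in simp)
    also have "\<dots> \<le> s * (norm p * norm \<xi>)"
      unfolding \<zeta>_def using s by (intro mult_left_mono norm_blinfun)
    finally show "norm ((y o\<^sub>L p) \<xi>) \<le> s * norm p * norm \<xi>"
      by (simp add: \<zeta>_def mult.assoc)
  qed (use s in simp)
  \<comment> \<open>\<open>p o\<^sub>L p\<close> factors as \<open>adj y\<close> after
    \<open>y o\<^sub>L p\<close>, so one of the four factors \<open>norm y\<close> in
    \<open>R\<^sup>2\<close> gets replaced by \<open>s\<close>, against
    \<open>s < norm y\<close>.\<close>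
  have "R\<^sup>2 = norm (adj y o\<^sub>L (y o\<^sub>L p))"
  proof -
    have "R\<^sup>2 = norm (adj p o\<^sub>L p)"
      using pb by (simp add: norm_adj_compose norm_p)
    also have "adj p o\<^sub>L p = adj y o\<^sub>L (y o\<^sub>L p)"
      by (rule blinfun_eqI) (simp add: adj_p, simp add: p_def)
    finally show ?thesis .
  qed
  also have "\<dots> \<le> norm y * norm (y o\<^sub>L p)"
    using norm_blinfun_compose[of "adj y" "y o\<^sub>L p"] yb by (simp add: norm_adj)
  also have "\<dots> \<le> norm y * (s * R)"
    using yp unfolding norm_p by (rule mult_left_mono) simp
  finally have RR: "R\<^sup>2 \<le> norm y * (s * R)" .
  then have "R * R \<le> (norm y * s) * R"
    by (simp add: power2_eq_square mult.assoc)
  then have "R \<le> norm y * s"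
    using R by (simp add: mult_le_cancel_right)
  then have "norm y * norm y \<le> norm y * s"
    by (simp add: R_def power2_eq_square)
  then show False
    using ys by (simp add: mult_le_cancel_left_pos)
qed

end

section \<open>Approximation of functionals on square-summable families\<close>

lemma bounded_functional_on_diff_functional:
  assumes "bounded_functional_on A f M" "bounded_functional_on A g N"
  shows "bounded_functional_on A (\<lambda>a. f a - g a) (M + N)"
  unfolding bounded_functional_on_def
proof (intro conjI ballI allI)
  fix a assume "a \<in> A"
  then have "cmod (f a) \<le> M * norm a" "cmod (g a) \<le> N * norm a"
    using assms by (auto simp: bounded_functional_on_def)
  then show "cmod (f a - g a) \<le> (M + N) * norm a"
    using norm_triangle_ineq4[of "f a" "g a"] by (simp add: distrib_right)
qed (use assms in \<open>auto simp: bounded_functional_on_def algebra_simps\<close>)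

text \<open>
  A Frank-Wolfe argument: while the residual \<open>r\<^sub>i = f e\<^sub>i - h e\<^sub>i\<close> is not small, \<open>\<K>\<close> being norming
  for \<open>\<Sum>i. cnj r\<^sub>i e\<^sub>i\<close> provides a direction \<open>k - h\<close> in which the residual decreases.
\<close>

lemma norming_convex_set_approximates:
  assumes A: "op_subspace A" "closed A"
    and e: "sq_bounded_family I e C" "\<And>i. i \<in> I \<Longrightarrow> e i \<in> A"
    and f: "bounded_functional_on A f M"
    and K: "K \<noteq> {}" "\<And>k. k \<in> K \<Longrightarrow> bounded_functional_on A k M"
    and convex: "\<And>h k t. h \<in> K \<Longrightarrow> k \<in> K \<Longrightarrow> 0 \<le> t \<Longrightarrow> t \<le> 1 \<Longrightarrow>
      (\<lambda>a. complex_of_real (1 - t) * h a + complex_of_real t * k a) \<in> K"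
    and norming: "\<And>z \<epsilon>. z \<in> A \<Longrightarrow> 0 < \<epsilon> \<Longrightarrow> \<exists>k\<in>K. M * norm z - \<epsilon> \<le> Re (k z)"
    and \<delta>: "0 < \<delta>"
  shows "\<exists>h\<in>K. sq_bounded I (\<lambda>i. f (e i) - h (e i)) \<delta>"
proof -
  define Q where "Q h = (\<Sum>\<^sub>\<infinity>i\<in>I. (cmod (f (e i) - h (e i)))\<^sup>2)" for h
  define D where "D = (M + M)\<^sup>2 * C"
  have res: "bounded_functional_on A (\<lambda>a. f a - h a) (M + M)" "sq_bounded I (\<lambda>i. f (e i) - h (e i)) D"
    if "h \<in> K" for h
    unfolding D_def
    by (rule bounded_functional_on_diff_functional[OF f K(2)[OF that]])
      (rule functional_family_sq_bounded[OF bounded_functional_on_diff_functional[OF f K(2)[OF that]] A(1) e])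
  define m where "m = (INF h\<in>K. Q h)"
  have bdd: "bdd_below (Q ` K)"
    by (intro bdd_belowI2[where m = 0]) (simp add: Q_def infsum_nonneg)
  have m_le: "m \<le> Q h" if "h \<in> K" for h
    unfolding m_def using bdd that by (rule cINF_lower)
  \<comment> \<open>One descent step from \<open>h\<close> toward a \<open>k\<close> nearly
    attaining \<open>M * norm z\<close>, where \<open>z\<close> is the sum of the \<open>e i\<close>
    with coefficients \<open>cnj (r i)\<close>. The residual energy \<open>Q h\<close> equals
    \<open>Re (f z - h z)\<close>, so to first order it drops by at least
    \<open>2 * t * (Q h - \<epsilon>)\<close>; \<open>D\<close> controls the quadratic term.\<close>
  have step: "m \<le> Q h - 2 * t * (Q h - \<epsilon>) + t\<^sup>2 * D"
    if h: "h \<in> K" and t: "0 \<le> t" "t \<le> 1" and \<epsilon>: "0 < \<epsilon>" for h t \<epsilon>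
  proof -
    define r where "r i = f (e i) - h (e i)" for i
    have r: "sq_bounded I r D"
      unfolding r_def[abs_def] by (rule res(2)[OF h])
    have cr: "sq_bounded I (\<lambda>i. cnj (r i)) D"
      using r by (simp add: sq_bounded_def)
    obtain z where z: "z \<in> A"
      "\<forall>g N. bounded_functional_on A g N \<longrightarrow> ((\<lambda>i. cnj (r i) * g (e i)) has_sum g z) I"
      using scaled_family_converges[OF A e cr] by blast
    have Qsum: "((\<lambda>i. (cmod (r i))\<^sup>2) has_sum Q h) I"
      unfolding Q_def r_def[symmetric] by (rule has_sum_infsum[OF sq_bounded_summable[OF r]])
    have "((\<lambda>i. cnj (r i) * r i) has_sum f z - h z) I"
      using z(2)[rule_format, OF res(1)[OF h]] by (simp add: r_def)
    then have "((\<lambda>i. Re (cnj (r i) * r i)) has_sum Re (f z - h z)) I"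
      by (rule has_sum_Re)
    also have "(\<lambda>i. Re (cnj (r i) * r i)) = (\<lambda>i. (cmod (r i))\<^sup>2)"
      by (rule ext) (simp add: cmod_power2, simp add: power2_eq_square)
    finally have Qz: "Q h = Re (f z) - Re (h z)"
      using Qsum has_sum_unique by fastforce
    obtain k where k: "k \<in> K" "M * norm z - \<epsilon> \<le> Re (k z)"
      using norming[OF z(1) \<epsilon>] by blast
    have "Re (f z) \<le> M * norm z"
      using f z(1) complex_Re_le_cmod[of "f z"] by (force simp: bounded_functional_on_def)
    with k Qz have kz: "Q h - \<epsilon> \<le> Re (k z - h z)" by simp
    define d where "d i = k (e i) - h (e i)" for i
    have kh: "bounded_functional_on A (\<lambda>a. k a - h a) (M + M)"
      by (rule bounded_functional_on_diff_functional[OF K(2)[OF k(1)] K(2)[OF h]])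
    have d: "sq_bounded I d D"
      unfolding D_def d_def[abs_def] by (rule functional_family_sq_bounded[OF kh A(1) e])
    have dsum: "((\<lambda>i. (cmod (d i))\<^sup>2) has_sum (\<Sum>\<^sub>\<infinity>i\<in>I. (cmod (d i))\<^sup>2)) I"
      by (rule has_sum_infsum[OF sq_bounded_summable[OF d]])
    have "((\<lambda>i. cnj (r i) * d i) has_sum k z - h z) I"
      using z(2)[rule_format, OF kh] by (simp add: d_def)
    then have crsum: "((\<lambda>i. Re (cnj (r i) * d i)) has_sum Re (k z - h z)) I"
      by (rule has_sum_Re)
    define h' where "h' = (\<lambda>a. complex_of_real (1 - t) * h a + complex_of_real t * k a)"
    have h'K: "h' \<in> K" unfolding h'_def by (rule convex[OF h k(1) t])
    have expand: "(cmod (f (e i) - h' (e i)))\<^sup>2 =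
        (cmod (r i))\<^sup>2 + (- (2 * t)) * Re (cnj (r i) * d i) + t\<^sup>2 * (cmod (d i))\<^sup>2" for i
    proof -
      have "f (e i) - h' (e i) = r i - complex_of_real t * d i"
        by (simp add: h'_def r_def d_def algebra_simps)
      then show ?thesis
        by (simp add: cmod_power2) (simp add: power2_eq_square algebra_simps)
    qed
    have "((\<lambda>i. (cmod (f (e i) - h' (e i)))\<^sup>2) has_sum
        (Q h + (- (2 * t)) * Re (k z - h z) + t\<^sup>2 * (\<Sum>\<^sub>\<infinity>i\<in>I. (cmod (d i))\<^sup>2))) I"
      unfolding expand by (intro has_sum_add has_sum_cmult_right Qsum crsum dsum)
    then have "Q h' = Q h + (- (2 * t)) * Re (k z - h z) + t\<^sup>2 * (\<Sum>\<^sub>\<infinity>i\<in>I. (cmod (d i))\<^sup>2)"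
      unfolding Q_def by (rule infsumI)
    moreover have "(2 * t) * (Q h - \<epsilon>) \<le> (2 * t) * Re (k z - h z)"
      using t kz by (intro mult_left_mono) auto
    moreover have "t\<^sup>2 * (\<Sum>\<^sub>\<infinity>i\<in>I. (cmod (d i))\<^sup>2) \<le> t\<^sup>2 * D"
      by (intro mult_left_mono sq_bounded_infsum_le[OF d]) simp
    ultimately show ?thesis
      using m_le[OF h'K] by linarith
  qed
  \<comment> \<open>For t \<le> 1/2 the coefficient \<open>1 - 2 * t\<close> of \<open>Q h\<close>
    is nonnegative, so the upper bound \<open>m + \<eta>\<close> for a nearly optimal
    \<open>h\<close> may be inserted.\<close>
  have "2 * t * m \<le> t\<^sup>2 * D" if t: "0 < t" "t \<le> 1/2" for t
  proof (rule field_le_epsilon)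
    fix \<eta> :: real assume \<eta>: "0 < \<eta>"
    have "m < m + \<eta>" using \<eta> by simp
    then have "\<exists>h\<in>K. Q h < m + \<eta>"
      using cINF_less_iff[OF K(1) bdd, of "m + \<eta>"] by (simp only: m_def)
    then obtain h where h: "h \<in> K" "Q h < m + \<eta>" by blast
    have "m \<le> (1 - 2 * t) * Q h + 2 * t * \<eta> + t\<^sup>2 * D"
      using step[OF h(1) _ _ \<eta>, of t] t by (simp add: algebra_simps)
    also have "(1 - 2 * t) * Q h \<le> (1 - 2 * t) * (m + \<eta>)"
      using h t by (intro mult_left_mono) auto
    finally show "2 * t * m \<le> t\<^sup>2 * D + \<eta>"
      by (simp add: algebra_simps)
  qed
  then have tm: "2 * m \<le> t * D" if t: "0 < t" "t \<le> 1/2" for t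
    using t by (simp add: power2_eq_square mult.assoc)
  have "m \<le> 0"
  proof (rule ccontr)
    assume "\<not> m \<le> 0"
    have "0 \<le> D" using e(1) by (simp add: D_def sq_bounded_family_def)
    \<comment> \<open>With t at most m / (D + 1), the inequality 2 m \<le> t D becomes 2 m \<le>
      m.\<close>
    define t where "t = min (1/2) (m / (D + 1))"
    have t: "0 < t" "t \<le> 1/2" "t \<le> m / (D + 1)"
      using \<open>\<not> m \<le> 0\<close> \<open>0 \<le> D\<close> by (simp_all add: t_def min_def)
    have "2 * m \<le> t * D" by (rule tm[OF t(1,2)])
    also have "\<dots> \<le> t * (D + 1)" using t by simp
    also have "\<dots> \<le> m" using t(3) \<open>0 \<le> D\<close> by (simp add: pos_le_divide_eq)
    finally show False using \<open>\<not> m \<le> 0\<close> by simp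
  qed
  then have "m < \<delta>" using \<delta> by simp
  then have "\<exists>h\<in>K. Q h < \<delta>"
    using cINF_less_iff[OF K(1) bdd, of \<delta>] by (simp only: m_def)
  then obtain h where h: "h \<in> K" "Q h < \<delta>" by blast
  have "sq_bounded I (\<lambda>i. f (e i) - h (e i)) (Q h)"
    unfolding Q_def by (rule summable_sq_bounded[OF sq_bounded_summable[OF res(2)[OF h(1)]]])
  with h show ?thesis
    by (intro bexI[of _ h]) (auto elim: sq_bounded_mono)
qed

section \<open>Transfer of nonnegativity from a norming family to all bounded functionals\<close>

lemma sq_bounded_Plus:
  assumes "sq_bounded I x B" "sq_bounded I' y D"
  shows "sq_bounded (I <+> I') (case_sum x y) (B + D)"
  unfolding sq_bounded_def
proof (intro allI impI)
  fix J assume J: "finite J" "J \<subseteq> I <+> I'"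
  have J': "J = (Inl -` J) <+> (Inr -` J)"
  proof
    show "J \<subseteq> (Inl -` J) <+> (Inr -` J)"
    proof
      fix j assume "j \<in> J" then show "j \<in> (Inl -` J) <+> (Inr -` J)" by (cases j) auto
    qed
  qed auto
  have fin: "finite (Inl -` J)" "finite (Inr -` J)"
    using J(1) by (auto intro: finite_vimageI)
  have "(\<Sum>j\<in>J. (norm (case_sum x y j))\<^sup>2) = (\<Sum>i\<in>Inl -` J. (norm (x i))\<^sup>2) + (\<Sum>i\<in>Inr -` J. (norm (y i))\<^sup>2)"
    by (subst J') (simp add: sum.Plus[OF fin])
  also have "\<dots> \<le> B + D"
    using J fin by (intro add_mono sq_boundedD[OF assms(1)] sq_boundedD[OF assms(2)]) auto
  finally show "(\<Sum>j\<in>J. (norm (case_sum x y j))\<^sup>2) \<le> B + D" .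
qed

lemma sq_bounded_reindex:
  assumes "sq_bounded I' x B" "inj_on g I" "g ` I \<subseteq> I'"
  shows "sq_bounded I (\<lambda>i. x (g i)) B"
  unfolding sq_bounded_def
proof (intro allI impI)
  fix J assume J: "finite J" "J \<subseteq> I"
  then have "(\<Sum>i\<in>J. (norm (x (g i)))\<^sup>2) = (\<Sum>j\<in>g ` J. (norm (x j))\<^sup>2)"
    using assms(2) by (subst sum.reindex) (auto intro: inj_on_subset)
  also have "\<dots> \<le> B"
    using J assms(3) by (intro sq_boundedD[OF assms(1)]) auto
  finally show "(\<Sum>i\<in>J. (norm (x (g i)))\<^sup>2) \<le> B" .
qed

text \<open>The tensor evaluated at the conjugate of h times h, where the conjugate functional sends
  a to \<open>cnj (h (adj a))\<close>. For a character it is the character itself; for a vector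
  functional it exchanges the two vectors.\<close>

definition eh_form ::
  "'i set \<Rightarrow> ('i \<Rightarrow> ('h::complex_hilbert \<Rightarrow>\<^sub>L 'h)) \<Rightarrow> ('i \<Rightarrow> ('h \<Rightarrow>\<^sub>L 'h)) \<Rightarrow> (('h \<Rightarrow>\<^sub>L 'h) \<Rightarrow> complex) \<Rightarrow> complex" where
  "eh_form I a b h = (\<Sum>\<^sub>\<infinity>i\<in>I. cnj (h (adj (a i))) * h (b i))"

lemma nonneg_Reals_approximated:
  assumes "\<And>\<epsilon>. 0 < \<epsilon> \<Longrightarrow> \<exists>v. v \<in> \<real>\<^sub>\<ge>\<^sub>0 \<and> cmod (w - v) \<le> \<epsilon>"
  shows "w \<in> \<real>\<^sub>\<ge>\<^sub>0"
proof -
  have "\<exists>v\<in>\<real>\<^sub>\<ge>\<^sub>0. dist v w < \<epsilon>" if "0 < \<epsilon>" for \<epsilon>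
    using assms[of "\<epsilon> / 2"] that by (force simp: dist_norm norm_minus_commute)
  then show ?thesis
    using closed_approachable[OF closed_nonneg_Reals_complex] by blast
qed

text \<open>The form depends on \<open>h\<close> only through the sequences \<open>h (b i)\<close>
  and \<open>h (adj (a i))\<close>, and continuously so in the l2 distance; the nonnegative reals
  are closed.\<close>

lemma eh_form_nonneg_limit:
  assumes A: "abelian_cstar_subalgebra A" and eh: "eh_series A A I a b"
    and f: "bounded_functional_on A f M"
    and approx: "\<And>\<delta>. 0 < \<delta> \<Longrightarrow> \<exists>h. sq_bounded I (\<lambda>i. f (b i) - h (b i)) \<delta> \<and>
      sq_bounded I (\<lambda>i. f (adj (a i)) - h (adj (a i))) \<delta> \<and> eh_form I a b h \<in> \<real>\<^sub>\<ge>\<^sub>0"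
  shows "eh_form I a b f \<in> \<real>\<^sub>\<ge>\<^sub>0"
proof (rule nonneg_Reals_approximated)
  note AD = abelian_cstarD[OF A]
  obtain C where C: "sq_bounded_family I b C" "sq_bounded_family I (\<lambda>i. adj (a i)) C"
    using abelian_eh_series[OF A eh] by metis
  have mem: "adj (a i) \<in> A" "b i \<in> A" if "i \<in> I" for i
    using that eh AD(5) by (auto simp: eh_series_def)
  define B where "B = M\<^sup>2 * C"
  have fb: "sq_bounded I (\<lambda>i. f (b i)) B" and fa: "sq_bounded I (\<lambda>i. f (adj (a i))) B"
    unfolding B_def using functional_family_sq_bounded[OF f AD(2)] C mem by blast+
  fix \<epsilon> :: real assume \<epsilon>: "0 < \<epsilon>"
  have B: "0 \<le> B" using fb by (rule sq_bounded_nonneg)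
  \<comment> \<open>Makes the error \<open>2 * s * sqrt B + s * s\<close> at most
    \<open>\<epsilon>\<close>; the cap 1 is there for \<open>s * s \<le> s\<close>.\<close>
  define s where "s = min 1 (\<epsilon> / (2 * sqrt B + 1))"
  have B1: "0 < 2 * sqrt B + 1" using B by (simp add: add_nonneg_pos)
  have s: "0 < s" "s \<le> 1" "s * (2 * sqrt B + 1) \<le> \<epsilon>"
    using \<epsilon> B1 by (auto simp: s_def pos_le_divide_eq[symmetric])
  obtain h where h: "sq_bounded I (\<lambda>i. f (b i) - h (b i)) (s\<^sup>2)"
    "sq_bounded I (\<lambda>i. f (adj (a i)) - h (adj (a i))) (s\<^sup>2)" "eh_form I a b h \<in> \<real>\<^sub>\<ge>\<^sub>0"
    using approx[of "s\<^sup>2"] s by auto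
  define \<alpha> \<alpha>' \<beta> \<beta>' where "\<alpha> i = cnj (f (adj (a i)))" and "\<alpha>' i = cnj (h (adj (a i)))"
    and "\<beta> i = f (b i)" and "\<beta>' i = h (b i)" for i
  have \<alpha>: "sq_bounded I \<alpha> B" and \<beta>: "sq_bounded I \<beta> B"
    using fa fb by (simp_all add: \<alpha>_def[abs_def] \<beta>_def[abs_def] sq_bounded_def)
  have d\<alpha>: "sq_bounded I (\<lambda>i. \<alpha> i - \<alpha>' i) (s\<^sup>2)" and d\<beta>: "sq_bounded I (\<lambda>i. \<beta> i - \<beta>' i) (s\<^sup>2)"
    using h by (simp_all add: \<alpha>_def \<alpha>'_def \<beta>_def \<beta>'_def sq_bounded_def flip: complex_cnj_diff)
  define S1 S2 S3 where "S1 = (\<Sum>\<^sub>\<infinity>i\<in>I. (\<alpha> i - \<alpha>' i) * \<beta> i)" and "S2 = (\<Sum>\<^sub>\<infinity>i\<in>I. \<alpha> i * (\<beta> i - \<beta>' i))"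
    and "S3 = (\<Sum>\<^sub>\<infinity>i\<in>I. (\<alpha> i - \<alpha>' i) * (\<beta> i - \<beta>' i))"
  have sums: "((\<lambda>i. (\<alpha> i - \<alpha>' i) * \<beta> i) has_sum S1) I" "((\<lambda>i. \<alpha> i * (\<beta> i - \<beta>' i)) has_sum S2) I"
    "((\<lambda>i. (\<alpha> i - \<alpha>' i) * (\<beta> i - \<beta>' i)) has_sum S3) I"
    unfolding S1_def S2_def S3_def
    by (rule has_sum_infsum, rule sq_bounded_product[OF d\<alpha> \<beta>] sq_bounded_product[OF \<alpha> d\<beta>]
        sq_bounded_product[OF d\<alpha> d\<beta>])+
  have main: "((\<lambda>i. \<alpha> i * \<beta> i) has_sum eh_form I a b f) I"
    unfolding eh_form_def \<alpha>_def[symmetric] \<beta>_def[symmetric]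
    by (rule has_sum_infsum, rule sq_bounded_product[OF \<alpha> \<beta>])
  \<comment> \<open>Expresses the product of the approximants through the exact sequences and the
    differences, so that no separate bound for the approximants has to be carried along.\<close>
  have "((\<lambda>i. (\<alpha> i * \<beta> i + (- 1) * ((\<alpha> i - \<alpha>' i) * \<beta> i + \<alpha> i * (\<beta> i - \<beta>' i))) + (\<alpha> i - \<alpha>' i) * (\<beta> i - \<beta>' i))
      has_sum (eh_form I a b f + (- 1) * (S1 + S2)) + S3) I"
    by (intro has_sum_add has_sum_cmult_right main sums)
  then have "((\<lambda>i. \<alpha>' i * \<beta>' i) has_sum (eh_form I a b f - (S1 + S2)) + S3) I"
    by (simp add: algebra_simps)
  then have "eh_form I a b h = (eh_form I a b f - (S1 + S2)) + S3"
    unfolding eh_form_def \<alpha>'_def \<beta>'_def by (rule infsumI)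
  then have "eh_form I a b f - eh_form I a b h = S1 + S2 - S3"
    by simp
  then have "cmod (eh_form I a b f - eh_form I a b h) = cmod (S1 + S2 - S3)"
    by simp
  also have "\<dots> \<le> cmod S1 + cmod S2 + cmod S3"
    by (meson add_mono norm_triangle_ineq norm_triangle_ineq4 order_refl order_trans)
  also have "\<dots> \<le> s * sqrt B + sqrt B * s + s * s"
    using sq_bounded_product(2)[OF d\<alpha> \<beta>] sq_bounded_product(2)[OF \<alpha> d\<beta>]
      sq_bounded_product(2)[OF d\<alpha> d\<beta>] s
    by (intro add_mono) (simp_all add: S1_def S2_def S3_def)
  also have "\<dots> \<le> s * (2 * sqrt B + 1)"
    using mult_left_mono[OF s(2), of s] s(1) by (simp add: algebra_simps)
  also have "\<dots> \<le> \<epsilon>" by (rule s(3))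
  finally show "\<exists>v. v \<in> \<real>\<^sub>\<ge>\<^sub>0 \<and> cmod (eh_form I a b f - v) \<le> \<epsilon>"
    using h(3) by blast
qed

lemma eh_form_nonneg_transfer:
  assumes A: "abelian_cstar_subalgebra A" and eh: "eh_series A A I a b"
    and f: "bounded_functional_on A f M"
    and K: "K \<noteq> {}" "\<And>k. k \<in> K \<Longrightarrow> bounded_functional_on A k M"
    and convex: "\<And>h k t. h \<in> K \<Longrightarrow> k \<in> K \<Longrightarrow> 0 \<le> t \<Longrightarrow> t \<le> 1 \<Longrightarrow>
      (\<lambda>a. complex_of_real (1 - t) * h a + complex_of_real t * k a) \<in> K"
    and norming: "\<And>z \<epsilon>. z \<in> A \<Longrightarrow> 0 < \<epsilon> \<Longrightarrow> \<exists>k\<in>K. M * norm z - \<epsilon> \<le> Re (k z)"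
    and pos: "\<And>k. k \<in> K \<Longrightarrow> eh_form I a b k \<in> \<real>\<^sub>\<ge>\<^sub>0"
  shows "eh_form I a b f \<in> \<real>\<^sub>\<ge>\<^sub>0"
proof (rule eh_form_nonneg_limit[OF A eh f])
  note AD = abelian_cstarD[OF A]
  obtain C where C: "sq_bounded_family I b C" "sq_bounded_family I (\<lambda>i. adj (a i)) C"
    using abelian_eh_series[OF A eh] by metis
  have mem: "adj (a i) \<in> A" "b i \<in> A" if "i \<in> I" for i
    using that eh AD(5) by (auto simp: eh_series_def)
  \<comment> \<open>One \<open>h\<close> has to approximate \<open>f\<close> along both families at
    once, so they are joined over the disjoint sum of the index sets.\<close>
  define e where "e = case_sum b (\<lambda>i. adj (a i))"
  have e: "sq_bounded_family (I <+> I) e (C + C)"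
    unfolding sq_bounded_family_def
  proof (intro conjI allI)
    fix \<xi>
    have "(\<lambda>j. e j \<xi>) = case_sum (\<lambda>i. b i \<xi>) (\<lambda>i. adj (a i) \<xi>)"
      by (auto simp: e_def fun_eq_iff split: sum.split)
    then show "sq_bounded (I <+> I) (\<lambda>j. e j \<xi>) ((C + C) * (norm \<xi>)\<^sup>2)"
      using sq_bounded_Plus[OF sq_bounded_familyD[OF C(1)] sq_bounded_familyD[OF C(2)], of \<xi> \<xi>]
      by (simp add: mult.assoc)
  qed (use C in \<open>simp add: sq_bounded_family_def\<close>)
  have eA: "e j \<in> A" if "j \<in> I <+> I" for j
    using that mem by (auto simp: e_def)
  fix \<delta> :: real assume "0 < \<delta>"
  then obtain h where h: "h \<in> K" "sq_bounded (I <+> I) (\<lambda>j. f (e j) - h (e j)) \<delta>"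
    using norming_convex_set_approximates[OF AD(2,3) e eA f K convex norming] by blast
  have "sq_bounded I (\<lambda>i. f (e (Inl i)) - h (e (Inl i))) \<delta>" "sq_bounded I (\<lambda>i. f (e (Inr i)) - h (e (Inr i))) \<delta>"
    by (rule sq_bounded_reindex[OF h(2)]; auto simp: inj_on_def)+
  then show "\<exists>h. sq_bounded I (\<lambda>i. f (b i) - h (b i)) \<delta> \<and>
      sq_bounded I (\<lambda>i. f (adj (a i)) - h (adj (a i))) \<delta> \<and> eh_form I a b h \<in> \<real>\<^sub>\<ge>\<^sub>0"
    using pos[OF h(1)] by (auto simp: e_def)
qed

text \<open>With lists, convex combinations are concatenations of rescaled lists. The index type
  stays arbitrary: points of the space in one application, pairs of vectors in the other.\<close>

definition functional_comb :: "('x \<Rightarrow> 'v \<Rightarrow> complex) \<Rightarrow> (complex \<times> 'x) list \<Rightarrow> 'v \<Rightarrow> complex" where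
  "functional_comb g xs a = (\<Sum>(c, x)\<leftarrow>xs. c * g x a)"

lemma functional_comb_Nil [simp]: "functional_comb g [] a = 0"
  by (simp add: functional_comb_def)

lemma functional_comb_Cons [simp]: "functional_comb g ((c, x) # xs) a = c * g x a + functional_comb g xs a"
  by (simp add: functional_comb_def)

lemma functional_comb_append [simp]: "functional_comb g (xs @ ys) a = functional_comb g xs a + functional_comb g ys a"
  by (simp add: functional_comb_def)

lemma functional_comb_scale [simp]:
  "functional_comb g (map (\<lambda>(c, x). (d * c, x)) xs) a = d * functional_comb g xs a"
  by (induction xs) (auto simp: distrib_left mult.assoc)

lemma functional_comb_sum:
  "functional_comb g xs a = (\<Sum>k<length xs. fst (xs ! k) * g (snd (xs ! k)) a)"
  unfolding functional_comb_def sum_list_sum_nth by (simp add: atLeast0LessThan case_prod_unfold)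

lemma functional_comb_bounded:
  assumes g: "\<And>x. x \<in> X \<Longrightarrow> bounded_functional_on A (g x) 1" and xs: "snd ` set xs \<subseteq> X"
  shows "bounded_functional_on A (functional_comb g xs) (\<Sum>(c, x)\<leftarrow>xs. cmod c)"
  using xs
proof (induction xs)
  case Nil
  then show ?case by (simp add: bounded_functional_on_def)
next
  case (Cons y xs)
  obtain c x where y: "y = (c, x)" by (cases y)
  have x: "bounded_functional_on A (g x) 1" using Cons y g by auto
  have IH: "bounded_functional_on A (functional_comb g xs) (\<Sum>(c, x)\<leftarrow>xs. cmod c)"
    using Cons by auto
  show ?case
    unfolding bounded_functional_on_def
  proof (intro conjI ballI allI)
    fix a assume a: "a \<in> A"
    have "cmod (c * g x a) \<le> cmod c * (1 * norm a)"
      unfolding norm_mult using x a by (intro mult_left_mono) (auto simp: bounded_functional_on_def)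
    moreover have "cmod (functional_comb g xs a) \<le> (\<Sum>(c, x)\<leftarrow>xs. cmod c) * norm a"
      using IH a by (simp add: bounded_functional_on_def)
    ultimately show "cmod (functional_comb g (y # xs) a) \<le> (\<Sum>(c, x)\<leftarrow>y # xs. cmod c) * norm a"
      using norm_triangle_ineq[of "c * g x a" "functional_comb g xs a"] by (simp add: y distrib_right)
  qed (use x IH in \<open>auto simp: bounded_functional_on_def y algebra_simps\<close>)
qed

lemma bounded_functional_on_mono:
  "bounded_functional_on A f M \<Longrightarrow> M \<le> N \<Longrightarrow> bounded_functional_on A f N"
  unfolding bounded_functional_on_def by (meson mult_right_mono norm_ge_zero order_trans)

lemma eh_form_nonneg_generated:
  fixes g :: "'x \<Rightarrow> ('h::complex_hilbert \<Rightarrow>\<^sub>L 'h) \<Rightarrow> complex"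
  assumes A: "abelian_cstar_subalgebra A" and eh: "eh_series A A I a b"
    and f: "bounded_functional_on A f M"
    and g: "\<And>x. x \<in> X \<Longrightarrow> bounded_functional_on A (g x) 1"
    and norming: "\<And>z s. z \<in> A \<Longrightarrow> (\<And>x. x \<in> X \<Longrightarrow> cmod (g x z) \<le> s) \<Longrightarrow> norm z \<le> s"
    and pos: "\<And>xs. snd ` set xs \<subseteq> X \<Longrightarrow> eh_form I a b (functional_comb g xs) \<in> \<real>\<^sub>\<ge>\<^sub>0"
  shows "eh_form I a b f \<in> \<real>\<^sub>\<ge>\<^sub>0"
proof -
  \<comment> \<open>The absolutely convex hull of the \<open>g x\<close>, scaled by
    \<open>M\<close>: the bound on the coefficients keeps every member within the norm bound of
    \<open>f\<close>.\<close>
  define K where "K = {functional_comb g xs | xs. snd ` set xs \<subseteq> X \<and> (\<Sum>(c, x)\<leftarrow>xs. cmod c) \<le> M}"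
  have M: "0 \<le> M" using f by (simp add: bounded_functional_on_def)
  have KI: "functional_comb g xs \<in> K" if "snd ` set xs \<subseteq> X" "(\<Sum>(c, x)\<leftarrow>xs. cmod c) \<le> M" for xs
    using that by (auto simp: K_def)
  have nil: "functional_comb g [] \<in> K" using M by (intro KI) auto
  show ?thesis
  proof (rule eh_form_nonneg_transfer[OF A eh f, of K])
    show "K \<noteq> {}" using nil by blast
    show "bounded_functional_on A k M" if "k \<in> K" for k
    proof -
      obtain xs where xs: "k = functional_comb g xs" "snd ` set xs \<subseteq> X" "(\<Sum>(c, x)\<leftarrow>xs. cmod c) \<le> M"
        using \<open>k \<in> K\<close> by (auto simp: K_def)
      show ?thesis
        unfolding xs(1) by (rule bounded_functional_on_mono[OF functional_comb_bounded[OF g xs(2)] xs(3)])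
    qed
    show "eh_form I a b k \<in> \<real>\<^sub>\<ge>\<^sub>0" if "k \<in> K" for k
      using that pos by (auto simp: K_def)
  next
    fix h k and t :: real
    assume "h \<in> K" "k \<in> K" and t: "0 \<le> t" "t \<le> 1"
    then obtain xs ys where xs: "h = functional_comb g xs" "snd ` set xs \<subseteq> X" "(\<Sum>(c, x)\<leftarrow>xs. cmod c) \<le> M"
      and ys: "k = functional_comb g ys" "snd ` set ys \<subseteq> X" "(\<Sum>(c, x)\<leftarrow>ys. cmod c) \<le> M"
      unfolding K_def by blast
    define S where "S d xs = map (\<lambda>(c, x). (d * c, x)) xs" for d :: complex and xs :: "(complex \<times> 'x) list"
    have S_norm: "(\<Sum>(c, x)\<leftarrow>S d xs. cmod c) = cmod d * (\<Sum>(c, x)\<leftarrow>xs. cmod c)" for d xs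
      by (induction xs) (auto simp: S_def norm_mult distrib_left)
    have S_snd: "snd ` set (S d xs) = snd ` set xs" for d xs
      by (force simp: S_def)
    define zs where "zs = S (complex_of_real (1 - t)) xs @ S (complex_of_real t) ys"
    have "(\<Sum>(c, x)\<leftarrow>zs. cmod c) = (1 - t) * (\<Sum>(c, x)\<leftarrow>xs. cmod c) + t * (\<Sum>(c, x)\<leftarrow>ys. cmod c)"
      using t by (simp add: zs_def S_norm del: of_real_diff)
    also have "\<dots> \<le> (1 - t) * M + t * M"
      using t xs ys by (intro add_mono mult_left_mono) auto
    finally have "functional_comb g zs \<in> K"
      using xs(2) ys(2) by (intro KI) (auto simp: zs_def S_snd image_Un algebra_simps)
    also have "functional_comb g zs = (\<lambda>a. complex_of_real (1 - t) * h a + complex_of_real t * k a)"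
      by (rule ext) (simp add: zs_def S_def xs(1) ys(1) del: of_real_diff)
    finally show "(\<lambda>a. complex_of_real (1 - t) * h a + complex_of_real t * k a) \<in> K" .
  next
    fix z and \<epsilon> :: real assume z: "z \<in> A" and \<epsilon>: "0 < \<epsilon>"
    show "\<exists>k\<in>K. M * norm z - \<epsilon> \<le> Re (k z)"
    proof (cases "M = 0")
      case True
      then show ?thesis using \<epsilon> by (intro bexI[OF _ nil]) simp
    next
      case False
      then have M: "0 < M" using M by simp
      then have "\<not> norm z \<le> norm z - \<epsilon> / M" using \<epsilon> by (simp add: not_le)
      then obtain x where x: "x \<in> X" "norm z - \<epsilon> / M < cmod (g x z)"
        using norming[OF z, of "norm z - \<epsilon> / M"] by (meson not_less)
      \<comment> \<open>The phase turns \<open>g x z\<close> into its modulus, so a single generator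
        already nearly attains \<open>M * norm z\<close>.\<close>
      define c where "c = complex_of_real M * cnj (sgn (g x z))"
      have "cmod c \<le> M" using M by (simp add: c_def norm_mult norm_sgn)
      then have "functional_comb g [(c, x)] \<in> K" using x by (intro KI) auto
      moreover have "c * g x z = complex_of_real (M * cmod (g x z))"
        by (simp add: c_def sgn_eq complex_norm_square[symmetric] power2_eq_square field_simps)
      then have "M * (norm z - \<epsilon> / M) \<le> Re (functional_comb g [(c, x)] z)"
        using x M by simp
      then have "M * norm z - \<epsilon> \<le> Re (functional_comb g [(c, x)] z)"
        using M by (simp add: right_diff_distrib)
      ultimately show ?thesis by blast
    qed
  qed
qed

section \<open>Positive definiteness\<close>

lemma has_sum_sum:
  fixes f :: "'j \<Rightarrow> 'i \<Rightarrow> 'b::topological_comm_monoid_add"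
  assumes "\<And>j. j \<in> J \<Longrightarrow> (f j has_sum s j) I"
  shows "((\<lambda>i. \<Sum>j\<in>J. f j i) has_sum (\<Sum>j\<in>J. s j)) I"
  using assms by (induction J rule: infinite_finite_induct) (auto intro: has_sum_add)

text \<open>Since \<open>F\<close> respects adjoints,
  \<open>cnj (F (adj (a i)) x) = F (a i) x\<close>; with the coefficients conjugated, the quadratic
  form of the kernel \<open>u\<close> appears.\<close>

lemma eh_form_characters:
  assumes A: "abelian_cstar_subalgebra A" and F: "star_hom_on A F" and eh: "eh_series A A I a b"
  defines "u \<equiv> fun_tensor I (\<lambda>i. apply_bcontfun (F (a i))) (\<lambda>i. apply_bcontfun (F (b i)))"
  shows "eh_form I a b (\<lambda>z. \<Sum>k<n. c k * F z (x k)) = (\<Sum>k<n. \<Sum>l<n. cnj (c k) * u (x k, x l) * c l)"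
proof -
  note AD = abelian_cstarD[OF A]
  obtain C where C: "sq_bounded_family I b C" "sq_bounded_family I a C"
    using abelian_eh_series[OF A eh] by metis
  have mem: "a i \<in> A" "b i \<in> A" if "i \<in> I" for i
    using that eh by (auto simp: eh_series_def)
  have sq: "sq_bounded I (\<lambda>i. F (e i) x) (1\<^sup>2 * C)"
    if "sq_bounded_family I e C" "\<And>i. i \<in> I \<Longrightarrow> e i \<in> A" for e x
    by (rule functional_family_sq_bounded[OF character_bounded_functional[OF A F] AD(2) that])
  have "((\<lambda>i. F (a i) x * F (b i) y) has_sum u (x, y)) I" for x y
    unfolding u_def fun_tensor_def using sq_bounded_product(1)[OF sq[OF C(2) mem(1)] sq[OF C(1) mem(2)]]
    by simp
  then have "((\<lambda>i. \<Sum>k<n. \<Sum>l<n. cnj (c k) * (F (a i) (x k) * F (b i) (x l)) * c l) has_sum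
      (\<Sum>k<n. \<Sum>l<n. cnj (c k) * u (x k, x l) * c l)) I"
    by (intro has_sum_sum has_sum_cmult_left has_sum_cmult_right) auto
  also have "?this \<longleftrightarrow> ((\<lambda>i. cnj (\<Sum>k<n. c k * F (adj (a i)) (x k)) * (\<Sum>l<n. c l * F (b i) (x l)))
      has_sum (\<Sum>k<n. \<Sum>l<n. cnj (c k) * u (x k, x l) * c l)) I"
  proof (rule has_sum_cong)
    fix i assume i: "i \<in> I"
    have "F (adj (a i)) y = cnj (F (a i) y)" for y
      using F mem[OF i] by (simp add: star_hom_on_def)
    then show "(\<Sum>k<n. \<Sum>l<n. cnj (c k) * (F (a i) (x k) * F (b i) (x l)) * c l) =
        cnj (\<Sum>k<n. c k * F (adj (a i)) (x k)) * (\<Sum>l<n. c l * F (b i) (x l))"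
      unfolding cnj_sum sum_product by (intro sum.cong refl) (simp add: mult_ac)
  qed
  finally show ?thesis
    unfolding eh_form_def by (rule infsumI)
qed

text \<open>From left to right, injectivity of \<open>F\<close> supplies the isometry that makes
  point evaluations norming; from right to left, finite combinations of point evaluations are
  themselves bounded functionals.\<close>

lemma positive_definite_iff_eh_form_nonneg:
  assumes A: "abelian_cstar_subalgebra A" and F: "star_hom_on A F" and inj: "inj_on F A"
    and eh: "eh_series A A I a b"
  defines "u \<equiv> fun_tensor I (\<lambda>i. apply_bcontfun (F (a i))) (\<lambda>i. apply_bcontfun (F (b i)))"
  shows "positive_definite_fun u \<longleftrightarrow> (\<forall>f M. bounded_functional_on A f M \<longrightarrow> eh_form I a b f \<in> \<real>\<^sub>\<ge>\<^sub>0)"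
proof
  assume pd: "positive_definite_fun u"
  have comb: "eh_form I a b (functional_comb (\<lambda>x z. F z x) xs) \<in> \<real>\<^sub>\<ge>\<^sub>0" for xs
  proof -
    have "functional_comb (\<lambda>x z. F z x) xs = (\<lambda>z. \<Sum>k<length xs. fst (xs ! k) * F z (snd (xs ! k)))"
      by (rule ext) (rule functional_comb_sum)
    then show ?thesis
      using pd eh_form_characters[OF A F eh, where n = "length xs" and c = "\<lambda>k. fst (xs ! k)" and x = "\<lambda>k. snd (xs ! k)"]
      by (simp add: positive_definite_fun_def psd_matrix_def u_def)
  qed
  show "\<forall>f M. bounded_functional_on A f M \<longrightarrow> eh_form I a b f \<in> \<real>\<^sub>\<ge>\<^sub>0"
  proof (intro allI impI)
    fix f M assume f: "bounded_functional_on A f M"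
    show "eh_form I a b f \<in> \<real>\<^sub>\<ge>\<^sub>0"
      by (rule eh_form_nonneg_generated[OF A eh f, of UNIV "\<lambda>x z. F z x"])
        (use character_bounded_functional[OF A F] injective_star_hom_norm_le[OF A F inj] comb in auto)
  qed
next
  assume all: "\<forall>f M. bounded_functional_on A f M \<longrightarrow> eh_form I a b f \<in> \<real>\<^sub>\<ge>\<^sub>0"
  show "positive_definite_fun u"
    unfolding positive_definite_fun_def psd_matrix_def
  proof (intro allI)
    fix n :: nat and x :: "nat \<Rightarrow> 'b" and c :: "nat \<Rightarrow> complex"
    define xs where "xs = map (\<lambda>k. (c k, x k)) [0..<n]"
    have "bounded_functional_on A (functional_comb (\<lambda>x z. F z x) xs) (\<Sum>(c, x)\<leftarrow>xs. cmod c)"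
      by (rule functional_comb_bounded[of UNIV]) (auto intro: character_bounded_functional[OF A F])
    then have "eh_form I a b (functional_comb (\<lambda>x z. F z x) xs) \<in> \<real>\<^sub>\<ge>\<^sub>0"
      using all by blast
    also have "functional_comb (\<lambda>x z. F z x) xs = (\<lambda>z. \<Sum>k<n. c k * F z (x k))"
      by (rule ext) (simp add: functional_comb_sum xs_def)
    finally show "(\<Sum>i<n. \<Sum>j<n. cnj (c i) * u (x i, x j) * c j) \<in> \<real>\<^sub>\<ge>\<^sub>0"
      by (simp add: eh_form_characters[OF A F eh] u_def)
  qed
qed

section \<open>The commutant and cyclic vectors\<close>

definition commutant :: "('h::complex_hilbert \<Rightarrow>\<^sub>L 'h) set \<Rightarrow> ('h \<Rightarrow>\<^sub>L 'h) set" where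
  "commutant A = {d \<in> bops. \<forall>a\<in>A. d o\<^sub>L a = a o\<^sub>L d}"

lemma commutant_bops: "d \<in> commutant A \<Longrightarrow> d \<in> bops"
  by (simp add: commutant_def)

lemma commutantD:
  assumes "d \<in> commutant A" "a \<in> A"
  shows "blinfun_apply d (blinfun_apply a \<xi>) = a (d \<xi>)"
proof -
  have "d o\<^sub>L a = a o\<^sub>L d"
    using assms by (simp add: commutant_def)
  then have "(d o\<^sub>L a) \<xi> = (a o\<^sub>L d) \<xi>" by simp
  then show ?thesis by simp
qed

lemma commutantI:
  assumes "d \<in> bops" "\<And>a \<xi>. a \<in> A \<Longrightarrow> blinfun_apply d (blinfun_apply a \<xi>) = a (d \<xi>)"
  shows "d \<in> commutant A"
  using assms by (auto simp: commutant_def intro: blinfun_eqI)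

lemma commutant_id: "id_blinfun \<in> commutant A"
  by (rule commutantI) (auto simp: bops_id)

lemma commutant_add: "d \<in> commutant A \<Longrightarrow> d' \<in> commutant A \<Longrightarrow> d + d' \<in> commutant A"
  by (rule commutantI) (auto simp: bops_add commutant_bops commutantD blinfun.add_left blinfun.add_right)

lemma commutant_scaleR: "d \<in> commutant A \<Longrightarrow> r *\<^sub>R d \<in> commutant A"
  by (rule commutantI) (auto simp: bops_scaleR commutant_bops commutantD blinfun.scaleR_left blinfun.scaleR_right)

lemma commutant_compose: "d \<in> commutant A \<Longrightarrow> d' \<in> commutant A \<Longrightarrow> d o\<^sub>L d' \<in> commutant A"
  by (rule commutantI) (auto simp: bops_compose commutant_bops commutantD)

lemma commutant_scalar:
  assumes "A \<subseteq> bops" shows "op_scaleC c id_blinfun \<in> commutant A"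
  using assms by (intro commutantI) (auto simp: bops_scale bops_id op_scaleC_apply bops_scaleC subset_iff)

lemma commutant_adj:
  assumes A: "abelian_cstar_subalgebra A" and d: "d \<in> commutant A"
  shows "adj d \<in> commutant A"
proof (rule commutantI)
  note db = commutant_bops[OF d]
  show "adj d \<in> bops" using db by (rule bops_adj)
  fix a \<xi> assume a: "a \<in> A"
  have ab: "a \<in> bops" "adj a \<in> A" using abelian_cstarD[OF A] a by auto
  show "adj d (a \<xi>) = a (adj d \<xi>)"
  proof (rule cinner_eqI)
    fix \<eta>
    have "cinner (adj d (a \<xi>)) \<eta> = cinner (a \<xi>) (d \<eta>)"
      using db by (rule cinner_adj_left)
    also have "\<dots> = cinner \<xi> (adj a (d \<eta>))"
      using ab(1) by (rule cinner_adj_right[symmetric])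
    also have "adj a (d \<eta>) = d (adj a \<eta>)"
      using commutantD[OF d ab(2)] by simp
    also have "cinner \<xi> (d (adj a \<eta>)) = cinner (a (adj d \<xi>)) \<eta>"
      using ab(1) db by (simp add: cinner_adj_left[symmetric] cinner_adj_right)
    finally show "cinner (adj d (a \<xi>)) \<eta> = cinner (a (adj d \<xi>)) \<eta>" .
  qed
qed

lemma abelian_subset_commutant: "abelian_cstar_subalgebra A \<Longrightarrow> a \<in> A \<Longrightarrow> a \<in> commutant A"
  unfolding commutant_def by (auto intro: abelian_cstarD(6,7))

text \<open>Cyclic for the commutant rather than for \<open>A\<close>: operators of the commutant
  can be moved past elements of \<open>A\<close> and then onto the other vector of a matrix
  coefficient.\<close>

definition cyclic_subspace :: "('h::complex_hilbert \<Rightarrow>\<^sub>L 'h) set \<Rightarrow> 'h \<Rightarrow> 'h set" where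
  "cyclic_subspace A \<zeta> = closure ((\<lambda>d. blinfun_apply d \<zeta>) ` commutant A)"

lemma closed_cyclic_subspace: "closed (cyclic_subspace A \<zeta>)"
  by (simp add: cyclic_subspace_def)

lemma cyclic_subspaceI: "d \<in> commutant A \<Longrightarrow> blinfun_apply d \<zeta> \<in> cyclic_subspace A \<zeta>"
  unfolding cyclic_subspace_def by (rule closure_subset[THEN subsetD]) (rule imageI)

lemma self_in_cyclic_subspace: "\<zeta> \<in> cyclic_subspace A \<zeta>"
  using cyclic_subspaceI[OF commutant_id, of \<zeta> A] by simp

lemma subspace_closure:
  fixes S :: "'b::real_normed_vector set"
  assumes S: "subspace S"
  shows "subspace (closure S)"
  unfolding subspace_def
proof (intro conjI ballI allI)
  show "0 \<in> closure S"
    using subspace_0[OF S] by (rule closure_subset[THEN subsetD])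
next
  fix x y assume "x \<in> closure S" "y \<in> closure S"
  then obtain f g where "\<forall>n. f n \<in> S" "f \<longlonglongrightarrow> x" "\<forall>n. g n \<in> S" "g \<longlonglongrightarrow> y"
    unfolding closure_sequential by blast
  then have "\<forall>n. f n + g n \<in> S" "(\<lambda>n. f n + g n) \<longlonglongrightarrow> x + y"
    using S by (auto intro: subspace_add tendsto_add)
  then show "x + y \<in> closure S"
    unfolding closure_sequential by (intro exI conjI)
next
  fix r x assume "x \<in> closure S"
  then obtain f where "\<forall>n. f n \<in> S" "f \<longlonglongrightarrow> x"
    unfolding closure_sequential by blast
  then have "\<forall>n. r *\<^sub>R f n \<in> S" "(\<lambda>n. r *\<^sub>R f n) \<longlonglongrightarrow> r *\<^sub>R x"
    using S by (auto intro: subspace_scale tendsto_scaleR)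
  then show "r *\<^sub>R x \<in> closure S"
    unfolding closure_sequential by (intro exI conjI)
qed

lemma subspace_cyclic_subspace: "subspace (cyclic_subspace A \<zeta>)"
  unfolding cyclic_subspace_def
proof (rule subspace_closure)
  show "subspace ((\<lambda>d. blinfun_apply d \<zeta>) ` commutant A)"
    unfolding subspace_def
  proof (intro conjI ballI allI)
    show "0 \<in> (\<lambda>d. blinfun_apply d \<zeta>) ` commutant A"
      using commutant_scaleR[OF commutant_id, of 0 A] by force
  next
    fix x y assume "x \<in> (\<lambda>d. blinfun_apply d \<zeta>) ` commutant A" "y \<in> (\<lambda>d. blinfun_apply d \<zeta>) ` commutant A"
    then obtain d d' where "d \<in> commutant A" "x = d \<zeta>" "d' \<in> commutant A" "y = d' \<zeta>" by blast
    then show "x + y \<in> (\<lambda>d. blinfun_apply d \<zeta>) ` commutant A"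
      by (intro image_eqI[of _ _ "d + d'"]) (auto simp: blinfun.add_left commutant_add)
  next
    fix r x assume "x \<in> (\<lambda>d. blinfun_apply d \<zeta>) ` commutant A"
    then obtain d where "d \<in> commutant A" "x = d \<zeta>" by blast
    then show "r *\<^sub>R x \<in> (\<lambda>d. blinfun_apply d \<zeta>) ` commutant A"
      by (intro image_eqI[of _ _ "r *\<^sub>R d"]) (auto simp: blinfun.scaleR_left commutant_scaleR)
  qed
qed

lemma cyclic_subspace_invariant:
  assumes d: "d \<in> commutant A" and v: "v \<in> cyclic_subspace A \<zeta>"
  shows "blinfun_apply d v \<in> cyclic_subspace A \<zeta>"
proof -
  let ?S = "(\<lambda>d. blinfun_apply d \<zeta>) ` commutant A"
  have "blinfun_apply d ` closure ?S \<subseteq> closure ?S"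
  proof (rule image_closure_subset)
    show "continuous_on (closure ?S) (blinfun_apply d)"
      by (intro continuous_intros)
    show "blinfun_apply d ` ?S \<subseteq> closure ?S"
    proof (rule image_subsetI)
      fix y assume "y \<in> ?S"
      then obtain d' where "d' \<in> commutant A" "y = d' \<zeta>" by blast
      then have "d y \<in> ?S"
        by (intro image_eqI[of _ _ "d o\<^sub>L d'"]) (auto simp: commutant_compose d)
      then show "d y \<in> closure ?S"
        by (rule closure_subset[THEN subsetD])
    qed
  qed simp
  with v show ?thesis by (auto simp: cyclic_subspace_def)
qed

text \<open>The subspace is invariant under the commutant, and so is its orthogonal complement, the
  commutant being closed under adjoints. Hence \<open>Q\<close> commutes with the whole commutant,
  in particular with complex scalars and with \<open>A\<close>.\<close>

lemma cyclic_projection: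
  assumes A: "abelian_cstar_subalgebra A"
  obtains Q where "Q \<in> commutant A" "\<And>x. blinfun_apply Q x \<in> cyclic_subspace A \<zeta>"
    "\<And>x. x \<in> cyclic_subspace A \<zeta> \<Longrightarrow> Q x = x"
proof -
  let ?V = "cyclic_subspace A \<zeta>"
  obtain Q where Q: "\<And>x. blinfun_apply Q x \<in> ?V" "\<And>x v. v \<in> ?V \<Longrightarrow> inner (x - Q x) v = 0"
    "\<And>x p. p \<in> ?V \<Longrightarrow> (\<And>v. v \<in> ?V \<Longrightarrow> inner (x - p) v = 0) \<Longrightarrow> Q x = p"
    using projection_exists[OF subspace_cyclic_subspace closed_cyclic_subspace] by metis
  have comm: "Q (d x) = d (Q x)" if d: "d \<in> commutant A" for d x
  proof (rule Q(3))
    show "d (Q x) \<in> ?V" by (rule cyclic_subspace_invariant[OF d Q(1)])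
    fix v assume v: "v \<in> ?V"
    have "inner (d x - d (Q x)) v = inner (x - Q x) (adj d v)"
      using cinner_adj_right[OF commutant_bops[OF d], of "x - Q x" v]
      by (simp add: Re_cinner[symmetric] blinfun.diff_right)
    also have "\<dots> = 0"
      by (rule Q(2)) (rule cyclic_subspace_invariant[OF commutant_adj[OF A d] v])
    finally show "inner (d x - d (Q x)) v = 0" .
  qed
  have "Q \<in> bops"
    using comm[OF commutant_scalar[OF abelian_cstarD(1)[OF A]]]
    by (simp add: bops_def op_scaleC_apply)
  then have "Q \<in> commutant A"
    using comm[OF abelian_subset_commutant[OF A]] by (intro commutantI) auto
  moreover have "Q x = x" if "x \<in> ?V" for x
    using that by (intro Q(3)) auto
  ultimately show ?thesis using Q(1) that by blast
qed

text \<open>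
  Any finite set of vectors lies in the cyclic subspace of one vector for the commutant: if \<open>Q\<close> is the
  projection onto the cyclic subspace of \<open>\<zeta>\<close>, then \<open>Q\<close> itself is in the commutant (because \<open>\<A>\<close> is abelian)
  and \<open>\<zeta> + (1 - Q) \<eta>\<close> generates a subspace containing both \<open>\<zeta>\<close> and \<open>\<eta>\<close>.
\<close>

lemma finite_cyclic:
  fixes n :: nat
  assumes A: "abelian_cstar_subalgebra A"
  shows "\<exists>\<zeta>. \<forall>k<n. \<xi> k \<in> cyclic_subspace A \<zeta>"
proof (induction n)
  case (Suc n)
  then obtain \<zeta> where \<zeta>: "\<And>k. k < n \<Longrightarrow> \<xi> k \<in> cyclic_subspace A \<zeta>" by blast
  obtain Q where Q: "Q \<in> commutant A" "\<And>x. blinfun_apply Q x \<in> cyclic_subspace A \<zeta>"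
    "\<And>x. x \<in> cyclic_subspace A \<zeta> \<Longrightarrow> Q x = x"
    using cyclic_projection[OF A] by metis
  define \<zeta>' where "\<zeta>' = \<zeta> + (\<xi> n - Q (\<xi> n))"
  \<comment> \<open>\<open>Q\<close> removes the added component, hence
    \<open>d \<zeta> = (d o\<^sub>L Q) \<zeta>'\<close> with \<open>d o\<^sub>L Q\<close> again in
    the commutant: the new subspace contains the old one.\<close>
  have Q\<zeta>': "Q \<zeta>' = \<zeta>"
    using Q(3)[OF self_in_cyclic_subspace] Q(3)[OF Q(2)]
    by (simp add: \<zeta>'_def blinfun.add_right blinfun.diff_right)
  have "d \<zeta> \<in> (\<lambda>d. blinfun_apply d \<zeta>') ` commutant A" if "d \<in> commutant A" for d
    using that by (intro image_eqI[of _ _ "d o\<^sub>L Q"]) (auto simp: Q\<zeta>' commutant_compose Q(1))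
  then have sub: "cyclic_subspace A \<zeta> \<subseteq> cyclic_subspace A \<zeta>'"
    unfolding cyclic_subspace_def by (intro closure_mono) auto
  have "Q (\<xi> n) + (\<zeta>' - \<zeta>) \<in> cyclic_subspace A \<zeta>'"
    using sub Q(2) self_in_cyclic_subspace
    by (intro subspace_add subspace_diff subspace_cyclic_subspace) blast+
  then have "\<xi> n \<in> cyclic_subspace A \<zeta>'"
    by (simp add: \<zeta>'_def)
  then have "\<forall>k<Suc n. \<xi> k \<in> cyclic_subspace A \<zeta>'"
    using sub \<zeta> by (auto simp: less_Suc_eq)
  then show ?case by blast
qed simp

section \<open>Positive maps\<close>

lemma bounded_functional_on_finite_sum:
  assumes "\<And>k. k \<in> S \<Longrightarrow> bounded_functional_on A (g k) (M k)"
  shows "bounded_functional_on A (\<lambda>z. \<Sum>k\<in>S. g k z) (\<Sum>k\<in>S. M k)"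
  unfolding bounded_functional_on_def
proof (intro conjI ballI allI)
  fix z assume "z \<in> A"
  then have "cmod (\<Sum>k\<in>S. g k z) \<le> (\<Sum>k\<in>S. M k * norm z)"
    using assms by (intro sum_norm_le) (simp add: bounded_functional_on_def)
  then show "cmod (\<Sum>k\<in>S. g k z) \<le> (\<Sum>k\<in>S. M k) * norm z"
    by (simp add: sum_distrib_right)
qed (use assms in \<open>auto simp: bounded_functional_on_def sum_distrib_left sum.distrib intro: sum_nonneg\<close>)

lemma bounded_functional_on_cong:
  assumes "bounded_functional_on A f M" "op_subspace A" "\<And>z. z \<in> A \<Longrightarrow> g z = f z"
  shows "bounded_functional_on A g M"
  using assms by (simp add: bounded_functional_on_def op_subspace_def)

lemma rank_one_positive: "positive_op (rank_one \<theta> \<theta>)"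
proof -
  have "cinner \<xi> \<theta> * cinner \<theta> \<xi> = complex_of_real ((cmod (cinner \<xi> \<theta>))\<^sup>2)" for \<xi>
    by (subst cinner_commute[of \<theta> \<xi>]) (rule complex_norm_square[symmetric])
  then show ?thesis
    by (simp add: positive_op_def rank_one_bops cinner_scaleC_left del: of_real_power)
qed

lemma vector_functional_norming:
  fixes z :: "'h::complex_hilbert \<Rightarrow>\<^sub>L 'h"
  assumes le: "\<And>\<xi> \<eta>. norm \<xi> \<le> 1 \<Longrightarrow> norm \<eta> \<le> 1 \<Longrightarrow> cmod (cinner (z \<xi>) \<eta>) \<le> s"
  shows "norm z \<le> s"
proof (rule norm_blinfun_bound)
  show "0 \<le> s" using le[of 0 0] by (simp add: cinner.zero_right)
  fix \<xi>
  show "norm (z \<xi>) \<le> s * norm \<xi>"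
  proof (cases "\<xi> = 0 \<or> z \<xi> = 0")
    case True
    then show ?thesis using \<open>0 \<le> s\<close> by auto
  next
    case False
    have "cinner (z ((1 / norm \<xi>) *\<^sub>R \<xi>)) ((1 / norm (z \<xi>)) *\<^sub>R z \<xi>) = complex_of_real (norm (z \<xi>) / norm \<xi>)"
      using False by (simp add: blinfun.scaleR_right cinner.scaleR_left cinner.scaleR_right cinner_self
          scaleR_conv_of_real power2_eq_square)
    moreover have "cmod (cinner (z ((1 / norm \<xi>) *\<^sub>R \<xi>)) ((1 / norm (z \<xi>)) *\<^sub>R z \<xi>)) \<le> s"
      using False by (intro le) auto
    ultimately have "norm (z \<xi>) / norm \<xi> \<le> s"
      by (simp only: norm_of_real abs_norm_cancel abs_divide)
    then show ?thesis using False by (simp add: pos_divide_le_eq)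
  qed
qed

lemma positive_map_vector_form:
  assumes A: "abelian_cstar_subalgebra A" and eh: "eh_series A A I a b"
    and pos: "positive_map (eh_map I a b)"
  shows "eh_form I a b (\<lambda>z. cinner (z \<zeta>) \<theta>) \<in> \<real>\<^sub>\<ge>\<^sub>0"
proof -
  note AD = abelian_cstarD[OF A]
  have "((\<lambda>i. cinner (rank_one \<theta> \<theta> (b i \<zeta>)) (adj (a i) \<zeta>)) has_sum
      cinner (eh_map I a b (rank_one \<theta> \<theta>) \<zeta>) \<zeta>) I"
    by (rule eh_map_cinner[OF eh AD(1) AD(1) rank_one_bops])
  also have "(\<lambda>i. cinner (rank_one \<theta> \<theta> (b i \<zeta>)) (adj (a i) \<zeta>)) =
      (\<lambda>i. cnj (cinner (adj (a i) \<zeta>) \<theta>) * cinner (b i \<zeta>) \<theta>)"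
    by (simp add: cinner_scaleC_left fun_eq_iff cinner_commute[symmetric])
  finally have "eh_form I a b (\<lambda>z. cinner (z \<zeta>) \<theta>) = cinner (eh_map I a b (rank_one \<theta> \<theta>) \<zeta>) \<zeta>"
    unfolding eh_form_def by (rule infsumI)
  also have "\<dots> \<in> \<real>\<^sub>\<ge>\<^sub>0"
    using pos rank_one_positive unfolding positive_map_def positive_op_def by blast
  finally show ?thesis .
qed

lemma positive_map_finite_form:
  fixes n :: nat
  assumes A: "abelian_cstar_subalgebra A" and eh: "eh_series A A I a b"
    and pos: "positive_map (eh_map I a b)"
  shows "eh_form I a b (\<lambda>z. \<Sum>k<n. cinner (z (\<xi> k)) (\<eta> k)) \<in> \<real>\<^sub>\<ge>\<^sub>0" (is "eh_form I a b ?f \<in> _")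
proof (rule eh_form_nonneg_limit[OF A eh])
  note AD = abelian_cstarD[OF A]
  obtain C where C: "sq_bounded_family I b C" "sq_bounded_family I (\<lambda>i. adj (a i)) C"
    using abelian_eh_series[OF A eh] by metis
  have mem: "adj (a i) \<in> A" "b i \<in> A" if "i \<in> I" for i
    using that eh AD(5) by (auto simp: eh_series_def)
  show "bounded_functional_on A ?f (\<Sum>k<n. norm (\<xi> k) * norm (\<eta> k))"
    by (intro bounded_functional_on_finite_sum vector_functional_bounded AD(1))
  obtain \<zeta> where \<zeta>: "\<And>k. k < n \<Longrightarrow> \<xi> k \<in> cyclic_subspace A \<zeta>"
    using finite_cyclic[OF A] by metis
  fix \<delta> :: real assume \<delta>: "0 < \<delta>"
  define N where "N = (\<Sum>k<n. norm (\<eta> k))"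
  have N: "0 \<le> N" by (simp add: N_def sum_nonneg)
  have C0: "0 \<le> C" using C by (simp add: sq_bounded_family_def)
  \<comment> \<open>Chosen so that \<open>(s * N)\<^sup>2 * C \<le> \<delta>\<close>; the added ones
    keep the denominator positive when \<open>N\<close> or \<open>C\<close> vanishes.\<close>
  define s where "s = sqrt \<delta> / ((N + 1) * (sqrt C + 1))"
  have NC: "0 < (N + 1) * (sqrt C + 1)" using N C0 by (intro mult_pos_pos) (auto simp: add_nonneg_pos)
  then have s: "0 < s" using \<delta> by (simp add: s_def)
  have "\<exists>d\<in>commutant A. norm (\<xi> k - d \<zeta>) < s" if "k < n" for k
    using \<zeta>[OF that] s unfolding cyclic_subspace_def closure_approachable
    by (auto simp: dist_norm norm_minus_commute)
  then obtain d where d: "\<And>k. k < n \<Longrightarrow> d k \<in> commutant A" "\<And>k. k < n \<Longrightarrow> norm (\<xi> k - d k \<zeta>) < s"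
    by metis
  \<comment> \<open>Commuting \<open>d k\<close> past \<open>z\<close> and passing to its adjoint
    turns \<open>cinner (z (d k \<zeta>)) (\<eta> k)\<close> into
    \<open>cinner (z \<zeta>) (adj (d k) (\<eta> k))\<close>: the first vector is now common to all
    terms, which merge into one functional.\<close>
  define \<theta> where "\<theta> = (\<Sum>k<n. adj (d k) (\<eta> k))"
  define h where "h = (\<lambda>z. cinner (blinfun_apply z \<zeta>) \<theta>)"
  have diff: "?f z - h z = (\<Sum>k<n. cinner (z (\<xi> k - d k \<zeta>)) (\<eta> k))" if z: "z \<in> A" for z
  proof -
    have "h z = (\<Sum>k<n. cinner (z \<zeta>) (adj (d k) (\<eta> k)))"
      by (simp add: h_def \<theta>_def cinner.sum_right)
    also have "\<dots> = (\<Sum>k<n. cinner (z (d k \<zeta>)) (\<eta> k))"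
      by (intro sum.cong) (auto simp: cinner_adj_right commutant_bops[OF d(1)] commutantD[OF d(1) z])
    finally show ?thesis
      by (simp add: blinfun.diff_right cinner.diff_left sum_subtractf)
  qed
  have "bounded_functional_on A (\<lambda>z. ?f z - h z) (\<Sum>k<n. norm (\<xi> k - d k \<zeta>) * norm (\<eta> k))"
    by (rule bounded_functional_on_cong[OF _ AD(2) diff])
      (intro bounded_functional_on_finite_sum vector_functional_bounded AD(1))
  moreover have "(\<Sum>k<n. norm (\<xi> k - d k \<zeta>) * norm (\<eta> k)) \<le> s * N"
    unfolding N_def sum_distrib_left using d(2) by (intro sum_mono mult_right_mono) (auto intro: less_imp_le)
  ultimately have fh: "bounded_functional_on A (\<lambda>z. ?f z - h z) (s * N)"
    by (rule bounded_functional_on_mono)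
  have "(s * N)\<^sup>2 * C = (s * (N * sqrt C))\<^sup>2"
    using C0 by (simp add: power_mult_distrib)
  also have "\<dots> \<le> (s * ((N + 1) * (sqrt C + 1)))\<^sup>2"
    using s N C0 by (intro power_mono mult_left_mono mult_mono) auto
  also have "s * ((N + 1) * (sqrt C + 1)) = sqrt \<delta>"
    unfolding s_def using NC by (metis less_irrefl nonzero_eq_divide_eq)
  also have "(sqrt \<delta>)\<^sup>2 = \<delta>"
    using \<delta> by simp
  finally have bound: "(s * N)\<^sup>2 * C \<le> \<delta>" .
  have "sq_bounded I (\<lambda>i. ?f (b i) - h (b i)) \<delta>" "sq_bounded I (\<lambda>i. ?f (adj (a i)) - h (adj (a i))) \<delta>"
    using sq_bounded_mono[OF functional_family_sq_bounded[OF fh AD(2) C(1) mem(2)] bound]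
      sq_bounded_mono[OF functional_family_sq_bounded[OF fh AD(2) C(2) mem(1)] bound] by simp_all
  moreover have "eh_form I a b h \<in> \<real>\<^sub>\<ge>\<^sub>0"
    unfolding h_def by (rule positive_map_vector_form[OF A eh pos])
  ultimately show "\<exists>h. sq_bounded I (\<lambda>i. ?f (b i) - h (b i)) \<delta> \<and>
      sq_bounded I (\<lambda>i. ?f (adj (a i)) - h (adj (a i))) \<delta> \<and> eh_form I a b h \<in> \<real>\<^sub>\<ge>\<^sub>0"
    by blast
qed

lemma positive_map_eh_form_nonneg:
  fixes A :: "('h::complex_hilbert \<Rightarrow>\<^sub>L 'h) set"
  assumes A: "abelian_cstar_subalgebra A" and eh: "eh_series A A I a b"
    and pos: "positive_map (eh_map I a b)" and f: "bounded_functional_on A f M"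
  shows "eh_form I a b f \<in> \<real>\<^sub>\<ge>\<^sub>0"
proof (rule eh_form_nonneg_generated[OF A eh f])
  note AD = abelian_cstarD[OF A]
  let ?X = "{p :: 'h \<times> 'h. norm (fst p) \<le> 1 \<and> norm (snd p) \<le> 1}"
  let ?g = "\<lambda>p z. cinner (blinfun_apply z (fst p)) (snd p)"
  show "bounded_functional_on A (?g p) 1" if "p \<in> ?X" for p
    by (rule bounded_functional_on_mono[OF vector_functional_bounded[OF AD(1)]])
      (use that in \<open>simp add: mult_le_one\<close>)
  show "norm z \<le> s" if "\<And>p. p \<in> ?X \<Longrightarrow> cmod (?g p z) \<le> s" for z :: "'h \<Rightarrow>\<^sub>L 'h" and s
    by (rule vector_functional_norming) (use that in force)
  fix xs :: "(complex \<times> 'h \<times> 'h) list"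
  have "functional_comb ?g xs =
      (\<lambda>z. \<Sum>k<length xs. cinner (z (fst (snd (xs ! k)))) (cnj (fst (xs ! k)) *\<^sub>C snd (snd (xs ! k))))"
    by (rule ext) (simp add: functional_comb_sum cinner_scaleC_right)
  then show "eh_form I a b (functional_comb ?g xs) \<in> \<real>\<^sub>\<ge>\<^sub>0"
    using positive_map_finite_form[OF A eh pos] by simp
qed

section \<open>Complete positivity\<close>

text \<open>Linearity is stated in the first argument; Hermitian symmetry transfers it to the second
  as conjugate linearity and makes the diagonal real.\<close>

definition psd_form :: "('h::complex_hilbert \<Rightarrow>\<^sub>L 'h) set \<Rightarrow> (('h \<Rightarrow>\<^sub>L 'h) \<Rightarrow> ('h \<Rightarrow>\<^sub>L 'h) \<Rightarrow> complex) \<Rightarrow> bool" where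
  "psd_form A s \<longleftrightarrow>
     (\<forall>p\<in>A. \<forall>q\<in>A. \<forall>r\<in>A. s (p + q) r = s p r + s q r) \<and>
     (\<forall>c. \<forall>p\<in>A. \<forall>q\<in>A. s (op_scaleC c p) q = c * s p q) \<and>
     (\<forall>p\<in>A. \<forall>q\<in>A. s q p = cnj (s p q)) \<and>
     (\<forall>p\<in>A. 0 \<le> Re (s p p))"

lemma psd_formD:
  assumes "psd_form A s"
  shows "\<And>p q r. p \<in> A \<Longrightarrow> q \<in> A \<Longrightarrow> r \<in> A \<Longrightarrow> s (p + q) r = s p r + s q r"
    "\<And>c p q. p \<in> A \<Longrightarrow> q \<in> A \<Longrightarrow> s (op_scaleC c p) q = c * s p q"
    "\<And>p q. p \<in> A \<Longrightarrow> q \<in> A \<Longrightarrow> s q p = cnj (s p q)"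
    "\<And>p. p \<in> A \<Longrightarrow> 0 \<le> Re (s p p)"
  using assms unfolding psd_form_def by blast+

lemma psd_form_diag:
  assumes "psd_form A s" "p \<in> A" shows "s p p = complex_of_real (Re (s p p))"
proof -
  have "s p p = cnj (s p p)" using psd_formD(3)[OF assms(1,2,2)] .
  then have "Im (s p p) = - Im (s p p)" by (metis complex_cnj cnj.simps(2))
  then show ?thesis by (simp add: complex_eq_iff)
qed

lemma quadratic_nonneg_discriminant:
  fixes P m R :: real
  assumes "\<And>t. 0 \<le> P - 2 * t * m + t\<^sup>2 * R" and R: "0 \<le> R"
  shows "m\<^sup>2 \<le> P * R"
proof (cases "R = 0")
  case True
  have "m = 0"
  proof (rule ccontr)
    assume "m \<noteq> 0"
    then show False
      using assms(1)[of "(P + 1) / (2 * m)"] True by simp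
  qed
  then show ?thesis using True by simp
next
  case False
  with R have R: "0 < R" by simp
  have "0 \<le> P - 2 * (m / R) * m + (m / R)\<^sup>2 * R" by (rule assms)
  also have "\<dots> = P - m\<^sup>2 / R"
    using R by (simp add: power2_eq_square field_simps)
  finally show ?thesis
    using R by (simp add: pos_divide_le_eq)
qed

lemma psd_form_Cauchy_Schwarz:
  assumes A: "op_subspace A" and s: "psd_form A s" and p: "p \<in> A" and q: "q \<in> A"
  shows "(cmod (s p q))\<^sup>2 \<le> Re (s p p) * Re (s q q)"
proof (rule quadratic_nonneg_discriminant)
  note S = psd_formD[OF s]
  show "0 \<le> Re (s q q)" by (rule S(4)[OF q])
  fix t :: real
  \<comment> \<open>Aligns the phase of \<open>q\<close> so that the cross term becomes
    \<open>- 2 * t * cmod (s p q)\<close>, leaving a real quadratic in t.\<close>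
  define c where "c = - complex_of_real t * sgn (s p q)"
  have cq: "op_scaleC c q \<in> A" using A q by (simp add: op_subspace_def)
  have pcq: "p + op_scaleC c q \<in> A" using A p cq by (simp add: op_subspace_def)
  have right_add: "s r (p + op_scaleC c q) = s r p + cnj c * s r q" if r: "r \<in> A" for r
  proof -
    have "s r (p + op_scaleC c q) = cnj (s p r + c * s q r)"
      using S(3)[OF pcq r] S(1)[OF p cq r] S(2)[OF q r] by simp
    also have "\<dots> = s r p + cnj c * s r q"
      using S(3)[OF p r] S(3)[OF q r] by simp
    finally show ?thesis .
  qed
  have "0 \<le> Re (s (p + op_scaleC c q) (p + op_scaleC c q))"
    by (rule S(4)[OF pcq])
  also have "s (p + op_scaleC c q) (p + op_scaleC c q) =
      s p p + cnj c * s p q + c * (s q p + cnj c * s q q)"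
    using S(1)[OF p cq pcq] S(2)[OF q pcq] right_add[OF p] right_add[OF q] by simp
  also have "Re \<dots> = Re (s p p) + 2 * Re (cnj c * s p q) + (cmod c)\<^sup>2 * Re (s q q)"
  proof -
    have "c * s q p = cnj (cnj c * s p q)" using S(3)[OF p q] by simp
    moreover have "c * (cnj c * s q q) = complex_of_real ((cmod c)\<^sup>2 * Re (s q q))"
      using psd_form_diag[OF s q] by (simp add: complex_norm_square[symmetric] mult.assoc[symmetric] del: of_real_power)
    ultimately show ?thesis
      by (simp only: distrib_left plus_complex.sel complex_cnj Re_complex_of_real cnj.sel)
  qed
  also have "cnj c * s p q = complex_of_real (- t * cmod (s p q))"
    by (cases "s p q = 0") (simp_all add: c_def sgn_eq complex_norm_square[symmetric] power2_eq_square field_simps)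
  also have "(cmod c)\<^sup>2 * Re (s q q) \<le> t\<^sup>2 * Re (s q q)"
    by (intro mult_right_mono S(4)[OF q]) (simp add: c_def norm_mult norm_sgn)
  finally show "0 \<le> Re (s p p) - 2 * t * cmod (s p q) + t\<^sup>2 * Re (s q q)"
    by simp
qed

lemma psd_form_norm_le:
  assumes "op_subspace A" "psd_form A s" "p \<in> A" "q \<in> A"
  shows "cmod (s p q) \<le> sqrt (Re (s p p)) * sqrt (Re (s q q))"
  using real_sqrt_le_mono[OF psd_form_Cauchy_Schwarz[OF assms]] by (simp add: real_sqrt_mult)

text \<open>
  The Schur complement of \<open>v\<close>: it splits off the rank-one form \<open>h \<otimes> cnj h\<close> with \<open>h = s(\<cdot>, v) / sqrt (s(v, v))\<close>,
  and what remains is still positive and has \<open>v\<close> in its kernel.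
\<close>

lemma psd_form_Schur_complement:
  assumes A: "op_subspace A" and s: "psd_form A s" and v: "v \<in> A"
  defines "s' \<equiv> (\<lambda>p q. s p q - s p v * s v q / s v v)"
  shows "psd_form A s'" "\<And>p. p \<in> A \<Longrightarrow> Re (s' p p) \<le> Re (s p p)" "\<And>q. q \<in> A \<Longrightarrow> s' v q = 0"
    "\<And>w q. q \<in> A \<Longrightarrow> (\<And>q. q \<in> A \<Longrightarrow> s w q = 0) \<Longrightarrow> s' w q = 0"
proof -
  note S = psd_formD[OF s]
  have diag: "Re (s' p p) = Re (s p p) - (cmod (s p v))\<^sup>2 / Re (s v v)" if p: "p \<in> A" for p
  proof -
    have "s p v * s v p = complex_of_real ((cmod (s p v))\<^sup>2)"
      using S(3)[OF p v] by (simp add: complex_norm_square del: of_real_power)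
    then have "s p v * s v p / s v v = complex_of_real ((cmod (s p v))\<^sup>2 / Re (s v v))"
      using psd_form_diag[OF s v] by simp
    then show ?thesis by (simp add: s'_def)
  qed
  show le: "Re (s' p p) \<le> Re (s p p)" if "p \<in> A" for p
    using diag[OF that] S(4)[OF v] by simp
  have "0 \<le> Re (s' p p)" if p: "p \<in> A" for p
  proof (cases "Re (s v v) = 0")
    case True
    then show ?thesis using diag[OF p] S(4)[OF p] by simp
  next
    case False
    then have "0 < Re (s v v)" using S(4)[OF v] by simp
    then show ?thesis
      using diag[OF p] psd_form_Cauchy_Schwarz[OF A s p v] by (simp add: pos_divide_le_eq)
  qed
  moreover have "s' q p = cnj (s' p q)" if p: "p \<in> A" and q: "q \<in> A" for p q
  proof -
    have "cnj (s v v) = s v v" using S(3)[OF v v] by (rule sym)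
    then show ?thesis
      by (simp add: s'_def S(3)[OF p q] S(3)[OF v q] S(3)[OF p v] mult.commute)
  qed
  ultimately show "psd_form A s'"
    using S(1,2) v by (auto simp: psd_form_def s'_def add_divide_distrib algebra_simps)
  \<comment> \<open>If \<open>s v v = 0\<close>, nothing is subtracted, as division by zero gives 0;
    Cauchy-Schwarz then already places \<open>v\<close> in the kernel of \<open>s\<close>.\<close>
  show "s' v q = 0" if q: "q \<in> A" for q
  proof (cases "s v v = 0")
    case True
    then have "s v q = 0"
      using psd_form_norm_le[OF A s v q] by simp
    then show ?thesis by (simp add: s'_def)
  qed (simp add: s'_def)
  show "s' w q = 0" if "q \<in> A" "\<And>q. q \<in> A \<Longrightarrow> s w q = 0" for w q
    using that v by (simp add: s'_def)
qed

text \<open>Makes the functional split off by a Schur complement an admissible argument of the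
  nonnegativity condition on bounded functionals.\<close>

lemma psd_form_functional_bounded:
  assumes A: "op_subspace A" and s: "psd_form A s" and v: "v \<in> A"
    and K: "0 \<le> K" "\<And>p. p \<in> A \<Longrightarrow> Re (s p p) \<le> K * (norm p)\<^sup>2"
  shows "bounded_functional_on A (\<lambda>p. s p v) (sqrt K * sqrt (Re (s v v)))"
  unfolding bounded_functional_on_def
proof (intro conjI ballI allI)
  note S = psd_formD[OF s]
  show "0 \<le> sqrt K * sqrt (Re (s v v))" using K(1) S(4)[OF v] by simp
  fix p assume p: "p \<in> A"
  have "cmod (s p v) \<le> sqrt (Re (s p p)) * sqrt (Re (s v v))"
    by (rule psd_form_norm_le[OF A s p v])
  also have "\<dots> \<le> sqrt (K * (norm p)\<^sup>2) * sqrt (Re (s v v))"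
    using K(2)[OF p] S(4)[OF v] by (intro mult_right_mono) auto
  finally show "cmod (s p v) \<le> sqrt K * sqrt (Re (s v v)) * norm p"
    by (simp add: real_sqrt_mult mult_ac)
qed (use psd_formD(1,2)[OF s] v in auto)

text \<open>Each Schur complement at some \<open>b j\<close> lowers the sum by a nonnegative amount.
  Diagonals only decrease, so Cauchy-Schwarz keeps all later series below the one summable
  \<open>g\<close>, whose tail bounds what is left after finitely many steps.\<close>

lemma psd_form_series_nonneg:
  assumes A: "abelian_cstar_subalgebra A" and eh: "eh_series A A I a b"
    and H: "\<And>f M. bounded_functional_on A f M \<Longrightarrow> eh_form I a b f \<in> \<real>\<^sub>\<ge>\<^sub>0"
    and s: "psd_form A s" and K: "0 \<le> K" "\<And>p. p \<in> A \<Longrightarrow> Re (s p p) \<le> K * (norm p)\<^sup>2"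
    and sb: "sq_bounded I (\<lambda>i. sqrt (Re (s (b i) (b i)))) B"
    and sa: "sq_bounded I (\<lambda>i. sqrt (Re (s (adj (a i)) (adj (a i))))) B"
  shows "(\<Sum>\<^sub>\<infinity>i\<in>I. s (b i) (adj (a i))) \<in> \<real>\<^sub>\<ge>\<^sub>0"
proof -
  note AD = abelian_cstarD[OF A]
  have mem: "adj (a i) \<in> A" "b i \<in> A" if "i \<in> I" for i
    using that eh AD(5) by (auto simp: eh_series_def)
  define g where "g i = norm (sqrt (Re (s (b i) (b i)))) * norm (sqrt (Re (s (adj (a i)) (adj (a i)))))" for i
  have g: "g summable_on I"
    unfolding g_def[abs_def] by (rule sq_bounded_mult_summable[OF sb sa])
  define le where "le s' \<longleftrightarrow> psd_form A s' \<and> (\<forall>p\<in>A. Re (s' p p) \<le> Re (s p p))" for s'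
  have term_le: "cmod (s' (b i) (adj (a i))) \<le> g i" if s': "le s'" and i: "i \<in> I" for s' i
  proof -
    have "cmod (s' (b i) (adj (a i))) \<le> sqrt (Re (s' (b i) (b i))) * sqrt (Re (s' (adj (a i)) (adj (a i))))"
      using s' mem[OF i] by (intro psd_form_norm_le[OF AD(2)]) (auto simp: le_def)
    also have "\<dots> \<le> sqrt (Re (s (b i) (b i))) * sqrt (Re (s (adj (a i)) (adj (a i))))"
      using s' mem[OF i] psd_formD(4)[OF s] psd_formD(4)[of A s']
      by (intro mult_mono) (auto simp: le_def)
    also have "\<dots> \<le> g i"
      using mem[OF i] psd_formD(4)[OF s] by (simp add: g_def)
    finally show ?thesis .
  qed
  define \<Sigma> where "\<Sigma> s' = (\<Sum>\<^sub>\<infinity>i\<in>I. s' (b i) (adj (a i)))" for s' :: "('a \<Rightarrow>\<^sub>L 'a) \<Rightarrow> ('a \<Rightarrow>\<^sub>L 'a) \<Rightarrow> complex"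
  have \<Sigma>: "((\<lambda>i. s' (b i) (adj (a i))) has_sum \<Sigma> s') I" if "le s'" for s'
    unfolding \<Sigma>_def
    by (rule has_sum_infsum, rule abs_summable_on_dominated(1)[OF g]) (rule term_le[OF that])
  \<comment> \<open>A direction annihilated once remains so under later complements, so the
    induction over \<open>J\<close> accumulates kernels.\<close>
  have kill: "\<exists>s'. le s' \<and> (\<forall>j\<in>J. \<forall>q\<in>A. s' (b j) q = 0) \<and> \<Sigma> s - \<Sigma> s' \<in> \<real>\<^sub>\<ge>\<^sub>0"
    if "finite J" "J \<subseteq> I" for J
    using that
  proof (induction J rule: finite_induct)
    case empty
    show ?case using s by (intro exI[of _ s]) (auto simp: le_def)
  next
    case (insert j J)
    then obtain s' where s': "le s'" "\<forall>j\<in>J. \<forall>q\<in>A. s' (b j) q = 0" "\<Sigma> s - \<Sigma> s' \<in> \<real>\<^sub>\<ge>\<^sub>0" by auto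
    define v where "v = b j"
    have v: "v \<in> A" using insert mem by (simp add: v_def)
    have psd: "psd_form A s'" and s's: "\<And>p. p \<in> A \<Longrightarrow> Re (s' p p) \<le> Re (s p p)"
      using s' by (auto simp: le_def)
    define s'' where "s'' = (\<lambda>p q. s' p q - s' p v * s' v q / s' v v)"
    note schur_complement = psd_form_Schur_complement[OF AD(2) psd v]
    have schur: "psd_form A s''" "\<And>p. p \<in> A \<Longrightarrow> Re (s'' p p) \<le> Re (s' p p)"
      "\<And>q. q \<in> A \<Longrightarrow> s'' v q = 0"
      "\<And>w q. q \<in> A \<Longrightarrow> (\<And>q. q \<in> A \<Longrightarrow> s' w q = 0) \<Longrightarrow> s'' w q = 0"
      unfolding s''_def by (fact schur_complement)+
    have le'': "le s''"
      using schur(1,2) s's unfolding le_def by (meson order_trans)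
    have "bounded_functional_on A (\<lambda>p. s' p v) (sqrt K * sqrt (Re (s' v v)))"
      by (rule psd_form_functional_bounded[OF AD(2) psd v K(1)]) (use s's K(2) order_trans in blast)
    then have "eh_form I a b (\<lambda>p. s' p v) \<in> \<real>\<^sub>\<ge>\<^sub>0" by (rule H)
    have "((\<lambda>i. s' (b i) (adj (a i)) + (- 1) * s'' (b i) (adj (a i))) has_sum (\<Sigma> s' + (- 1) * \<Sigma> s'')) I"
      by (intro has_sum_add has_sum_cmult_right \<Sigma> s'(1) le'')
    also have "?this \<longleftrightarrow> ((\<lambda>i. (1 / s' v v) * (cnj (s' (adj (a i)) v) * s' (b i) v)) has_sum (\<Sigma> s' + (- 1) * \<Sigma> s'')) I"
      by (intro has_sum_cong) (simp add: s''_def psd_formD(3)[OF psd mem(1) v])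
    finally have "\<Sigma> s' - \<Sigma> s'' = (\<Sum>\<^sub>\<infinity>i\<in>I. (1 / s' v v) * (cnj (s' (adj (a i)) v) * s' (b i) v))"
      by (simp add: infsumI)
    \<comment> \<open>The split-off part contributes a nonnegative multiple of the form at
      \<open>\<lambda>p. s' p v\<close>; if \<open>s' v v = 0\<close>, the multiple is 0.\<close>
    also have "\<dots> = (1 / s' v v) * eh_form I a b (\<lambda>p. s' p v)"
      unfolding eh_form_def by (rule infsum_cmult_right')
    also have "1 / s' v v = complex_of_real (1 / Re (s' v v))"
      using psd_form_diag[OF psd v] by simp
    also have "complex_of_real (1 / Re (s' v v)) * eh_form I a b (\<lambda>p. s' p v) \<in> \<real>\<^sub>\<ge>\<^sub>0"
      using psd_formD(4)[OF psd v] \<open>eh_form I a b (\<lambda>p. s' p v) \<in> \<real>\<^sub>\<ge>\<^sub>0\<close>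
      by (intro nonneg_Reals_mult_I) auto
    finally have "(\<Sigma> s - \<Sigma> s') + (\<Sigma> s' - \<Sigma> s'') \<in> \<real>\<^sub>\<ge>\<^sub>0"
      using s'(3) by (intro nonneg_Reals_add_I)
    then have "\<Sigma> s - \<Sigma> s'' \<in> \<real>\<^sub>\<ge>\<^sub>0" by simp
    moreover have "\<forall>j\<in>insert j J. \<forall>q\<in>A. s'' (b j) q = 0"
      using schur(3,4) s'(2) by (auto simp: v_def)
    ultimately show ?case using le'' by blast
  qed
  have "\<Sigma> s \<in> \<real>\<^sub>\<ge>\<^sub>0"
  proof (rule nonneg_Reals_approximated)
    fix \<epsilon> :: real assume "0 < \<epsilon>"
    then obtain J where J: "finite J" "J \<subseteq> I" "infsum g (I - J) < \<epsilon>"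
      using summable_on_small_tail[OF g] by (auto simp: g_def)
    obtain s' where s': "le s'" "\<forall>j\<in>J. \<forall>q\<in>A. s' (b j) q = 0" "\<Sigma> s - \<Sigma> s' \<in> \<real>\<^sub>\<ge>\<^sub>0"
      using kill[OF J(1,2)] by blast
    have "\<Sigma> s' = (\<Sum>\<^sub>\<infinity>i\<in>I - J. s' (b i) (adj (a i)))"
      unfolding \<Sigma>_def using s'(2) mem J(2) by (intro infsum_cong_neutral) auto
    also have "cmod \<dots> \<le> infsum g (I - J)"
      by (rule abs_summable_on_dominated(3)[OF summable_on_subset_banach[OF g]]) (auto intro: term_le[OF s'(1)])
    finally have "cmod (\<Sigma> s') \<le> \<epsilon>" using J(3) by simp
    then show "\<exists>v. v \<in> \<real>\<^sub>\<ge>\<^sub>0 \<and> cmod (\<Sigma> s - v) \<le> \<epsilon>"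
      using s'(3) by (intro exI[of _ "\<Sigma> s - \<Sigma> s'"]) simp
  qed
  then show ?thesis by (simp add: \<Sigma>_def)
qed

text \<open>Polarization: the form is real on the diagonal, and its values at \<zeta> + \<eta> and
  \<zeta> + i \<eta> compare the imaginary and the real parts of the two mixed terms.\<close>

lemma positive_op_matrix_hermitian:
  assumes X: "positive_op_matrix n X"
  defines "t \<equiv> \<lambda>\<zeta> \<eta>. \<Sum>k<n. \<Sum>l<n. cinner (blinfun_apply (X k l) (\<zeta> l)) (\<eta> k)"
  shows "t \<eta> \<zeta> = cnj (t \<zeta> \<eta>)"
proof -
  have t: "t \<zeta> \<zeta> \<in> \<real>\<^sub>\<ge>\<^sub>0" for \<zeta>
    using X by (simp add: positive_op_matrix_def t_def cinner.sum_left)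
  then have Im: "Im (t \<zeta> \<zeta>) = 0" for \<zeta>
    by (simp add: complex_nonneg_Reals_iff)
  have add1: "t (\<lambda>k. \<zeta> k + \<eta> k) \<theta> = t \<zeta> \<theta> + t \<eta> \<theta>" for \<zeta> \<eta> \<theta>
    by (simp add: t_def blinfun.add_right cinner_add_left sum.distrib)
  have add2: "t \<theta> (\<lambda>k. \<zeta> k + \<eta> k) = t \<theta> \<zeta> + t \<theta> \<eta>" for \<zeta> \<eta> \<theta>
    by (simp add: t_def cinner_add_right sum.distrib)
  have scale1: "t (\<lambda>k. c *\<^sub>C \<zeta> k) \<theta> = c * t \<zeta> \<theta>" for c \<zeta> \<theta>
    using X unfolding t_def sum_distrib_left
    by (intro sum.cong) (auto simp: positive_op_matrix_def bops_scaleC cinner_scaleC_left)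
  have scale2: "t \<theta> (\<lambda>k. c *\<^sub>C \<zeta> k) = cnj c * t \<theta> \<zeta>" for c \<zeta> \<theta>
    by (simp add: t_def cinner_scaleC_right sum_distrib_left)
  have "Im (t \<zeta> \<eta>) + Im (t \<eta> \<zeta>) = 0"
    using Im[of "\<lambda>k. \<zeta> k + \<eta> k"] Im[of \<zeta>] Im[of \<eta>] by (simp add: add1 add2)
  moreover have "Re (t \<eta> \<zeta>) - Re (t \<zeta> \<eta>) = 0"
    using Im[of "\<lambda>k. \<zeta> k + \<i> *\<^sub>C \<eta> k"] Im[of \<zeta>] Im[of \<eta>]
    by (simp add: add1 add2 scale1 scale2)
  ultimately show ?thesis by (simp add: complex_eq_iff)
qed

lemma eh_form_nonneg_completely_positive:
  fixes A :: "('h::complex_hilbert \<Rightarrow>\<^sub>L 'h) set"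
  assumes A: "abelian_cstar_subalgebra A" and eh: "eh_series A A I a b"
    and H: "\<And>f M. bounded_functional_on A f M \<Longrightarrow> eh_form I a b f \<in> \<real>\<^sub>\<ge>\<^sub>0"
  shows "completely_positive_map (eh_map I a b)"
  unfolding completely_positive_map_def
proof (intro allI impI)
  note AD = abelian_cstarD[OF A]
  fix n and X :: "nat \<Rightarrow> nat \<Rightarrow> ('h \<Rightarrow>\<^sub>L 'h)" assume X: "positive_op_matrix n X"
  have Xb: "X k l \<in> bops" if "k < n" "l < n" for k l
    using X that by (simp add: positive_op_matrix_def)
  have "(\<Sum>k<n. cinner (\<Sum>l<n. eh_map I a b (X k l) (\<xi> l)) (\<xi> k)) \<in> \<real>\<^sub>\<ge>\<^sub>0" for \<xi>
  proof -
    obtain C where C: "sq_bounded_family I b C" "sq_bounded_family I (\<lambda>i. adj (a i)) C"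
      using abelian_eh_series[OF A eh] by metis
    \<comment> \<open>At \<open>p = b i\<close> and \<open>q = adj (a i)\<close> this is the i-th
      term of the number to be shown nonnegative.\<close>
    define s where "s p q = (\<Sum>k<n. \<Sum>l<n. cinner (X k l (blinfun_apply p (\<xi> l))) (blinfun_apply q (\<xi> k)))" for p q
    have herm: "s q p = cnj (s p q)" for p q
      unfolding s_def by (rule positive_op_matrix_hermitian[OF X, of "\<lambda>k. q (\<xi> k)" "\<lambda>k. p (\<xi> k)"])
    have diag: "s p p \<in> \<real>\<^sub>\<ge>\<^sub>0" for p
      using X by (simp add: positive_op_matrix_def s_def cinner.sum_left)
    have scale: "s (op_scaleC c p) q = c * s p q" for c p q
      unfolding s_def sum_distrib_left
      by (intro sum.cong) (auto simp: Xb op_scaleC_apply bops_scaleC cinner_scaleC_left)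
    have psd: "psd_form A s"
      using herm scale diag
      by (auto simp: psd_form_def s_def complex_nonneg_Reals_iff blinfun.add_left blinfun.add_right
          cinner_add_left sum.distrib)
    define N where "N = (\<Sum>k<n. \<Sum>l<n. norm (X k l))"
    have N: "0 \<le> N" by (simp add: N_def sum_nonneg)
    \<comment> \<open>An intermediate bound between the form and the squared norm: summed over a
      column-bounded family, \<open>W\<close> stays below \<open>C * Z\<close>, whereas the squared
      operator norms of the members need not be summable.\<close>
    define W where "W p = (\<Sum>l<n. (norm (p (\<xi> l)))\<^sup>2)" for p :: "'h \<Rightarrow>\<^sub>L 'h"
    have sW: "Re (s p p) \<le> N * W p" for p
    proof -
      have "Re (s p p) \<le> cmod (s p p)" by (rule complex_Re_le_cmod)
      also have "\<dots> \<le> (\<Sum>k<n. \<Sum>l<n. norm (X k l) * W p)"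
        unfolding s_def
      proof (intro sum_norm_le)
        fix k l assume kl: "k \<in> {..<n}" "l \<in> {..<n}"
        have sq: "(norm (p (\<xi> j)))\<^sup>2 \<le> W p" if "j \<in> {..<n}" for j
          unfolding W_def by (rule member_le_sum[OF that]) auto
        have "cmod (cinner (X k l (p (\<xi> l))) (p (\<xi> k))) \<le> norm (X k l (p (\<xi> l))) * norm (p (\<xi> k))"
          by (rule norm_cinner_le)
        also have "\<dots> \<le> (norm (X k l) * norm (p (\<xi> l))) * norm (p (\<xi> k))"
          by (intro mult_right_mono norm_blinfun) auto
        also have "\<dots> = norm (X k l) * (norm (p (\<xi> l)) * norm (p (\<xi> k)))"
          by simp
        also have "\<dots> \<le> norm (X k l) * W p"
          using sum_squares_bound[of "norm (p (\<xi> l))" "norm (p (\<xi> k))"] sq[OF kl(1)] sq[OF kl(2)]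
          by (intro mult_left_mono) auto
        finally show "cmod (cinner (X k l (p (\<xi> l))) (p (\<xi> k))) \<le> norm (X k l) * W p" .
      qed
      also have "\<dots> = N * W p"
        by (simp add: N_def sum_distrib_right)
      finally show ?thesis .
    qed
    define Z where "Z = (\<Sum>l<n. (norm (\<xi> l))\<^sup>2)"
    have WZ: "W p \<le> (norm p)\<^sup>2 * Z" for p
      unfolding W_def Z_def sum_distrib_left
      by (intro sum_mono) (simp add: norm_blinfun power_mono flip: power_mult_distrib)
    have K: "Re (s p p) \<le> (N * Z) * (norm p)\<^sup>2" for p
      using sW[of p] mult_left_mono[OF WZ[of p] N] by (simp add: mult_ac)
    have family: "sq_bounded I (\<lambda>i. sqrt (Re (s (e i) (e i)))) (N * (C * Z))"
      if e: "sq_bounded_family I e C" for e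
      unfolding sq_bounded_def
    proof (intro allI impI)
      fix J assume J: "finite J" "J \<subseteq> I"
      have "(\<Sum>i\<in>J. (norm (sqrt (Re (s (e i) (e i)))))\<^sup>2) \<le> (\<Sum>i\<in>J. N * W (e i))"
        using diag sW by (intro sum_mono) (simp add: complex_nonneg_Reals_iff)
      also have "\<dots> = N * (\<Sum>l<n. \<Sum>i\<in>J. (norm (e i (\<xi> l)))\<^sup>2)"
        unfolding W_def sum_distrib_left by (rule sum.swap)
      also have "\<dots> \<le> N * (\<Sum>l<n. C * (norm (\<xi> l))\<^sup>2)"
        using N by (intro mult_left_mono sum_mono sq_boundedD[OF sq_bounded_familyD[OF e] J])
      finally show "(\<Sum>i\<in>J. (norm (sqrt (Re (s (e i) (e i)))))\<^sup>2) \<le> N * (C * Z)"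
        by (simp add: Z_def sum_distrib_left)
    qed
    have "0 \<le> N * Z" using N by (simp add: Z_def sum_nonneg)
    then have "(\<Sum>\<^sub>\<infinity>i\<in>I. s (b i) (adj (a i))) \<in> \<real>\<^sub>\<ge>\<^sub>0"
      by (rule psd_form_series_nonneg[OF A eh _ psd _ K family[OF C(1)] family[OF C(2)], rotated]) (rule H)
    moreover have "((\<lambda>i. s (b i) (adj (a i))) has_sum
        (\<Sum>k<n. \<Sum>l<n. cinner (eh_map I a b (X k l) (\<xi> l)) (\<xi> k))) I"
      unfolding s_def
      by (intro has_sum_sum eh_map_cinner[OF eh AD(1) AD(1)]) (auto intro: Xb)
    ultimately show ?thesis
      by (simp add: cinner.sum_left infsumI)
  qed
  then show "positive_op_matrix n (\<lambda>i j. eh_map I a b (X i j))"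
    unfolding positive_op_matrix_def using eh_map_bops[OF eh AD(1) AD(1) Xb] by blast
qed

lemma completely_positive_imp_positive:
  assumes "completely_positive_map T"
  shows "positive_map T"
  unfolding positive_map_def
proof (intro allI impI)
  fix x :: "'a \<Rightarrow>\<^sub>L 'a" assume "positive_op x"
  then have "positive_op_matrix 1 (\<lambda>i j. x)"
    by (simp add: positive_op_matrix_def positive_op_def)
  then have "positive_op_matrix 1 (\<lambda>i j. T x)"
    using assms by (simp add: completely_positive_map_def)
  then have T: "T x \<in> bops" "\<And>\<xi>. cinner (T x (\<xi> 0)) (\<xi> 0) \<in> \<real>\<^sub>\<ge>\<^sub>0"
    by (auto simp: positive_op_matrix_def)
  show "positive_op (T x)"
    unfolding positive_op_def using T(1) T(2)[of "\<lambda>_. \<xi>" for \<xi>] by simp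
qed

theorem theorem2p4:
  fixes A :: "('h::complex_hilbert \<Rightarrow>\<^sub>L 'h) set"
    and F :: "('h \<Rightarrow>\<^sub>L 'h) \<Rightarrow> ('e::topological_space \<Rightarrow>\<^sub>C complex)"
    and T :: "('h \<Rightarrow>\<^sub>L 'h) \<Rightarrow> ('h \<Rightarrow>\<^sub>L 'h)"
    and u :: "'e \<times> 'e \<Rightarrow> complex"
  assumes "abelian_cstar_subalgebra A"
    and "locally_compact_space (euclidean :: 'e topology)"
    and "star_hom_on A F" and "inj_on F A"
    and "T \<in> eh_tensor TYPE('i) A A"
    and "u = hom_tensor TYPE('i) A F T"
  shows "u \<in> eh_fun_tensor TYPE('i) (F ` A) \<and>
      eh_fun_tensor TYPE('i) (F ` A) \<subseteq> Vb TYPE('i) \<and>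
      (positive_map T \<longleftrightarrow> completely_positive_map T) \<and>
      (completely_positive_map T \<longleftrightarrow> positive_definite_fun u)"
proof -
  note A = assms(1) and F = assms(3) and inj = assms(4)
  obtain I :: "'i set" and a b where eh: "eh_series A A I a b" and T: "T = eh_map I a b"
    using assms(5) unfolding eh_tensor_def by blast
  have u: "u = fun_tensor I (\<lambda>i. apply_bcontfun (F (a i))) (\<lambda>i. apply_bcontfun (F (b i)))"
    using hom_tensor_eq[OF A F eh] assms(6) T by simp
  have "u \<in> eh_fun_tensor TYPE('i) (F ` A)"
    unfolding u by (rule fun_tensor_mem[OF A F eh])
  moreover have "eh_fun_tensor TYPE('i) (F ` A) \<subseteq> Vb TYPE('i)"
    unfolding eh_fun_tensor_def by blast
  moreover have "positive_definite_fun u \<Longrightarrow> completely_positive_map T"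
    unfolding T u positive_definite_iff_eh_form_nonneg[OF A F inj eh]
    by (rule eh_form_nonneg_completely_positive[OF A eh]) blast
  moreover have "completely_positive_map T \<Longrightarrow> positive_map T"
    by (rule completely_positive_imp_positive)
  moreover have "positive_map T \<Longrightarrow> positive_definite_fun u"
    unfolding T u positive_definite_iff_eh_form_nonneg[OF A F inj eh]
    using positive_map_eh_form_nonneg[OF A eh] by blast
  ultimately show ?thesis by blast
qed

end
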